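(* Let $K$ be a field, let $Q$ be a finite biserial quiver and let $Z$ be a set of paths in $Q$ of length at least $2$ such that $(Q,Z)$ is special. Let $\Gamma=\overline{KQ}/\overline{\langle Z\rangle}$ be the associated completed string algebra. Let $V=V[1]\sqcup\dots\sqcup V[n]$ be the primitive-nerve partition of $(Q,Z)$, let $R=K[|t_1,\dots,t_n|]$ be the power series ring, and let $I$ be the two-sided ideal of $RQ$ given by $$I=\langle Z\rangle+\sum_{i=1}^{n}\Big(\langle t_ie_v-\sigma_v\mid v\in V[i]\rangle+\langle t_ie_v\mid v\in Q_0\setminus V[i]\rangle\Big),$$ where $\sigma_v$ is the sum of the $Z$-primitive cycles at $v$. Then $\Gamma\cong RQ/I$ as $K$-algebras.
   Context: Quivers and paths. $Q=(Q_0,Q_1,h,t)$ has vertices $Q_0$, arrows $Q_1$, and each arrow $a$ has head $h(a)$ and tail $t(a)$. Trivial paths $e_v$ have length $0$ and head and tail $v$. A non-trivial path is $a_n\dots a_1$ with arrows satisfying $t(a_{i+1})=h(a_i)$, head $h(a_n)$, tail $t(a_1)$. In a path algebra $pq$ is the composite path if $t(p)=h(q)$ and $0$ otherwise. A cycle is a non-trivial path with equal head and tail; it is at $v$ if this vertex is $v$. $\langle\,\cdot\,\rangle$ denotes the two-sided ideal generated (in $KQ$ or in $RQ$). $Q$ is biserial if each vertex is the head of at most two arrows and the tail of at most two arrows. $(Q,Z)$ is special if for every arrow $b$ there is at most one arrow $a$ with $t(a)=h(b)$ and $ab\notin Z$, and at most one arrow $c$ with $h(c)=t(b)$ and $bc\notin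 Z$. A path is $Z$-admissible if no element of $Z$ is a subpath of it. A cycle $c$ is $Z$-primitive if every power $c^m$ ($m\ge 1$) is $Z$-admissible and $c$ is not a power of a shorter cycle. For a path $p$, $V(p)$ is the set of vertices traversed by $p$ (heads and tails of its arrows). $V=\bigcup_cV(c)$ with $c$ running over $Z$-primitive cycles, and the primitive-nerve partition $V=V[1]\sqcup\dots\sqcup V[n]$ is the partition into classes of the equivalence relation generated by $\bigcup_cV(c)\times V(c)$. Completed string algebra (Ricke). Let $B$ be the ideal of $KQ$ generated by the arrows and $H=\langle Z\rangle\subseteq KQ$. $\overline{KQ}$ is the $B$-adic completion of $KQ$, and $\overline{\langle Z\rangle}=\overline{H}$ is the closure of $H$ in $\overline{KQ}$, i.e. $\bigcap_{d>0}(H+\overline{B^d})$ with $\overline{B^d}$ the kernel of $\overline{KQ}\to KQ/B^d$. The quotient $\overline{KQ}/\overline{H}$ is the completion of $KQ/H$ in the $(B+H)/H$-adic topology, that is, $\varprojlim_d KQ/(H+B^d)$. *)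

theory Defs
  imports "HOL-Algebra.Algebra" "Graph_Theory.Arc_Walk"
begin

section \<open>Quivers and paths\<close>

text \<open>A quiver is a \<^typ>\<open>('v, 'a) pre_digraph\<close> (loops and parallel arrows are allowed); a finite
  quiver is a \<^locale>\<open>fin_digraph\<close>.  A path is a pair of its tail and the list of its arrows in the
  order in which they are traversed: the path written \<open>a\<^sub>n \<dots> a\<^sub>1\<close> is \<open>(tail a\<^sub>1, [a\<^sub>1, \<dots>, a\<^sub>n])\<close>, and
  the trivial path at \<open>v\<close> is \<open>(v, [])\<close>.\<close>

type_synonym ('v, 'a) qpath = "'v \<times> 'a list"

definition paths :: "('v, 'a) pre_digraph \<Rightarrow> ('v, 'a) qpath set" where
  "paths Q = {(v, as). \<exists>w. pre_digraph.awalk Q v as w}"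

definition path_tail :: "('v, 'a) qpath \<Rightarrow> 'v" where
  "path_tail p = fst p"

definition path_head :: "('v, 'a) pre_digraph \<Rightarrow> ('v, 'a) qpath \<Rightarrow> 'v" where
  "path_head Q p = last (pre_digraph.awalk_verts Q (fst p) (snd p))"

definition path_length :: "('v, 'a) qpath \<Rightarrow> nat" where
  "path_length p = length (snd p)"

definition trivial_path :: "'v \<Rightarrow> ('v, 'a) qpath" where
  "trivial_path v = (v, [])"

definition arrow_path :: "('v, 'a) pre_digraph \<Rightarrow> 'a \<Rightarrow> ('v, 'a) qpath" where
  "arrow_path Q a = (tail Q a, [a])"

text \<open>\<open>path_comp p q\<close> is the composite \<open>pq\<close>, that is, first \<open>q\<close> and then \<open>p\<close>; it is only meaningful
  if \<open>path_tail p = path_head Q q\<close>.\<close>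

definition path_comp :: "('v, 'a) qpath \<Rightarrow> ('v, 'a) qpath \<Rightarrow> ('v, 'a) qpath" where
  "path_comp p q = (fst q, snd q @ snd p)"

definition subpath :: "('v, 'a) pre_digraph \<Rightarrow> ('v, 'a) qpath \<Rightarrow> ('v, 'a) qpath \<Rightarrow> bool" where
  "subpath Q z p \<longleftrightarrow> (\<exists>q\<in>paths Q. \<exists>r\<in>paths Q. z \<in> paths Q \<and>
     path_tail q = path_head Q z \<and> path_tail z = path_head Q r \<and>
     p = path_comp q (path_comp z r))"

definition quiver_cycle :: "('v, 'a) pre_digraph \<Rightarrow> ('v, 'a) qpath \<Rightarrow> bool" where
  "quiver_cycle Q c \<longleftrightarrow> c \<in> paths Q \<and> 0 < path_length c \<and> path_head Q c = path_tail c"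

definition path_pow :: "('v, 'a) qpath \<Rightarrow> nat \<Rightarrow> ('v, 'a) qpath" where
  "path_pow c m = (fst c, concat (replicate m (snd c)))"

definition biserial :: "('v, 'a) pre_digraph \<Rightarrow> bool" where
  "biserial Q \<longleftrightarrow> (\<forall>v\<in>verts Q. card {a \<in> arcs Q. head Q a = v} \<le> 2 \<and>
                             card {a \<in> arcs Q. tail Q a = v} \<le> 2)"

definition special :: "('v, 'a) pre_digraph \<Rightarrow> ('v, 'a) qpath set \<Rightarrow> bool" where
  "special Q Z \<longleftrightarrow> (\<forall>b\<in>arcs Q.
     (\<exists>\<^sub>\<le>\<^sub>1 a. a \<in> arcs Q \<and> tail Q a = head Q b \<and>
             path_comp (arrow_path Q a) (arrow_path Q b) \<notin> Z) \<and>
     (\<exists>\<^sub>\<le>\<^sub>1 c. c \<in> arcs Q \<and> head Q c = tail Q b \<and>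
             path_comp (arrow_path Q b) (arrow_path Q c) \<notin> Z))"

definition admissible :: "('v, 'a) pre_digraph \<Rightarrow> ('v, 'a) qpath set \<Rightarrow> ('v, 'a) qpath \<Rightarrow> bool" where
  "admissible Q Z p \<longleftrightarrow> p \<in> paths Q \<and> \<not> (\<exists>z\<in>Z. subpath Q z p)"

definition primitive_cycle ::
    "('v, 'a) pre_digraph \<Rightarrow> ('v, 'a) qpath set \<Rightarrow> ('v, 'a) qpath \<Rightarrow> bool" where
  "primitive_cycle Q Z c \<longleftrightarrow> quiver_cycle Q c \<and>
     (\<forall>m\<ge>1. admissible Q Z (path_pow c m)) \<and>
     \<not> (\<exists>c' m. quiver_cycle Q c' \<and> path_length c' < path_length c \<and> c = path_pow c' m)"

definition path_verts :: "('v, 'a) pre_digraph \<Rightarrow> ('v, 'a) qpath \<Rightarrow> 'v set" where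
  "path_verts Q p = head Q ` set (snd p) \<union> tail Q ` set (snd p)"

definition nerve_verts :: "('v, 'a) pre_digraph \<Rightarrow> ('v, 'a) qpath set \<Rightarrow> 'v set" where
  "nerve_verts Q Z = (\<Union>c\<in>{c. primitive_cycle Q Z c}. path_verts Q c)"

definition nerve_equiv :: "('v, 'a) pre_digraph \<Rightarrow> ('v, 'a) qpath set \<Rightarrow> ('v \<times> 'v) set" where
  "nerve_equiv Q Z = \<Inter>{E. equiv (nerve_verts Q Z) E \<and>
     (\<Union>c\<in>{c. primitive_cycle Q Z c}. path_verts Q c \<times> path_verts Q c) \<subseteq> E}"

definition nerve_partition :: "('v, 'a) pre_digraph \<Rightarrow> ('v, 'a) qpath set \<Rightarrow> 'v set set" where
  "nerve_partition Q Z = nerve_verts Q Z // nerve_equiv Q Z"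


section \<open>Algebras\<close>

text \<open>An algebra over \<open>K\<close> is recorded as a \<^typ>\<open>('k, 'x) module\<close>, i.e. a ring together with a
  scalar multiplication.  The library locale \<^locale>\<open>algebra\<close> is not used since it only covers
  commutative algebras.\<close>

definition is_alg_iso ::
    "('k, 'l) ring_scheme \<Rightarrow> ('k, 'x, 'm) module_scheme \<Rightarrow> ('k, 'y, 'n) module_scheme \<Rightarrow> bool" where
  "is_alg_iso K A B \<longleftrightarrow> (\<exists>h\<in>ring_iso A B.
     \<forall>k\<in>carrier K. \<forall>x\<in>carrier A. h (k \<odot>\<^bsub>A\<^esub> x) = k \<odot>\<^bsub>B\<^esub> h x)"

definition quotient_algebra ::
    "('k, 'x, 'm) module_scheme \<Rightarrow> 'x set \<Rightarrow> ('k, 'x set) module" where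
  "quotient_algebra A I = ring.extend (A Quot I)
     (module.fields (\<lambda>k U. \<Union>x\<in>U. I +>\<^bsub>A\<^esub> (k \<odot>\<^bsub>A\<^esub> x)))"

text \<open>Restriction of scalars from \<open>R\<close> to \<open>K\<close>, where \<open>A\<close> is an \<open>R\<close>-algebra and \<open>R\<close> is a
  commutative \<open>K\<close>-algebra.\<close>

definition restrict_scalars ::
    "('k, 'r, 'm) module_scheme \<Rightarrow> ('r, 'x, 'n) module_scheme \<Rightarrow> ('k, 'x) module" where
  "restrict_scalars R A = \<lparr>carrier = carrier A, monoid.mult = monoid.mult A, one = one A,
     ring.zero = ring.zero A, ring.add = ring.add A, smult = (\<lambda>k x. (k \<odot>\<^bsub>R\<^esub> \<one>\<^bsub>R\<^esub>) \<odot>\<^bsub>A\<^esub> x)\<rparr>"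

text \<open>The path algebra: finitely supported functions on the set of paths, extended by zero.\<close>

definition path_algebra ::
    "('r, 'm) ring_scheme \<Rightarrow> ('v, 'a) pre_digraph \<Rightarrow> ('r, ('v, 'a) qpath \<Rightarrow> 'r) module" where
  "path_algebra R Q = \<lparr>
     carrier = {f. (\<forall>p\<in>paths Q. f p \<in> carrier R) \<and> (\<forall>p. p \<notin> paths Q \<longrightarrow> f p = \<zero>\<^bsub>R\<^esub>) \<and>
                   finite {p. f p \<noteq> \<zero>\<^bsub>R\<^esub>}},
     monoid.mult = (\<lambda>f g p. finsum R (\<lambda>(q, r). f q \<otimes>\<^bsub>R\<^esub> g r)
               {(q, r). q \<in> paths Q \<and> r \<in> paths Q \<and> path_tail q = path_head Q r \<and>
                        path_comp q r = p}),
     one = (\<lambda>p. if p \<in> trivial_path ` verts Q then \<one>\<^bsub>R\<^esub> else \<zero>\<^bsub>R\<^esub>),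
     ring.zero = (\<lambda>p. \<zero>\<^bsub>R\<^esub>),
     ring.add = (\<lambda>f g p. f p \<oplus>\<^bsub>R\<^esub> g p),
     smult = (\<lambda>k f p. k \<otimes>\<^bsub>R\<^esub> f p)\<rparr>"

definition path_elem :: "('r, 'm) ring_scheme \<Rightarrow> ('v, 'a) qpath \<Rightarrow> (('v, 'a) qpath \<Rightarrow> 'r)" where
  "path_elem R p = (\<lambda>q. if q = p then \<one>\<^bsub>R\<^esub> else \<zero>\<^bsub>R\<^esub>)"

text \<open>The power series ring over \<open>K\<close> in the commuting variables \<open>t\<^sub>i\<close>, \<open>i \<in> S\<close>, for a finite set
  \<open>S\<close>.  As in \<^theory>\<open>HOL-Algebra.Indexed_Polynomials\<close>, monomials are multisets of indices.\<close>

definition power_series_ring ::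
    "('k, 'm) ring_scheme \<Rightarrow> 'i set \<Rightarrow> ('k, 'i multiset \<Rightarrow> 'k) module" where
  "power_series_ring K S = \<lparr>
     carrier = {f. \<forall>m. (set_mset m \<subseteq> S \<longrightarrow> f m \<in> carrier K) \<and>
                       (\<not> set_mset m \<subseteq> S \<longrightarrow> f m = \<zero>\<^bsub>K\<^esub>)},
     monoid.mult = (\<lambda>f g m. finsum K (\<lambda>(a, b). f a \<otimes>\<^bsub>K\<^esub> g b) {(a, b). a + b = m}),
     one = (\<lambda>m. if m = {#} then \<one>\<^bsub>K\<^esub> else \<zero>\<^bsub>K\<^esub>),
     ring.zero = (\<lambda>m. \<zero>\<^bsub>K\<^esub>),
     ring.add = (\<lambda>f g m. f m \<oplus>\<^bsub>K\<^esub> g m),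
     smult = (\<lambda>k f m. k \<otimes>\<^bsub>K\<^esub> f m)\<rparr>"

definition ps_var :: "('k, 'm) ring_scheme \<Rightarrow> 'i \<Rightarrow> ('i multiset \<Rightarrow> 'k)" where
  "ps_var K i = (\<lambda>m. if m = {#i#} then \<one>\<^bsub>K\<^esub> else \<zero>\<^bsub>K\<^esub>)"


section \<open>Adic completion\<close>

primrec ideal_pow :: "('x, 'm) ring_scheme \<Rightarrow> 'x set \<Rightarrow> nat \<Rightarrow> 'x set" where
  "ideal_pow A B 0 = carrier A"
| "ideal_pow A B (Suc d) = ideal_prod A B (ideal_pow A B d)"

text \<open>The completion is the inverse limit of the quotients \<open>A / B\<^sup>d\<close>, realised as the algebra of
  compatible families; the transition map \<open>A / B\<^sup>d\<^sup>+\<^sup>1 \<rightarrow> A / B\<^sup>d\<close> sends a coset \<open>U\<close> to \<open>B\<^sup>d + U\<close>.\<close>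

definition adic_completion ::
    "('k, 'x, 'm) module_scheme \<Rightarrow> 'x set \<Rightarrow> ('k, nat \<Rightarrow> 'x set) module" where
  "adic_completion A B = (let q = (\<lambda>d. quotient_algebra A (ideal_pow A B d)) in \<lparr>
     carrier = {x. \<forall>d. x d \<in> carrier (q d) \<and> ideal_pow A B d <+>\<^bsub>A\<^esub> x (Suc d) = x d},
     monoid.mult = (\<lambda>x y d. x d \<otimes>\<^bsub>q d\<^esub> y d),
     one = (\<lambda>d. \<one>\<^bsub>q d\<^esub>),
     ring.zero = (\<lambda>d. \<zero>\<^bsub>q d\<^esub>),
     ring.add = (\<lambda>x y d. x d \<oplus>\<^bsub>q d\<^esub> y d),
     smult = (\<lambda>k x d. k \<odot>\<^bsub>q d\<^esub> x d)\<rparr>)"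

definition to_completion ::
    "('k, 'x, 'm) module_scheme \<Rightarrow> 'x set \<Rightarrow> 'x \<Rightarrow> (nat \<Rightarrow> 'x set)" where
  "to_completion A B a = (\<lambda>d. ideal_pow A B d +>\<^bsub>A\<^esub> a)"

definition completed_pow ::
    "('k, 'x, 'm) module_scheme \<Rightarrow> 'x set \<Rightarrow> nat \<Rightarrow> (nat \<Rightarrow> 'x set) set" where
  "completed_pow A B d =
     a_kernel (adic_completion A B) (quotient_algebra A (ideal_pow A B d)) (\<lambda>x. x d)"

definition completion_closure ::
    "('k, 'x, 'm) module_scheme \<Rightarrow> 'x set \<Rightarrow> 'x set \<Rightarrow> (nat \<Rightarrow> 'x set) set" where
  "completion_closure A B H = (\<Inter>d\<in>{0<..}.
     to_completion A B ` H <+>\<^bsub>adic_completion A B\<^esub> completed_pow A B d)"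


section \<open>The two algebras\<close>

definition arrow_ideal ::
    "('k, 'm) ring_scheme \<Rightarrow> ('v, 'a) pre_digraph \<Rightarrow> (('v, 'a) qpath \<Rightarrow> 'k) set" where
  "arrow_ideal K Q = Idl\<^bsub>path_algebra K Q\<^esub> ((\<lambda>a. path_elem K (arrow_path Q a)) ` arcs Q)"

definition path_ideal ::
    "('r, 'm) ring_scheme \<Rightarrow> ('v, 'a) pre_digraph \<Rightarrow> ('v, 'a) qpath set
      \<Rightarrow> (('v, 'a) qpath \<Rightarrow> 'r) set" where
  "path_ideal R Q Z = Idl\<^bsub>path_algebra R Q\<^esub> (path_elem R ` Z)"

definition completed_string_algebra ::
    "('k, 'm) ring_scheme \<Rightarrow> ('v, 'a) pre_digraph \<Rightarrow> ('v, 'a) qpath set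
      \<Rightarrow> ('k, (nat \<Rightarrow> (('v, 'a) qpath \<Rightarrow> 'k) set) set) module" where
  "completed_string_algebra K Q Z =
     quotient_algebra (adic_completion (path_algebra K Q) (arrow_ideal K Q))
       (completion_closure (path_algebra K Q) (arrow_ideal K Q) (path_ideal K Q Z))"

definition cycle_sum ::
    "('r, 'm) ring_scheme \<Rightarrow> ('v, 'a) pre_digraph \<Rightarrow> ('v, 'a) qpath set \<Rightarrow> 'v
      \<Rightarrow> (('v, 'a) qpath \<Rightarrow> 'r)" where
  "cycle_sum R Q Z v =
     finsum (path_algebra R Q) (path_elem R) {c. primitive_cycle Q Z c \<and> path_tail c = v}"

text \<open>The ideal \<open>I\<close> of \<open>RQ\<close>, where \<open>W 1, \<dots>, W n\<close> are the classes of the primitive-nerve partition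
  and \<open>t i \<in> R\<close>; the \<open>foldr\<close> is the finite sum of ideals over \<open>i = 1, \<dots>, n\<close>.\<close>

definition nerve_ideal ::
    "('r, 'm) ring_scheme \<Rightarrow> (nat \<Rightarrow> 'r) \<Rightarrow> ('v, 'a) pre_digraph \<Rightarrow> ('v, 'a) qpath set
      \<Rightarrow> nat \<Rightarrow> (nat \<Rightarrow> 'v set) \<Rightarrow> (('v, 'a) qpath \<Rightarrow> 'r) set" where
  "nerve_ideal R t Q Z n W = (let RQ = path_algebra R Q;
       te = (\<lambda>i v. t i \<odot>\<^bsub>RQ\<^esub> path_elem R (trivial_path v)) in
     path_ideal R Q Z <+>\<^bsub>RQ\<^esub>
     foldr (\<lambda>i J.
         (Idl\<^bsub>RQ\<^esub> {te i v \<ominus>\<^bsub>RQ\<^esub> cycle_sum R Q Z v | v. v \<in> W i} <+>\<^bsub>RQ\<^esub>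
          Idl\<^bsub>RQ\<^esub> {te i v | v. v \<in> verts Q - W i}) <+>\<^bsub>RQ\<^esub> J)
       [1..<Suc n] {\<zero>\<^bsub>RQ\<^esub>})"

end

theory Submission
  imports Defs
begin

text \<open>
  Both algebras map onto a third one: the algebra \<open>\<Gamma>\<close> of all functions on the admissible paths,
  that is, of possibly infinite formal sums of admissible paths, in which a product of two paths is
  their composite if this is admissible and zero otherwise.  Two quotients are isomorphic if they
  are quotients by the kernels of two surjections onto the same algebra
  (\<open>alg_iso_of_common_image\<close>), so it remains to find the two surjections and their kernels.

  On the completed side, the power \<open>B\<^sup>d\<close> of the arrow ideal is spanned by the paths of length at
  least \<open>d\<close>, so an element of the completion is an arbitrary function on paths.  Every factor of an
  admissible path is admissible; hence restriction to the admissible paths is a homomorphism onto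
  \<open>\<Gamma>\<close> (\<open>to_admissible_hom\<close>).  If a function vanishes on the admissible paths, then its truncations
  lie in \<open>\<langle>Z\<rangle>\<close>, so the kernel is the closure of \<open>\<langle>Z\<rangle>\<close> (\<open>to_admissible_kernel\<close>).

  On the side of \<open>RQ\<close>, specialness says that an arrow has at most one admissible successor and at
  most one admissible predecessor.  So an admissible path is determined by its first arrow and its
  length, a primitive cycle is determined by its first arrow (\<open>prim_unique\<close>), an arrow that starts
  arbitrarily long admissible paths starts a primitive cycle (\<open>noncyclic_bounded\<close>), and every
  admissible path starting with such an arrow runs along that cycle (\<open>cyclic_split\<close>).  Let \<open>\<tau>\<^sub>i\<close> be
  the sum in \<open>\<Gamma>\<close> of all primitive cycles in the class \<open>V[i]\<close>.  Distinct primitive cycles have no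
  admissible composite, so the powers of \<open>\<tau>\<^sub>i\<close> are the sums of the powers of these cycles, and
  \<open>\<tau>\<^sub>i \<tau>\<^sub>j = 0\<close> for \<open>i \<noteq> j\<close> (\<open>act_mult\<close>).  Moving a cycle past an arrow rotates it, so \<open>\<tau>\<^sub>i\<close> is central
  (\<open>act_commutes\<close>).  Substituting \<open>\<tau>\<^sub>i\<close> for \<open>t\<^sub>i\<close> is therefore a homomorphism \<open>\<psi>\<close> from \<open>RQ\<close> to \<open>\<Gamma>\<close>
  (\<open>\<psi>_hom\<close>), and it kills the ideal \<open>I\<close>.

  That the kernel is no larger follows from a normal form.  Let \<open>p\<close> be an admissible path starting
  at \<open>v\<close>.  Modulo \<open>I\<close> the product \<open>t\<^sub>i p\<close> vanishes unless \<open>v\<close> lies in \<open>V[i]\<close>, and then it is the sum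
  of the paths \<open>p c\<close> for the primitive cycles \<open>c\<close> at \<open>v\<close>.  If \<open>p\<close> is not trivial, then only the
  cycle with the same first arrow contributes to this sum, so full turns of a cycle can be traded
  for powers of \<open>t\<^sub>i\<close>.  Every element is thus congruent to a combination of trivial paths and of paths
  off the primitive cycles, with coefficients in the field, and of paths that make at most one
  turn of a primitive cycle of class \<open>i\<close>, with power series in \<open>t\<^sub>i\<close> as coefficients
  (\<open>all_reducible\<close>).  As every admissible path off the trivial ones and off the cycles is of this
  kind and every other nontrivial one is uniquely \<open>q c\<^sup>k\<close> with \<open>q\<close> of this kind, these normal forms
  correspond to the functions on admissible paths (\<open>\<psi>_\<theta>\<close>).  Only finitely many paths occur in normal
  forms (\<open>finite_base_paths\<close>), which is why an arbitrary function on admissible paths comes from a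
  finitely supported element of \<open>RQ\<close>.
\<close>


section \<open>Finite sums in abelian monoids\<close>

lemma (in abelian_monoid) finsum_eq_single:
  assumes "finite A" "a \<in> A" "f a \<in> carrier G" "\<And>x. x \<in> A \<Longrightarrow> x \<noteq> a \<Longrightarrow> f x = \<zero>"
  shows "finsum G f A = f a"
proof -
  have "finsum G f A = finsum G f {a}"
    by (rule add.finprod_mono_neutral_cong_right) (use assms in \<open>auto simp: Pi_def, metis zero_closed\<close>)
  then show ?thesis using assms(3) by simp
qed

lemma (in abelian_monoid) finsum_eq_zero:
  assumes "\<And>x. x \<in> A \<Longrightarrow> f x = \<zero>"
  shows "finsum G f A = \<zero>"
  using assms by (rule add.finprod_one_eqI)

lemma (in abelian_monoid) finsum_Sigma:
  assumes "finite I" "\<And>i. i \<in> I \<Longrightarrow> finite (A i)"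
    "\<And>i j. i \<in> I \<Longrightarrow> j \<in> A i \<Longrightarrow> f i j \<in> carrier G"
  shows "(\<Oplus>i\<in>I. \<Oplus>j\<in>A i. f i j) = finsum G (\<lambda>(i, j). f i j) (Sigma I A)"
  using assms
proof (induction I rule: finite_induct)
  case (insert i I)
  have S: "Sigma (insert i I) A = (Pair i ` A i) \<union> Sigma I A"
    by auto
  have "finsum G (\<lambda>(i, j). f i j) (Sigma (insert i I) A)
      = finsum G (\<lambda>(i, j). f i j) (Pair i ` A i) \<oplus> finsum G (\<lambda>(i, j). f i j) (Sigma I A)"
    unfolding S
    by (rule finsum_Un_disjoint) (use insert in \<open>auto intro: finite_SigmaI\<close>)
  also have "finsum G (\<lambda>(i, j). f i j) (Pair i ` A i) = (\<Oplus>j\<in>A i. f i j)"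
    by (subst finsum_reindex) (use insert in \<open>auto simp: inj_on_def\<close>)
  also have "(\<Oplus>j\<in>A i. f i j) \<oplus> finsum G (\<lambda>(i, j). f i j) (Sigma I A)
      = (\<Oplus>i\<in>insert i I. \<Oplus>j\<in>A i. f i j)"
    by (subst finsum_insert) (use insert in \<open>auto intro!: finsum_closed\<close>)
  finally show ?case by simp
qed auto

lemma (in abelian_monoid) finsum_bij_betw:
  assumes "bij_betw h A B" "\<And>x. x \<in> A \<Longrightarrow> f x = g (h x)" "\<And>y. y \<in> B \<Longrightarrow> g y \<in> carrier G"
  shows "finsum G f A = finsum G g B"
proof -
  have B: "B = h ` A" and inj: "inj_on h A"
    using assms(1) by (auto simp: bij_betw_def)
  have "finsum G g (h ` A) = finsum G (\<lambda>x. g (h x)) A"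
    by (rule finsum_reindex) (use assms B inj in auto)
  also have "\<dots> = finsum G f A"
    by (rule finsum_cong') (use assms B in auto)
  finally show ?thesis by (simp add: B)
qed


section \<open>Convolution over a partial monoid\<close>

text \<open>Power series, path algebras and the algebra of admissible paths are all algebras of functions
  under convolution over a partially defined product.  Associativity needs only that a triple product
  is defined in one bracketing iff it is in the other; cancellation makes multiplication with a single
  path a mere shift of coefficients.  The set \<open>P\<close> is the part of the index type on which functions may
  be non-zero, and \<open>U\<close> is the set of local units: the trivial paths, or the monomial 1.\<close>

locale partial_monoid =
  fixes P :: "'p set" and ok :: "'p \<Rightarrow> 'p \<Rightarrow> bool" and mul :: "'p \<Rightarrow> 'p \<Rightarrow> 'p" and U :: "'p set"
  assumes finite_factorisations: "finite {(q, r). ok q r \<and> mul q r = p}"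
    and ok_assoc: "ok q r \<and> ok (mul q r) s \<longleftrightarrow> ok r s \<and> ok q (mul r s)"
    and mul_assoc: "ok q r \<Longrightarrow> ok (mul q r) s \<Longrightarrow> mul (mul q r) s = mul q (mul r s)"
    and cancel_left: "ok q r \<Longrightarrow> ok q s \<Longrightarrow> mul q r = mul q s \<Longrightarrow> r = s"
    and cancel_right: "ok q s \<Longrightarrow> ok r s \<Longrightarrow> mul q s = mul r s \<Longrightarrow> q = r"
    and mul_in_iff: "ok q r \<Longrightarrow> mul q r \<in> P \<longleftrightarrow> q \<in> P \<and> r \<in> P"
    and units: "U \<subseteq> P"
    and unit_left: "u \<in> U \<Longrightarrow> ok u p \<Longrightarrow> mul u p = p"
    and unit_right: "u \<in> U \<Longrightarrow> ok p u \<Longrightarrow> mul p u = p"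
    and ex1_unit_left: "p \<in> P \<Longrightarrow> \<exists>!u. u \<in> U \<and> ok u p"
    and ex1_unit_right: "p \<in> P \<Longrightarrow> \<exists>!u. u \<in> U \<and> ok p u"

locale convolution = partial_monoid P ok mul U + cring R
  for P :: "'p set" and ok mul U and R (structure)
begin

definition factorisations :: "'p \<Rightarrow> ('p \<times> 'p) set" where
  "factorisations p = {(q, r). ok q r \<and> mul q r = p}"

definition coeffs :: "('p \<Rightarrow> 'a) set" where
  "coeffs = {f. (\<forall>p\<in>P. f p \<in> carrier R) \<and> (\<forall>p. p \<notin> P \<longrightarrow> f p = \<zero>)}"

definition conv :: "('p \<Rightarrow> 'a) \<Rightarrow> ('p \<Rightarrow> 'a) \<Rightarrow> 'p \<Rightarrow> 'a" where
  "conv f g = (\<lambda>p. finsum R (\<lambda>(q, r). f q \<otimes> g r) (factorisations p))"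

definition conv_one :: "'p \<Rightarrow> 'a" where
  "conv_one = (\<lambda>p. if p \<in> U then \<one> else \<zero>)"

lemma finite_facs [simp, intro]: "finite (factorisations p)"
  unfolding factorisations_def by (rule finite_factorisations)

lemma coeffs_closed [simp]: "f \<in> coeffs \<Longrightarrow> f p \<in> carrier R"
  by (cases "p \<in> P") (auto simp: coeffs_def)

lemma coeffs_outside: "f \<in> coeffs \<Longrightarrow> p \<notin> P \<Longrightarrow> f p = \<zero>"
  unfolding coeffs_def by blast

lemma coeffsI:
  "(\<And>p. f p \<in> carrier R) \<Longrightarrow> (\<And>p. p \<notin> P \<Longrightarrow> f p = \<zero>) \<Longrightarrow> f \<in> coeffs"
  unfolding coeffs_def by blast

lemma conv_summand_closed [simp]:
  "f \<in> coeffs \<Longrightarrow> g \<in> coeffs \<Longrightarrow> (\<lambda>(q, r). f q \<otimes> g r) \<in> A \<rightarrow> carrier R"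
  by auto

lemma conv_nonzero:
  assumes "f \<in> coeffs" "g \<in> coeffs" "conv f g p \<noteq> \<zero>"
  obtains q r where "ok q r" "p = mul q r" "f q \<noteq> \<zero>" "g r \<noteq> \<zero>"
proof -
  have "\<exists>x\<in>factorisations p. (case x of (q, r) \<Rightarrow> f q \<otimes> g r) \<noteq> \<zero>"
    using assms(3) unfolding conv_def using finsum_eq_zero[of "factorisations p"] by blast
  then obtain q r where "(q, r) \<in> factorisations p" "f q \<otimes> g r \<noteq> \<zero>"
    by auto
  moreover from this have "f q \<noteq> \<zero>" "g r \<noteq> \<zero>"
    using assms by auto
  ultimately show ?thesis
    using that[of q r] by (simp add: factorisations_def)
qed

lemma conv_closed:
  assumes "f \<in> coeffs" "g \<in> coeffs"
  shows "conv f g \<in> coeffs"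
proof (rule coeffsI)
  show "conv f g p \<in> carrier R" for p
    unfolding conv_def by (rule finsum_closed) (rule conv_summand_closed[OF assms])
  show "conv f g p = \<zero>" if "p \<notin> P" for p
    using conv_nonzero[OF assms, of p] coeffs_outside assms mul_in_iff that by metis
qed

lemma conv_one_closed: "conv_one \<in> coeffs"
  using units by (auto simp: conv_one_def intro!: coeffsI)

lemma conv_add_left:
  assumes "f \<in> coeffs" "g \<in> coeffs" "h \<in> coeffs"
  shows "conv (\<lambda>p. f p \<oplus> g p) h = (\<lambda>p. conv f h p \<oplus> conv g h p)"
proof
  fix p
  have "conv (\<lambda>p. f p \<oplus> g p) h p
      = (\<Oplus>x\<in>factorisations p. (case x of (q, r) \<Rightarrow> f q \<otimes> h r) \<oplus> (case x of (q, r) \<Rightarrow> g q \<otimes> h r))"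
    unfolding conv_def
    by (rule finsum_cong') (use assms in \<open>auto simp: l_distr\<close>)
  also have "\<dots> = conv f h p \<oplus> conv g h p"
    unfolding conv_def by (rule finsum_addf) (use assms in auto)
  finally show "conv (\<lambda>p. f p \<oplus> g p) h p = conv f h p \<oplus> conv g h p" .
qed

lemma conv_add_right:
  assumes "f \<in> coeffs" "g \<in> coeffs" "h \<in> coeffs"
  shows "conv h (\<lambda>p. f p \<oplus> g p) = (\<lambda>p. conv h f p \<oplus> conv h g p)"
proof
  fix p
  have "conv h (\<lambda>p. f p \<oplus> g p) p
      = (\<Oplus>x\<in>factorisations p. (case x of (q, r) \<Rightarrow> h q \<otimes> f r) \<oplus> (case x of (q, r) \<Rightarrow> h q \<otimes> g r))"
    unfolding conv_def
    by (rule finsum_cong') (use assms in \<open>auto simp: r_distr\<close>)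
  also have "\<dots> = conv h f p \<oplus> conv h g p"
    unfolding conv_def by (rule finsum_addf) (use assms in auto)
  finally show "conv h (\<lambda>p. f p \<oplus> g p) p = conv h f p \<oplus> conv h g p" .
qed

lemma conv_scale_left:
  assumes "f \<in> coeffs" "g \<in> coeffs" "k \<in> carrier R"
  shows "conv (\<lambda>p. k \<otimes> f p) g = (\<lambda>p. k \<otimes> conv f g p)"
proof
  fix p
  have "conv (\<lambda>p. k \<otimes> f p) g p
      = (\<Oplus>x\<in>factorisations p. k \<otimes> (case x of (q, r) \<Rightarrow> f q \<otimes> g r))"
    unfolding conv_def
    by (rule finsum_cong') (use assms in \<open>auto simp: m_assoc\<close>)
  also have "\<dots> = k \<otimes> conv f g p"
    unfolding conv_def by (rule finsum_rdistr[symmetric]) (use assms in auto)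
  finally show "conv (\<lambda>p. k \<otimes> f p) g p = k \<otimes> conv f g p" .
qed

text \<open>Both bracketings are sums over the factorisations into three factors.\<close>

lemma conv_assoc:
  assumes "f \<in> coeffs" "g \<in> coeffs" "h \<in> coeffs"
  shows "conv (conv f g) h = conv f (conv g h)"
proof
  fix p
  let ?L = "Sigma (factorisations p) (\<lambda>(u, s). factorisations u)"
  let ?R = "Sigma (factorisations p) (\<lambda>(q, v). factorisations v)"
  have "conv (conv f g) h p
      = (\<Oplus>x\<in>factorisations p. \<Oplus>y\<in>(case x of (u, s) \<Rightarrow> factorisations u). f (fst y) \<otimes> g (snd y) \<otimes> h (snd x))"
    unfolding conv_def
    by (rule finsum_cong')
      (use assms in \<open>auto simp: case_prod_beta finsum_ldistr intro!: finsum_closed\<close>)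
  also have "\<dots> = finsum R (\<lambda>(x, y). f (fst y) \<otimes> g (snd y) \<otimes> h (snd x)) ?L"
    by (rule finsum_Sigma) (use assms in auto)
  also have "\<dots> = finsum R (\<lambda>(x, y). f (fst x) \<otimes> (g (fst y) \<otimes> h (snd y))) ?R"
  proof (rule finsum_bij_betw)
    show "bij_betw (\<lambda>((u, s), (q, r)). ((q, mul r s), (r, s))) ?L ?R"
    proof (rule bij_betwI[where g = "\<lambda>((q, v), (r, s)). ((mul q r, s), (q, r))"])
      show "(\<lambda>((u, s), (q, r)). ((q, mul r s), (r, s))) \<in> ?L \<rightarrow> ?R"
      proof
        fix x assume "x \<in> ?L"
        then obtain q r s where x: "x = ((mul q r, s), (q, r))"
          and "ok q r" "ok (mul q r) s" "p = mul (mul q r) s"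
          by (auto simp: factorisations_def)
        then show "(\<lambda>((u, s), (q, r)). ((q, mul r s), (r, s))) x \<in> ?R"
          using ok_assoc[of q r s] mul_assoc[of q r s] by (simp add: factorisations_def)
      qed
      show "(\<lambda>((q, v), (r, s)). ((mul q r, s), (q, r))) \<in> ?R \<rightarrow> ?L"
      proof
        fix x assume "x \<in> ?R"
        then obtain q r s where x: "x = ((q, mul r s), (r, s))"
          and "ok r s" "ok q (mul r s)" "p = mul q (mul r s)"
          by (auto simp: factorisations_def)
        then show "(\<lambda>((q, v), (r, s)). ((mul q r, s), (q, r))) x \<in> ?L"
          using ok_assoc[of q r s] mul_assoc[of q r s] by (simp add: factorisations_def)
      qed
    qed (auto simp: factorisations_def)
  qed (use assms in \<open>auto simp: m_assoc\<close>)
  also have "\<dots> = (\<Oplus>x\<in>factorisations p. \<Oplus>y\<in>(case x of (q, v) \<Rightarrow> factorisations v). f (fst x) \<otimes> (g (fst y) \<otimes> h (snd y)))"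
    by (rule finsum_Sigma[symmetric]) (use assms in auto)
  also have "\<dots> = conv f (conv g h) p"
    unfolding conv_def
    by (rule finsum_cong')
      (use assms in \<open>auto simp: case_prod_beta finsum_rdistr intro!: finsum_closed\<close>)
  finally show "conv (conv f g) h p = conv f (conv g h) p" .
qed

lemma conv_one_left:
  assumes "f \<in> coeffs"
  shows "conv conv_one f = f"
proof
  fix p
  show "conv conv_one f p = f p"
  proof (cases "p \<in> P")
    case False
    then show ?thesis
      using conv_closed[OF conv_one_closed assms] assms False by (simp add: coeffs_outside)
  next
    case True
    then obtain u where u: "u \<in> U" "ok u p" and uniq: "\<And>w. w \<in> U \<Longrightarrow> ok w p \<Longrightarrow> w = u"
      using ex1_unit_left[OF True] by blast
    have "conv conv_one f p = (case (u, p) of (q, r) \<Rightarrow> conv_one q \<otimes> f r)"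
      unfolding conv_def
    proof (rule finsum_eq_single)
      fix x assume "x \<in> factorisations p" "x \<noteq> (u, p)"
      then obtain q r where x: "x = (q, r)" "ok q r" "mul q r = p" "(q, r) \<noteq> (u, p)"
        by (auto simp: factorisations_def)
      have "q \<notin> U"
      proof
        assume "q \<in> U"
        then have "r = p" using unit_left[of q r] x by simp
        then show False using uniq[OF \<open>q \<in> U\<close>] x by simp
      qed
      then show "(case x of (q, r) \<Rightarrow> conv_one q \<otimes> f r) = \<zero>"
        using x(1) assms by (simp add: conv_one_def)
    qed (use u assms in \<open>auto simp: factorisations_def conv_one_def unit_left finite_factorisations\<close>)
    then show ?thesis
      using u assms by (simp add: conv_one_def)
  qed
qed

lemma conv_one_right:
  assumes "f \<in> coeffs"
  shows "conv f conv_one = f"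
proof
  fix p
  show "conv f conv_one p = f p"
  proof (cases "p \<in> P")
    case False
    then show ?thesis
      using conv_closed[OF assms conv_one_closed] assms False by (simp add: coeffs_outside)
  next
    case True
    then obtain u where u: "u \<in> U" "ok p u" and uniq: "\<And>w. w \<in> U \<Longrightarrow> ok p w \<Longrightarrow> w = u"
      using ex1_unit_right[OF True] by blast
    have "conv f conv_one p = (case (p, u) of (q, r) \<Rightarrow> f q \<otimes> conv_one r)"
      unfolding conv_def
    proof (rule finsum_eq_single)
      fix x assume "x \<in> factorisations p" "x \<noteq> (p, u)"
      then obtain q r where x: "x = (q, r)" "ok q r" "mul q r = p" "(q, r) \<noteq> (p, u)"
        by (auto simp: factorisations_def)
      have "r \<notin> U"
      proof
        assume "r \<in> U"
        then have "q = p" using unit_right[of r q] x by simp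
        then show False using uniq[OF \<open>r \<in> U\<close>] x by simp
      qed
      then show "(case x of (q, r) \<Rightarrow> f q \<otimes> conv_one r) = \<zero>"
        using x(1) assms by (simp add: conv_one_def)
    qed (use u assms in \<open>auto simp: finite_factorisations factorisations_def conv_one_def unit_right\<close>)
    then show ?thesis
      using u assms by (simp add: conv_one_def)
  qed
qed

text \<open>The carrier may be smaller than the set of all functions, so that the same argument covers
  power series and finitely supported functions.\<close>

lemma ring_of_functions:
  assumes "carrier A \<subseteq> coeffs"
    and ops: "monoid.mult A = conv" "one A = conv_one" "ring.zero A = (\<lambda>p. \<zero>)"
      "ring.add A = (\<lambda>f g p. f p \<oplus> g p)"
    and closed: "(\<lambda>p. \<zero>) \<in> carrier A" "conv_one \<in> carrier A"
      "\<And>f g. f \<in> carrier A \<Longrightarrow> g \<in> carrier A \<Longrightarrow> (\<lambda>p. f p \<oplus> g p) \<in> carrier A"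
      "\<And>f g. f \<in> carrier A \<Longrightarrow> g \<in> carrier A \<Longrightarrow> conv f g \<in> carrier A"
      "\<And>f. f \<in> carrier A \<Longrightarrow> (\<lambda>p. \<ominus> f p) \<in> carrier A"
  shows "ring A"
proof -
  have C: "f \<in> carrier A \<Longrightarrow> f \<in> coeffs" for f
    using assms(1) by auto
  show ?thesis
  proof (rule ringI)
    show "abelian_group A"
    proof (rule abelian_groupI)
      fix f assume f: "f \<in> carrier A"
      show "\<exists>g\<in>carrier A. g \<oplus>\<^bsub>A\<^esub> f = \<zero>\<^bsub>A\<^esub>"
        using f C[OF f] closed(5)[OF f] by (intro bexI[of _ "\<lambda>p. \<ominus> f p"]) (simp_all add: ops l_neg)
    qed (use closed C in \<open>auto simp: ops a_ac intro!: ext\<close>)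
    show "monoid A"
      by (rule monoidI) (use closed C in \<open>auto simp: ops conv_assoc conv_one_left conv_one_right\<close>)
  qed (use C in \<open>auto simp: ops conv_add_left conv_add_right\<close>)
qed

lemma coeffs_zero: "(\<lambda>p. \<zero>) \<in> coeffs"
  by (auto intro: coeffsI)

lemma coeffs_add: "f \<in> coeffs \<Longrightarrow> g \<in> coeffs \<Longrightarrow> (\<lambda>p. f p \<oplus> g p) \<in> coeffs"
  by (rule coeffsI) (simp_all add: coeffs_outside)

lemma coeffs_uminus: "f \<in> coeffs \<Longrightarrow> (\<lambda>p. \<ominus> f p) \<in> coeffs"
  by (rule coeffsI) (simp_all add: coeffs_outside)

lemma coeffs_scale: "k \<in> carrier R \<Longrightarrow> f \<in> coeffs \<Longrightarrow> (\<lambda>p. k \<otimes> f p) \<in> coeffs"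
  by (rule coeffsI) (simp_all add: coeffs_outside)

definition single :: "'p \<Rightarrow> 'a \<Rightarrow> 'p \<Rightarrow> 'a" where
  "single p a = (\<lambda>q. if q = p then a else \<zero>)"

lemma single_in_coeffs: "p \<in> P \<Longrightarrow> a \<in> carrier R \<Longrightarrow> single p a \<in> coeffs"
  by (auto simp: single_def intro!: coeffsI)

lemma single_zero: "single p \<zero> = (\<lambda>q. \<zero>)"
  by (simp add: single_def)

lemma conv_single_single:
  assumes "a \<in> carrier R" "b \<in> carrier R"
  shows "conv (single p a) (single q b)
    = (if ok p q then single (mul p q) (a \<otimes> b) else (\<lambda>_. \<zero>))"
proof
  fix x
  show "conv (single p a) (single q b) x
    = (if ok p q then single (mul p q) (a \<otimes> b) else (\<lambda>_. \<zero>)) x"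
  proof (cases "(p, q) \<in> factorisations x")
    case True
    have "conv (single p a) (single q b) x = (case (p, q) of (u, v) \<Rightarrow> single p a u \<otimes> single q b v)"
      unfolding conv_def
      by (rule finsum_eq_single) (use True assms in \<open>auto simp: single_def split: if_splits\<close>)
    then show ?thesis
      using True by (simp add: single_def factorisations_def)
  next
    case False
    have "conv (single p a) (single q b) x = \<zero>"
      unfolding conv_def
      by (rule finsum_eq_zero) (use False assms in \<open>auto simp: single_def split: if_splits\<close>)
    then show ?thesis
      using False by (auto simp: single_def factorisations_def)
  qed
qed

lemma conv_single_right:
  assumes "f \<in> coeffs" "b \<in> carrier R" "ok w q"
  shows "conv f (single q b) (mul w q) = f w \<otimes> b"
proof -
  have "conv f (single q b) (mul w q) = (case (w, q) of (u, v) \<Rightarrow> f u \<otimes> single q b v)"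
    unfolding conv_def
    by (rule finsum_eq_single)
      (use assms cancel_right in \<open>auto simp: single_def factorisations_def finite_factorisations split: if_splits\<close>)
  then show ?thesis by (simp add: single_def)
qed

lemma conv_single_left:
  assumes "f \<in> coeffs" "b \<in> carrier R" "ok q w"
  shows "conv (single q b) f (mul q w) = b \<otimes> f w"
proof -
  have "conv (single q b) f (mul q w) = (case (q, w) of (u, v) \<Rightarrow> single q b u \<otimes> f v)"
    unfolding conv_def
    by (rule finsum_eq_single)
      (use assms cancel_left in \<open>auto simp: single_def factorisations_def finite_factorisations split: if_splits\<close>)
  then show ?thesis by (simp add: single_def)
qed

text \<open>A function with finite support is the sum of its values at single indices, so it lies in
  every additively closed set that contains these.\<close>

lemma finite_support_induct:
  assumes "f \<in> coeffs" "finite {p. f p \<noteq> \<zero>}"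
    and "(\<lambda>p. \<zero>) \<in> J" "\<And>g h. g \<in> J \<Longrightarrow> h \<in> J \<Longrightarrow> (\<lambda>p. g p \<oplus> h p) \<in> J"
    and "\<And>p. f p \<noteq> \<zero> \<Longrightarrow> single p (f p) \<in> J"
  shows "f \<in> J"
proof -
  have "(\<lambda>p. if p \<in> S then f p else \<zero>) \<in> J" if "finite S" "S \<subseteq> {p. f p \<noteq> \<zero>}" for S
    using that
  proof (induction S rule: finite_induct)
    case empty
    then show ?case using assms(3) by simp
  next
    case (insert x S)
    have "(\<lambda>p. if p \<in> insert x S then f p else \<zero>)
        = (\<lambda>p. (if p \<in> S then f p else \<zero>) \<oplus> single x (f x) p)"
      using insert assms(1) by (auto simp: single_def)
    then show ?case
      using insert assms(4,5) by auto
  qed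
  from this[OF assms(2) subset_refl]
  have "(\<lambda>p. if p \<in> {p. f p \<noteq> \<zero>} then f p else \<zero>) \<in> J" .
  moreover have "(\<lambda>p. if p \<in> {p. f p \<noteq> \<zero>} then f p else \<zero>) = f"
    by auto
  ultimately show ?thesis by simp
qed

end


section \<open>Quotient algebras\<close>

lemma FactRing_carrier: "carrier (A Quot I) = (\<lambda>a. I +>\<^bsub>A\<^esub> a) ` carrier A"
  by (auto simp: FactRing_simps)

lemma quotient_algebra_simps:
  "carrier (quotient_algebra A I) = carrier (A Quot I)"
  "monoid.mult (quotient_algebra A I) = monoid.mult (A Quot I)"
  "one (quotient_algebra A I) = one (A Quot I)"
  "ring.zero (quotient_algebra A I) = ring.zero (A Quot I)"
  "ring.add (quotient_algebra A I) = ring.add (A Quot I)"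
  by (simp_all add: quotient_algebra_def ring.defs module.defs)

lemma quotient_algebra_smult:
  "k \<odot>\<^bsub>quotient_algebra A I\<^esub> Y = (\<Union>x\<in>Y. I +>\<^bsub>A\<^esub> (k \<odot>\<^bsub>A\<^esub> x))"
  by (simp add: quotient_algebra_def ring.defs module.defs)

lemma ring_iso_quotient_algebra:
  "h \<in> ring_iso (quotient_algebra A I) (quotient_algebra B J) \<longleftrightarrow> h \<in> ring_iso (A Quot I) (B Quot J)"
  by (simp add: ring_iso_def ring_hom_def quotient_algebra_simps)

text \<open>On a coset, scalars act through any representative as soon as they preserve the ideal.\<close>

lemma (in ideal) quotient_smult_coset:
  assumes "a \<in> carrier R" and "\<And>x. x \<in> carrier R \<Longrightarrow> s x \<in> carrier R"
    and "\<And>x. x \<in> I +> a \<Longrightarrow> s x \<ominus> s a \<in> I"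
  shows "(\<Union>x\<in>I +> a. I +> s x) = I +> s a"
proof -
  have "I +> s x = I +> s a" if "x \<in> I +> a" for x
  proof -
    have "x \<in> carrier R"
      using that assms(1) a_r_coset_subset_G[of I a] Icarr by blast
    then show ?thesis
      using assms that by (intro quotient_eq_iff_same_a_r_cos[THEN iffD1]) (auto intro: ideal_axioms)
  qed
  moreover have "a \<in> I +> a"
    using assms(1) by (rule a_rcos_self)
  ultimately show ?thesis by blast
qed

lemma hom_kernel_smult:
  assumes "ring A" "ring C" and hom: "\<phi> \<in> ring_hom A C"
    and ker: "a_kernel A C \<phi> = I"
    and cl: "\<And>x. x \<in> carrier A \<Longrightarrow> k \<odot>\<^bsub>A\<^esub> x \<in> carrier A"
    and lin: "\<And>x. x \<in> carrier A \<Longrightarrow> \<phi> (k \<odot>\<^bsub>A\<^esub> x) = k \<odot>\<^bsub>C\<^esub> \<phi> x"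
    and a: "a \<in> carrier A"
  shows "k \<odot>\<^bsub>quotient_algebra A I\<^esub> (I +>\<^bsub>A\<^esub> a) = I +>\<^bsub>A\<^esub> (k \<odot>\<^bsub>A\<^esub> a)"
proof -
  interpret A: ring A by fact
  interpret C: ring C by fact
  interpret h: ring_hom_ring A C \<phi>
    by (rule ring_hom_ringI2) fact+
  interpret ideal I A
    using h.kernel_is_ideal ker by simp
  show ?thesis
    unfolding quotient_algebra_smult
  proof (rule quotient_smult_coset[OF a cl])
    fix x assume x: "x \<in> I +>\<^bsub>A\<^esub> a"
    then have xc: "x \<in> carrier A"
      using a A.a_r_coset_subset_G[of I a] Icarr by blast
    have "\<phi> x = \<phi> a"
      using x a ker h.rcos_imp_homeq[of a x] by simp
    then have "\<phi> (k \<odot>\<^bsub>A\<^esub> x \<ominus>\<^bsub>A\<^esub> k \<odot>\<^bsub>A\<^esub> a) = \<zero>\<^bsub>C\<^esub>"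
      using xc a cl lin h.hom_closed[OF cl[OF a]] by (simp add: A.minus_eq C.r_neg)
    then show "k \<odot>\<^bsub>A\<^esub> x \<ominus>\<^bsub>A\<^esub> k \<odot>\<^bsub>A\<^esub> a \<in> I"
      unfolding ker[symmetric] a_kernel_def' using xc a cl by simp
  qed
qed

text \<open>Two quotients are isomorphic when both are the image of linear ring homomorphisms onto a
  common algebra; this is how the two presentations of a string algebra are compared below.\<close>

lemma alg_iso_of_common_image:
  assumes rings: "ring A" "ring B" "ring C"
    and \<phi>: "\<phi> \<in> ring_hom A C" "\<phi> ` carrier A = carrier C" "a_kernel A C \<phi> = I"
    and \<psi>: "\<psi> \<in> ring_hom B C" "\<psi> ` carrier B = carrier C" "a_kernel B C \<psi> = J"
    and clA: "\<And>k x. k \<in> carrier K \<Longrightarrow> x \<in> carrier A \<Longrightarrow> k \<odot>\<^bsub>A\<^esub> x \<in> carrier A"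
    and clB: "\<And>k x. k \<in> carrier K \<Longrightarrow> x \<in> carrier B \<Longrightarrow> k \<odot>\<^bsub>B\<^esub> x \<in> carrier B"
    and lin\<phi>: "\<And>k x. k \<in> carrier K \<Longrightarrow> x \<in> carrier A \<Longrightarrow> \<phi> (k \<odot>\<^bsub>A\<^esub> x) = k \<odot>\<^bsub>C\<^esub> \<phi> x"
    and lin\<psi>: "\<And>k x. k \<in> carrier K \<Longrightarrow> x \<in> carrier B \<Longrightarrow> \<psi> (k \<odot>\<^bsub>B\<^esub> x) = k \<odot>\<^bsub>C\<^esub> \<psi> x"
  shows "is_alg_iso K (quotient_algebra A I) (quotient_algebra B J)"
proof -
  interpret A: ring A by fact
  interpret B: ring B by fact
  interpret C: ring C by fact
  interpret \<phi>: ring_hom_ring A C \<phi>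
    by (rule ring_hom_ringI2) fact+
  interpret \<psi>: ring_hom_ring B C \<psi>
    by (rule ring_hom_ringI2) fact+
  define h1 where "h1 = (\<lambda>Y. the_elem (\<phi> ` Y))"
  define h2 where "h2 = (\<lambda>Y. the_elem (\<psi> ` Y))"
  have h1: "h1 \<in> ring_iso (A Quot I) C"
    using \<phi>.FactRing_iso_set[OF \<phi>(2)] \<phi>(3) by (simp add: h1_def)
  have h2: "h2 \<in> ring_iso (B Quot J) C"
    using \<psi>.FactRing_iso_set[OF \<psi>(2)] \<psi>(3) by (simp add: h2_def)
  have h1_coset: "h1 (I +>\<^bsub>A\<^esub> a) = \<phi> a" if "a \<in> carrier A" for a
    using \<phi>.the_elem_simp[OF that] \<phi>(3) by (simp add: h1_def)
  have h2_coset: "h2 (J +>\<^bsub>B\<^esub> b) = \<psi> b" if "b \<in> carrier B" for b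
    using \<psi>.the_elem_simp[OF that] \<psi>(3) by (simp add: h2_def)
  have "ideal J B"
    using \<psi>.kernel_is_ideal \<psi>(3) by simp
  then have BJ: "ring (B Quot J)"
    by (rule ideal.quotient_is_ring)
  define g where "g = inv_into (carrier (B Quot J)) h2"
  have g: "g \<in> ring_iso C (B Quot J)"
    unfolding g_def by (rule ring_iso_set_sym[OF BJ h2])
  have g_coset: "g (\<psi> b) = J +>\<^bsub>B\<^esub> b" if "b \<in> carrier B" for b
  proof -
    have "J +>\<^bsub>B\<^esub> b \<in> carrier (B Quot J)"
      using that by (auto simp: FactRing_simps)
    moreover have "inj_on h2 (carrier (B Quot J))"
      using h2 by (simp add: ring_iso_def bij_betw_def)
    ultimately show ?thesis
      unfolding g_def h2_coset[OF that, symmetric] by (rule inv_into_f_f[rotated])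
  qed
  have "g \<circ> h1 \<in> ring_iso (A Quot I) (B Quot J)"
    by (rule ring_iso_set_trans[OF h1 g])
  moreover have "(g \<circ> h1) (k \<odot>\<^bsub>quotient_algebra A I\<^esub> Y) = k \<odot>\<^bsub>quotient_algebra B J\<^esub> (g \<circ> h1) Y"
    if k: "k \<in> carrier K" and Y: "Y \<in> carrier (A Quot I)" for k Y
  proof -
    obtain a where a: "a \<in> carrier A" "Y = I +>\<^bsub>A\<^esub> a"
      using Y by (auto simp: FactRing_simps)
    then have "\<phi> a \<in> \<psi> ` carrier B"
      using \<psi>(2) \<phi>.hom_closed by simp
    then obtain b where b: "b \<in> carrier B" "\<phi> a = \<psi> b"
      by auto
    have "(g \<circ> h1) (k \<odot>\<^bsub>quotient_algebra A I\<^esub> Y) = g (\<phi> (k \<odot>\<^bsub>A\<^esub> a))"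
      using hom_kernel_smult[OF rings(1,3) \<phi>(1,3) clA lin\<phi>] k a h1_coset clA by simp
    also have "\<dots> = g (\<psi> (k \<odot>\<^bsub>B\<^esub> b))"
      using k a b lin\<phi> lin\<psi> by simp
    also have "\<dots> = k \<odot>\<^bsub>quotient_algebra B J\<^esub> (J +>\<^bsub>B\<^esub> b)"
      using hom_kernel_smult[OF rings(2,3) \<psi>(1,3) clB lin\<psi>] k b g_coset clB by simp
    also have "J +>\<^bsub>B\<^esub> b = (g \<circ> h1) Y"
      using a b h1_coset g_coset by simp
    finally show ?thesis .
  qed
  ultimately show ?thesis
    unfolding is_alg_iso_def quotient_algebra_simps
    by (intro bexI[of _ "g \<circ> h1"] ballI) (simp_all only: ring_iso_quotient_algebra)
qed


section \<open>Finite sums of ideals\<close>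

lemma (in ring) add_ideals_upper:
  assumes "ideal I R" "ideal J R"
  shows "I \<subseteq> I <+>\<^bsub>R\<^esub> J" "J \<subseteq> I <+>\<^bsub>R\<^esub> J"
proof -
  interpret I: ideal I R by fact
  interpret J: ideal J R by fact
  show "I \<subseteq> I <+>\<^bsub>R\<^esub> J"
  proof
    fix x assume "x \<in> I"
    then have "x = x \<oplus> \<zero>" using I.Icarr by simp
    then show "x \<in> I <+>\<^bsub>R\<^esub> J"
      unfolding set_add_def' using \<open>x \<in> I\<close> J.zero_closed by blast
  qed
  show "J \<subseteq> I <+>\<^bsub>R\<^esub> J"
  proof
    fix x assume "x \<in> J"
    then have "x = \<zero> \<oplus> x" using J.Icarr by simp
    then show "x \<in> I <+>\<^bsub>R\<^esub> J"
      unfolding set_add_def' using \<open>x \<in> J\<close> I.zero_closed by blast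
  qed
qed

lemma (in ring) add_ideals_least:
  assumes "ideal L R" "I \<subseteq> L" "J \<subseteq> L"
  shows "I <+>\<^bsub>R\<^esub> J \<subseteq> L"
proof -
  interpret L: ideal L R by fact
  show ?thesis
    unfolding set_add_def' using assms(2,3) L.a_closed by blast
qed

text \<open>The universal property of a finite sum of ideals: it is the least ideal that contains all of them.\<close>

lemma (in ring) ideal_sum_fold:
  assumes "\<And>i. i \<in> set xs \<Longrightarrow> ideal (N i) R"
  shows "ideal (foldr (\<lambda>i J. N i <+>\<^bsub>R\<^esub> J) xs {\<zero>}) R"
    and "\<And>i. i \<in> set xs \<Longrightarrow> N i \<subseteq> foldr (\<lambda>i J. N i <+>\<^bsub>R\<^esub> J) xs {\<zero>}"
    and "\<And>L. ideal L R \<Longrightarrow> (\<And>i. i \<in> set xs \<Longrightarrow> N i \<subseteq> L) \<Longrightarrow> foldr (\<lambda>i J. N i <+>\<^bsub>R\<^esub> J) xs {\<zero>} \<subseteq> L"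
proof -
  have "ideal (foldr (\<lambda>i J. N i <+>\<^bsub>R\<^esub> J) xs {\<zero>}) R
      \<and> (\<forall>i\<in>set xs. N i \<subseteq> foldr (\<lambda>i J. N i <+>\<^bsub>R\<^esub> J) xs {\<zero>})
      \<and> (\<forall>L. ideal L R \<longrightarrow> (\<forall>i\<in>set xs. N i \<subseteq> L) \<longrightarrow> foldr (\<lambda>i J. N i <+>\<^bsub>R\<^esub> J) xs {\<zero>} \<subseteq> L)"
    using assms
  proof (induction xs)
    case Nil
    have "\<zero> \<in> L" if "ideal L R" for L
      using additive_subgroup.zero_closed[OF ideal.axioms(1)[OF that]] .
    then show ?case
      using zeroideal by simp
  next
    case (Cons x xs)
    let ?F = "foldr (\<lambda>i J. N i <+>\<^bsub>R\<^esub> J) xs {\<zero>}"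
    have N: "ideal (N x) R" and F: "ideal ?F R" and up: "\<forall>i\<in>set xs. N i \<subseteq> ?F"
      and low: "\<forall>L. ideal L R \<longrightarrow> (\<forall>i\<in>set xs. N i \<subseteq> L) \<longrightarrow> ?F \<subseteq> L"
      using Cons by auto
    have "ideal (N x <+>\<^bsub>R\<^esub> ?F) R"
      using add_ideals[OF N F] .
    moreover have "\<forall>i\<in>set (x # xs). N i \<subseteq> N x <+>\<^bsub>R\<^esub> ?F"
      using up add_ideals_upper[OF N F] by auto
    moreover have "\<forall>L. ideal L R \<longrightarrow> (\<forall>i\<in>set (x # xs). N i \<subseteq> L) \<longrightarrow> N x <+>\<^bsub>R\<^esub> ?F \<subseteq> L"
      using low by (auto intro!: add_ideals_least del: subsetI)
    ultimately show ?case by simp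
  qed
  then show "ideal (foldr (\<lambda>i J. N i <+>\<^bsub>R\<^esub> J) xs {\<zero>}) R"
    and "\<And>i. i \<in> set xs \<Longrightarrow> N i \<subseteq> foldr (\<lambda>i J. N i <+>\<^bsub>R\<^esub> J) xs {\<zero>}"
    and "\<And>L. ideal L R \<Longrightarrow> (\<And>i. i \<in> set xs \<Longrightarrow> N i \<subseteq> L) \<Longrightarrow> foldr (\<lambda>i J. N i <+>\<^bsub>R\<^esub> J) xs {\<zero>} \<subseteq> L"
    by blast+
qed


(* A path is a pair, but quantifiers over paths should not be split into its components. *)
declare split_paired_All [simp del] split_paired_Ex [simp del]

section \<open>Paths in a quiver\<close>

locale quiver = fin_digraph Q for Q :: "('v, 'a) pre_digraph"
begin

definition composable :: "('v, 'a) qpath \<Rightarrow> ('v, 'a) qpath \<Rightarrow> bool" where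
  "composable q r \<longleftrightarrow> q \<in> paths Q \<and> r \<in> paths Q \<and> path_tail q = path_head Q r"

lemma paths_Nil [simp]: "(v, []) \<in> paths Q \<longleftrightarrow> v \<in> verts Q"
  by (auto simp: paths_def awalk_Nil_iff)

lemma paths_Cons [simp]:
  "(v, a # as) \<in> paths Q \<longleftrightarrow> a \<in> arcs Q \<and> tail Q a = v \<and> (head Q a, as) \<in> paths Q"
  by (auto simp: paths_def awalk_def)

lemma path_head_Nil [simp]: "path_head Q (v, []) = v"
  by (simp add: path_head_def)

lemma path_head_Cons [simp]: "path_head Q (v, a # as) = path_head Q (head Q a, as)"
  by (simp add: path_head_def)

lemma path_head_append [simp]: "path_head Q (v, as @ bs) = path_head Q (path_head Q (v, as), bs)"
  by (induction as arbitrary: v) auto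

lemma paths_append [simp]:
  "(v, as @ bs) \<in> paths Q \<longleftrightarrow> (v, as) \<in> paths Q \<and> (path_head Q (v, as), bs) \<in> paths Q"
proof (induction as arbitrary: v)
  case Nil
  have "(v, bs) \<in> paths Q \<Longrightarrow> v \<in> verts Q"
    by (cases bs) auto
  then show ?case by auto
qed auto

lemma path_tail_in_verts: "(v, as) \<in> paths Q \<Longrightarrow> v \<in> verts Q"
  by (cases as) auto

lemma path_head_in_verts: "(v, as) \<in> paths Q \<Longrightarrow> path_head Q (v, as) \<in> verts Q"
  by (induction as arbitrary: v) auto

lemma path_head_nonempty: "as \<noteq> [] \<Longrightarrow> path_head Q (v, as) = head Q (last as)"
  by (induction as arbitrary: v) auto

lemma path_arcs: "(v, as) \<in> paths Q \<Longrightarrow> set as \<subseteq> arcs Q"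
  by (induction as arbitrary: v) auto

lemma path_tail_simp [simp]: "path_tail (v, as) = v"
  by (simp add: path_tail_def)

lemma path_comp_simp [simp]: "path_comp (u, bs) (v, as) = (v, as @ bs)"
  by (simp add: path_comp_def)

lemma path_length_simp [simp]: "path_length (v, as) = length as"
  by (simp add: path_length_def)

lemma composable_iff [simp]:
  "composable (u, bs) (v, as) \<longleftrightarrow> u = path_head Q (v, as) \<and> (v, as @ bs) \<in> paths Q"
  by (auto simp: composable_def)

lemma path_comp_paths: "composable q r \<Longrightarrow> path_comp q r \<in> paths Q"
  by (cases q, cases r) simp

lemma finite_path_factorisations: "finite {(q, r). composable q r \<and> path_comp q r = p}"
proof -
  obtain v as where p: "p = (v, as)" by (cases p)
  have "{(q, r). composable q r \<and> path_comp q r = p} \<subseteq>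
    (\<lambda>k. ((path_head Q (v, take k as), drop k as), (v, take k as))) ` {..length as}"
  proof
    fix x assume "x \<in> {(q, r). composable q r \<and> path_comp q r = p}"
    then obtain u bs w cs where x: "x = ((u, bs), (w, cs))"
      and "composable (u, bs) (w, cs)" "path_comp (u, bs) (w, cs) = p"
      by auto
    then show "x \<in> (\<lambda>k. ((path_head Q (v, take k as), drop k as), (v, take k as))) ` {..length as}"
      by (intro image_eqI[of _ _ "length cs"]) (auto simp: p)
  qed
  then show ?thesis
    by (rule finite_subset) simp
qed

lemma finite_paths_of_length_less: "finite {p \<in> paths Q. path_length p < d}"
proof -
  have "{p \<in> paths Q. path_length p < d} \<subseteq> verts Q \<times> {as. set as \<subseteq> arcs Q \<and> length as \<le> d}"
    using path_arcs path_tail_in_verts by auto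
  moreover have "finite {as. set as \<subseteq> arcs Q \<and> length as \<le> d}"
    by (rule finite_lists_length_le) simp
  ultimately show ?thesis
    using finite_verts finite_subset by blast
qed

lemma subpath_iff:
  "subpath Q (w, zs) (v, as) \<longleftrightarrow> (v, as) \<in> paths Q \<and>
    (\<exists>xs ys. as = xs @ zs @ ys \<and> w = path_head Q (v, xs))"
proof
  assume "subpath Q (w, zs) (v, as)"
  then obtain q r where q: "q \<in> paths Q" "r \<in> paths Q" "(w, zs) \<in> paths Q"
      "path_tail q = path_head Q (w, zs)" "path_tail (w, zs) = path_head Q r"
      "(v, as) = path_comp q (path_comp (w, zs) r)"
    unfolding subpath_def by blast
  obtain u ys v' xs where [simp]: "q = (u, ys)" "r = (v', xs)"
    by (cases q, cases r)
  show "(v, as) \<in> paths Q \<and> (\<exists>xs ys. as = xs @ zs @ ys \<and> w = path_head Q (v, xs))"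
    using q by auto
next
  assume "(v, as) \<in> paths Q \<and> (\<exists>xs ys. as = xs @ zs @ ys \<and> w = path_head Q (v, xs))"
  then obtain xs ys where "as = xs @ zs @ ys" "w = path_head Q (v, xs)" "(v, as) \<in> paths Q"
    by blast
  then show "subpath Q (w, zs) (v, as)"
    unfolding subpath_def
    by (intro bexI[of _ "(path_head Q (w, zs), ys)"] bexI[of _ "(v, xs)"] conjI) auto
qed

lemma subpath_comp:
  assumes "subpath Q z p" "composable q p"
  shows "subpath Q z (path_comp q p)"
proof -
  obtain u zs v as w bs where [simp]: "z = (u, zs)" "p = (v, as)" "q = (w, bs)"
    by (cases z, cases p, cases q)
  from assms obtain xs ys where "as = xs @ zs @ ys" "u = path_head Q (v, xs)"
    by (auto simp: subpath_iff)
  then have "as @ bs = xs @ zs @ (ys @ bs)" "u = path_head Q (v, xs)"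
    by auto
  then show ?thesis
    using assms(2) unfolding \<open>z = _\<close> \<open>p = _\<close> \<open>q = _\<close> path_comp_simp subpath_iff composable_iff
    by blast
qed

lemma subpath_comp':
  assumes "subpath Q z p" "composable p q"
  shows "subpath Q z (path_comp p q)"
proof -
  obtain u zs v as w bs where [simp]: "z = (u, zs)" "p = (v, as)" "q = (w, bs)"
    by (cases z, cases p, cases q)
  from assms obtain xs ys where "as = xs @ zs @ ys" "u = path_head Q (v, xs)"
    by (auto simp: subpath_iff)
  then have "bs @ as = (bs @ xs) @ zs @ ys" "u = path_head Q (w, bs @ xs)"
    using assms(2) by auto
  then show ?thesis
    using assms(2) unfolding \<open>z = _\<close> \<open>p = _\<close> \<open>q = _\<close> path_comp_simp subpath_iff composable_iff
    by blast
qed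

sublocale paths: partial_monoid "paths Q" composable path_comp "trivial_path ` verts Q"
proof
  show "finite {(q, r). composable q r \<and> path_comp q r = p}" for p
    by (rule finite_path_factorisations)
  fix q r s :: "('v, 'a) qpath"
  obtain u as v bs w cs where [simp]: "q = (u, as)" "r = (v, bs)" "s = (w, cs)"
    by (cases q, cases r, cases s)
  show "composable q r \<and> composable (path_comp q r) s \<longleftrightarrow>
      composable r s \<and> composable q (path_comp r s)"
    by auto
  show "path_comp (path_comp q r) s = path_comp q (path_comp r s)"
    by simp
  show "composable q r \<Longrightarrow> composable q s \<Longrightarrow> path_comp q r = path_comp q s \<Longrightarrow> r = s"
    "composable q s \<Longrightarrow> composable r s \<Longrightarrow> path_comp q s = path_comp r s \<Longrightarrow> q = r"
    by auto
  show "composable q r \<Longrightarrow> path_comp q r \<in> paths Q \<longleftrightarrow> q \<in> paths Q \<and> r \<in> paths Q"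
    by (auto dest: path_comp_paths simp: composable_def)
  show "r \<in> trivial_path ` verts Q \<Longrightarrow> composable r s \<Longrightarrow> path_comp r s = s"
    by (auto simp: trivial_path_def)
  show "r \<in> trivial_path ` verts Q \<Longrightarrow> composable s r \<Longrightarrow> path_comp s r = s"
    by (auto simp: trivial_path_def)
  show "r \<in> paths Q \<Longrightarrow> \<exists>!u. u \<in> trivial_path ` verts Q \<and> composable u r"
    by (rule ex1I[of _ "trivial_path (path_head Q r)"])
      (auto simp: trivial_path_def path_head_in_verts)
  show "r \<in> paths Q \<Longrightarrow> \<exists>!u. u \<in> trivial_path ` verts Q \<and> composable r u"
    by (rule ex1I[of _ "trivial_path (path_tail r)"])
      (auto simp: trivial_path_def path_tail_in_verts)
qed (auto simp: trivial_path_def)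

end


section \<open>Path algebras\<close>

locale path_alg = quiver Q + cring R for Q :: "('v, 'a) pre_digraph" and R (structure)
begin

sublocale convolution "paths Q" composable path_comp "trivial_path ` verts Q" R ..

abbreviation RQ where "RQ \<equiv> path_algebra R Q"

lemma path_algebra_ops [simp]:
  "monoid.mult RQ = conv"
  "one RQ = conv_one"
  "ring.zero RQ = (\<lambda>p. \<zero>)"
  "ring.add RQ = (\<lambda>f g p. f p \<oplus> g p)"
  "smult RQ = (\<lambda>k f p. k \<otimes> f p)"
  by (simp_all add: path_algebra_def conv_def[abs_def] factorisations_def composable_def
      conv_one_def conj_assoc)

lemma carrier_path_algebra: "carrier RQ = {f \<in> coeffs. finite {p. f p \<noteq> \<zero>}}"
  unfolding path_algebra_def coeffs_def by (simp add: conj_assoc)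

lemma path_algebra_coeffs: "f \<in> carrier RQ \<Longrightarrow> f \<in> coeffs"
  by (simp add: carrier_path_algebra)

lemma path_algebra_closed [simp]: "f \<in> carrier RQ \<Longrightarrow> f p \<in> carrier R"
  using path_algebra_coeffs coeffs_closed by blast

lemma single_closed [simp]: "p \<in> paths Q \<Longrightarrow> a \<in> carrier R \<Longrightarrow> single p a \<in> carrier RQ"
  by (auto simp: carrier_path_algebra single_in_coeffs) (simp add: single_def)

lemma conv_finite_support:
  assumes "finite {p. f p \<noteq> \<zero>}" "finite {p. g p \<noteq> \<zero>}" "f \<in> coeffs" "g \<in> coeffs"
  shows "finite {p. conv f g p \<noteq> \<zero>}"
proof (rule finite_subset)
  show "{p. conv f g p \<noteq> \<zero>} \<subseteq> (\<lambda>(q, r). path_comp q r) ` ({p. f p \<noteq> \<zero>} \<times> {p. g p \<noteq> \<zero>})"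
  proof
    fix p assume "p \<in> {p. conv f g p \<noteq> \<zero>}"
    then obtain q r where "p = path_comp q r" "f q \<noteq> \<zero>" "g r \<noteq> \<zero>"
      using conv_nonzero[OF assms(3,4), of p] by blast
    then show "p \<in> (\<lambda>(q, r). path_comp q r) ` ({p. f p \<noteq> \<zero>} \<times> {p. g p \<noteq> \<zero>})"
      by auto
  qed
qed (use assms in auto)

lemma supported_closed:
  assumes "f \<in> carrier RQ" "g \<in> carrier RQ" "\<And>p. h p \<in> carrier R"
    and "\<And>p. f p = \<zero> \<Longrightarrow> g p = \<zero> \<Longrightarrow> h p = \<zero>"
  shows "h \<in> carrier RQ"
proof -
  have "{p. h p \<noteq> \<zero>} \<subseteq> {p. f p \<noteq> \<zero>} \<union> {p. g p \<noteq> \<zero>}"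
    using assms(4) by auto
  then have "finite {p. h p \<noteq> \<zero>}"
    by (rule finite_subset) (use assms(1,2) in \<open>simp add: carrier_path_algebra\<close>)
  moreover have "h \<in> coeffs"
    using assms by (intro coeffsI) (simp_all add: coeffs_outside path_algebra_coeffs)
  ultimately show ?thesis
    by (simp add: carrier_path_algebra)
qed

lemma path_algebra_ring: "ring RQ"
proof (rule ring_of_functions)
  show "conv_one \<in> carrier RQ"
  proof -
    have "{p. conv_one p \<noteq> \<zero>} \<subseteq> trivial_path ` verts Q"
      by (auto simp: conv_one_def)
    then show ?thesis
      by (auto simp: carrier_path_algebra conv_one_closed intro: finite_subset)
  qed
  show "(\<lambda>p. f p \<oplus> g p) \<in> carrier RQ" if "f \<in> carrier RQ" "g \<in> carrier RQ" for f g
    by (rule supported_closed[OF that]) (use that in auto)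
  show "conv f g \<in> carrier RQ" if "f \<in> carrier RQ" "g \<in> carrier RQ" for f g
    using that by (simp add: carrier_path_algebra conv_closed conv_finite_support)
  show "(\<lambda>p. \<ominus> f p) \<in> carrier RQ" if "f \<in> carrier RQ" for f
    by (rule supported_closed[OF that that]) (use that in auto)
qed (auto simp: carrier_path_algebra intro!: coeffsI)

sublocale RQ: ring RQ
  by (rule path_algebra_ring)

lemma smult_closed [simp]:
  "k \<in> carrier R \<Longrightarrow> f \<in> carrier RQ \<Longrightarrow> (\<lambda>p. k \<otimes> f p) \<in> carrier RQ"
  by (rule supported_closed[of f f]) auto

lemma path_elem_single: "path_elem R p = single p \<one>"
  by (simp add: path_elem_def single_def)

lemma path_algebra_span:
  assumes "f \<in> carrier RQ" "(\<lambda>p. \<zero>) \<in> J"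
    and "\<And>g h. g \<in> J \<Longrightarrow> h \<in> J \<Longrightarrow> (\<lambda>p. g p \<oplus> h p) \<in> J"
    and "\<And>p. f p \<noteq> \<zero> \<Longrightarrow> p \<in> paths Q \<Longrightarrow> single p (f p) \<in> J"
  shows "f \<in> J"
proof -
  have "f p \<noteq> \<zero> \<Longrightarrow> p \<in> paths Q" for p
    using assms(1) coeffs_outside path_algebra_coeffs by blast
  then have "\<And>p. f p \<noteq> \<zero> \<Longrightarrow> single p (f p) \<in> J"
    using assms(4) by blast
  moreover have "f \<in> coeffs" "finite {p. f p \<noteq> \<zero>}"
    using assms(1) by (simp_all add: carrier_path_algebra)
  ultimately show ?thesis
    using assms(2,3) by (intro finite_support_induct[of f J])
qed

lemma uminus_apply:
  assumes "f \<in> carrier RQ"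
  shows "\<ominus>\<^bsub>RQ\<^esub> f = (\<lambda>p. \<ominus> f p)"
proof -
  have "(\<lambda>p. \<ominus> f p) \<in> carrier RQ"
    by (rule supported_closed[OF assms assms]) (use assms in auto)
  moreover have "(\<lambda>p. \<ominus> f p) \<oplus>\<^bsub>RQ\<^esub> f = \<zero>\<^bsub>RQ\<^esub>"
    using assms by (simp add: l_neg)
  ultimately show ?thesis
    using assms RQ.minus_equality by blast
qed

lemma minus_apply:
  assumes "f \<in> carrier RQ" "g \<in> carrier RQ"
  shows "f \<ominus>\<^bsub>RQ\<^esub> g = (\<lambda>p. f p \<ominus> g p)"
  using assms by (simp add: RQ.minus_eq minus_eq uminus_apply)

lemma finsum_apply:
  assumes "finite A" "\<And>i. i \<in> A \<Longrightarrow> F i \<in> carrier RQ"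
  shows "finsum RQ F A p = (\<Oplus>i\<in>A. F i p)"
  using assms
proof (induction A rule: finite_induct)
  case (insert x A)
  then have "F \<in> A \<rightarrow> carrier RQ" "(\<lambda>i. F i p) \<in> A \<rightarrow> carrier R"
    by auto
  then show ?case
    using insert by (simp add: RQ.finsum_insert)
qed simp


subsection \<open>Ideals generated by paths\<close>

text \<open>Every path in the support of a product is a composite of paths in the supports of the factors.\<close>

lemma ideal_supported_on:
  assumes "\<And>q p. p \<in> S \<Longrightarrow> composable q p \<Longrightarrow> path_comp q p \<in> S"
    and "\<And>q p. p \<in> S \<Longrightarrow> composable p q \<Longrightarrow> path_comp p q \<in> S"
  shows "ideal {f \<in> carrier RQ. \<forall>p. f p \<noteq> \<zero> \<longrightarrow> p \<in> S} RQ" (is "ideal ?J RQ")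
proof (rule idealI)
  show "ring RQ" by (rule path_algebra_ring)
  have JI: "h \<in> ?J" if "h \<in> carrier RQ" "\<And>p. p \<notin> S \<Longrightarrow> h p = \<zero>" for h
    using that by blast
  show "subgroup ?J (add_monoid RQ)"
  proof (rule RQ.add.subgroupI)
    show "f \<oplus>\<^bsub>RQ\<^esub> g \<in> ?J" if fg: "f \<in> ?J" "g \<in> ?J" for f g
    proof (rule JI)
      show "f \<oplus>\<^bsub>RQ\<^esub> g \<in> carrier RQ"
        using fg by (intro RQ.add.m_closed) auto
      fix p assume "p \<notin> S"
      then have "f p = \<zero>" "g p = \<zero>"
        using fg by blast+
      then show "(f \<oplus>\<^bsub>RQ\<^esub> g) p = \<zero>" by simp
    qed
    show "\<ominus>\<^bsub>RQ\<^esub> f \<in> ?J" if f: "f \<in> ?J" for f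
    proof (rule JI)
      show "\<ominus>\<^bsub>RQ\<^esub> f \<in> carrier RQ"
        using f by simp
      fix p assume "p \<notin> S"
      then have "f p = \<zero>"
        using f by blast
      then show "(\<ominus>\<^bsub>RQ\<^esub> f) p = \<zero>"
        using f uminus_apply[of f] by simp
    qed
  qed (use RQ.zero_closed in auto)
  fix f g assume f: "f \<in> ?J" and g: "g \<in> carrier RQ"
  then have c: "f \<in> carrier RQ" "f \<in> coeffs" "g \<in> coeffs"
    using path_algebra_coeffs by auto
  show "g \<otimes>\<^bsub>RQ\<^esub> f \<in> ?J"
  proof (rule JI[OF RQ.m_closed[OF g c(1)]], rule ccontr)
    fix p assume p: "p \<notin> S" and "(g \<otimes>\<^bsub>RQ\<^esub> f) p \<noteq> \<zero>"
    then have nz: "conv g f p \<noteq> \<zero>" by simp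
    obtain q r where "composable q r" "p = path_comp q r" "f r \<noteq> \<zero>"
      using conv_nonzero[OF c(3,2) nz] by blast
    then show False
      using p assms(1) f by blast
  qed
  show "f \<otimes>\<^bsub>RQ\<^esub> g \<in> ?J"
  proof (rule JI[OF RQ.m_closed[OF c(1) g]], rule ccontr)
    fix p assume p: "p \<notin> S" and "(f \<otimes>\<^bsub>RQ\<^esub> g) p \<noteq> \<zero>"
    then have nz: "conv f g p \<noteq> \<zero>" by simp
    obtain q r where "composable q r" "p = path_comp q r" "f q \<noteq> \<zero>"
      using conv_nonzero[OF c(2,3) nz] by blast
    then show False
      using p assms(2) f by blast
  qed
qed

lemma single_mult:
  assumes "composable p q" "a \<in> carrier R" "b \<in> carrier R"
  shows "single p a \<otimes>\<^bsub>RQ\<^esub> single q b = single (path_comp p q) (a \<otimes> b)"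
  using assms by (simp add: conv_single_single)

text \<open>A two-sided multiple of a path is again a path or zero, so an ideal generated by paths is spanned
  by the paths that contain a generator.\<close>

lemma Idl_paths:
  assumes "Y \<subseteq> paths Q"
  shows "Idl\<^bsub>RQ\<^esub> (path_elem R ` Y) = {f \<in> carrier RQ. \<forall>p. f p \<noteq> \<zero> \<longrightarrow> (\<exists>z\<in>Y. subpath Q z p)}"
    (is "?I = ?J")
proof
  have gens: "path_elem R ` Y \<subseteq> carrier RQ"
    using assms by (auto simp: path_elem_single)
  then interpret I: ideal ?I RQ
    by (rule RQ.genideal_ideal)
  have "subpath Q z z" if "z \<in> paths Q" for z
    using that by (cases z) (auto simp: subpath_iff intro!: exI[of _ "[]"])
  then have "path_elem R ` Y \<subseteq> ?J"
    using assms by (auto simp: path_elem_single) (auto simp: single_def split: if_splits)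
  moreover have "ideal {f \<in> carrier RQ. \<forall>p. f p \<noteq> \<zero> \<longrightarrow> p \<in> {p. \<exists>z\<in>Y. subpath Q z p}} RQ"
    by (rule ideal_supported_on) (use subpath_comp subpath_comp' in blast)+
  then have "ideal ?J RQ"
    by (simp only: mem_Collect_eq)
  ultimately show "?I \<subseteq> ?J"
    by (intro RQ.genideal_minimal)
  show "?J \<subseteq> ?I"
  proof
    fix f assume f: "f \<in> ?J"
    show "f \<in> ?I"
    proof (rule path_algebra_span)
      show "(\<lambda>p. \<zero>) \<in> ?I"
        using I.zero_closed by simp
      show "(\<lambda>p. g p \<oplus> h p) \<in> ?I" if "g \<in> ?I" "h \<in> ?I" for g h
        using I.a_closed[OF that] by simp
      fix p assume "f p \<noteq> \<zero>"
      then obtain z where z: "z \<in> Y" "subpath Q z p"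
        using f by blast
      then obtain x y where x: "x \<in> paths Q" "y \<in> paths Q" "z \<in> paths Q"
          "path_tail x = path_head Q z" "path_tail z = path_head Q y"
          and p: "p = path_comp x (path_comp z y)"
        unfolding subpath_def by blast
      have c: "composable z y" "composable x (path_comp z y)"
        using x by (cases x, cases y, cases z, auto)+
      have "path_elem R z \<in> ?I"
        using z(1) gens RQ.genideal_self by blast
      then have "single x (f p) \<otimes>\<^bsub>RQ\<^esub> (path_elem R z \<otimes>\<^bsub>RQ\<^esub> single y \<one>) \<in> ?I"
        using x f by (intro I.I_l_closed I.I_r_closed) auto
      also have "single x (f p) \<otimes>\<^bsub>RQ\<^esub> (path_elem R z \<otimes>\<^bsub>RQ\<^esub> single y \<one>) = single p (f p)"
        using c f by (simp add: path_elem_single conv_single_single p)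
      finally show "single p (f p) \<in> ?I" .
    qed (use f in auto)
  qed
qed

lemma path_ideal_eq:
  assumes "Z \<subseteq> paths Q"
  shows "path_ideal R Q Z = {f \<in> carrier RQ. \<forall>p. admissible Q Z p \<longrightarrow> f p = \<zero>}"
proof -
  have "f p \<noteq> \<zero> \<Longrightarrow> p \<in> paths Q" if "f \<in> carrier RQ" for f p
    using that coeffs_outside path_algebra_coeffs by blast
  then show ?thesis
    unfolding path_ideal_def Idl_paths[OF assms] admissible_def by blast
qed

end


section \<open>Power series rings\<close>

text \<open>A monomial has finitely many divisors, which makes the product of power series well defined.\<close>

lemma finite_msubset: "finite {a. a \<subseteq># (m :: 'i multiset)}"
proof (rule finite_subset)
  show "{a. a \<subseteq># m} \<subseteq> mset ` {xs. set xs \<subseteq> set_mset m \<and> length xs \<le> size m}"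
  proof
    fix a assume "a \<in> {a. a \<subseteq># m}"
    then have "a \<subseteq># m" by simp
    obtain xs where "mset xs = a" using ex_mset by blast
    with \<open>a \<subseteq># m\<close> show "a \<in> mset ` {xs. set xs \<subseteq> set_mset m \<and> length xs \<le> size m}"
      using set_mset_mono[of a m] size_mset_mono[of a m] by (intro image_eqI[of _ _ xs]) auto
  qed
  show "finite (mset ` {xs. set xs \<subseteq> set_mset m \<and> length xs \<le> size m})"
    by (intro finite_imageI finite_lists_length_le) simp
qed

locale power_series = cring K for K (structure) and S :: "'i set"
begin

sublocale ps: convolution "{m. set_mset m \<subseteq> S}" "\<lambda>_ _. True" "(+)" "{{#}}" K
proof
  show "finite {(q, r). True \<and> q + r = p}" for p :: "'i multiset"
  proof (rule finite_subset)
    show "{(q, r). True \<and> q + r = p} \<subseteq> {a. a \<subseteq># p} \<times> {a. a \<subseteq># p}"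
      by auto
  qed (simp add: finite_msubset)
qed (auto simp: add.assoc)

abbreviation PS where "PS \<equiv> power_series_ring K S"

lemma ps_ops [simp]:
  "monoid.mult PS = ps.conv"
  "one PS = ps.conv_one"
  "ring.zero PS = (\<lambda>p. \<zero>)"
  "ring.add PS = (\<lambda>f g p. f p \<oplus> g p)"
  "smult PS = (\<lambda>k f p. k \<otimes> f p)"
  by (simp_all add: power_series_ring_def ps.conv_def[abs_def] ps.factorisations_def
      ps.conv_one_def)

lemma ps_carrier: "carrier PS = ps.coeffs"
  unfolding power_series_ring_def ps.coeffs_def by auto

lemma ps_ring: "ring PS"
  by (rule ps.ring_of_functions)
    (simp_all add: ps_carrier ps.conv_closed ps.conv_one_closed ps.coeffs_zero ps.coeffs_add
      ps.coeffs_uminus)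

lemma ps_conv_commute:
  assumes "f \<in> ps.coeffs" "g \<in> ps.coeffs"
  shows "ps.conv f g = ps.conv g f"
proof
  fix m
  show "ps.conv f g m = ps.conv g f m"
    unfolding ps.conv_def
  proof (rule finsum_bij_betw[where h = "\<lambda>(a, b). (b, a)"])
    show "bij_betw (\<lambda>(a, b). (b, a)) (ps.factorisations m) (ps.factorisations m)"
      by (rule bij_betwI[where g = "\<lambda>(a, b). (b, a)"]) (auto simp: ps.factorisations_def add.commute)
  qed (use assms in \<open>auto simp: m_comm\<close>)
qed

lemma ps_cring: "cring PS"
proof -
  interpret PS: ring PS by (rule ps_ring)
  show ?thesis
    by unfold_locales (simp add: ps_carrier ps_conv_commute)
qed

lemma ps_var_single: "ps_var K i = ps.single {#i#} \<one>"
  by (simp add: ps_var_def ps.single_def)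

lemma ps_var_closed: "i \<in> S \<Longrightarrow> ps_var K i \<in> ps.coeffs"
  unfolding ps_var_single by (rule ps.single_in_coeffs) auto

lemma ps_var_mult:
  assumes "i \<in> S" "f \<in> ps.coeffs"
  shows "ps.conv (ps_var K i) f m = (if i \<in># m then f (m - {#i#}) else \<zero>)"
proof (cases "i \<in># m")
  case True
  then obtain w where m: "m = {#i#} + w"
    by (metis add.commute insert_DiffM2)
  have "ps.conv (ps_var K i) f ({#i#} + w) = \<one> \<otimes> f w"
    unfolding ps_var_single by (rule ps.conv_single_left[OF assms(2)]) auto
  then show ?thesis using assms True by (simp add: m)
next
  case False
  have "ps.conv (ps_var K i) f m = \<zero>"
  proof (rule ccontr)
    assume "ps.conv (ps_var K i) f m \<noteq> \<zero>"
    then obtain q r where "m = q + r" "ps_var K i q \<noteq> \<zero>"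
      using ps.conv_nonzero[OF ps_var_closed[OF assms(1)] assms(2)] by blast
    then show False
      using False by (auto simp: ps_var_def split: if_splits)
  qed
  then show ?thesis using False by simp
qed

text \<open>A power of one variable factors only into powers of this variable.\<close>

lemma ps_mult_replicate:
  assumes "f \<in> ps.coeffs" "g \<in> ps.coeffs"
  shows "ps.conv f g (replicate_mset k i)
    = (\<Oplus>j\<in>{..k}. f (replicate_mset j i) \<otimes> g (replicate_mset (k - j) i))"
  unfolding ps.conv_def
proof (rule finsum_bij_betw[symmetric])
  show "bij_betw (\<lambda>j. (replicate_mset j i, replicate_mset (k - j) i)) {..k}
      (ps.factorisations (replicate_mset k i))"
  proof (rule bij_betwI[where g = "\<lambda>(a, b). size a"])
    show "(\<lambda>j. (replicate_mset j i, replicate_mset (k - j) i))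
        \<in> {..k} \<rightarrow> ps.factorisations (replicate_mset k i)"
      by (auto simp: ps.factorisations_def multiset_eq_iff)
    have *: "a = replicate_mset (size a) i \<and> b = replicate_mset (k - size a) i \<and> size a \<le> k"
      if "a + b = replicate_mset k i" for a b
    proof -
      from that have "a \<subseteq># replicate_mset k i" "b \<subseteq># replicate_mset k i"
        by (metis mset_subset_eq_add_left, metis mset_subset_eq_add_right)
      then obtain x y where "a = replicate_mset x i" "b = replicate_mset y i"
        by (metis msubseteq_replicate_msetE)
      moreover have "size a + size b = k"
        using arg_cong[OF that, of size] by simp
      ultimately show ?thesis by auto
    qed
    show "(\<lambda>(a, b). size a) \<in> ps.factorisations (replicate_mset k i) \<rightarrow> {..k}"
      using * by (auto simp: ps.factorisations_def)
    show "(\<lambda>j. (replicate_mset j i, replicate_mset (k - j) i)) (case y of (a, b) \<Rightarrow> size a) = y"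
      if "y \<in> ps.factorisations (replicate_mset k i)" for y
    proof -
      obtain a b where y: "y = (a, b)" by (cases y)
      then have "a + b = replicate_mset k i"
        using that by (simp add: ps.factorisations_def)
      from *[OF this] show ?thesis by (simp add: y)
    qed
  qed auto
qed (use assms in auto)

text \<open>A power series without monomials prime to the variables in \<open>T\<close> is a combination of these
  variables: split off the monomials divisible by the first variable, then continue.\<close>

lemma ps_in_span_of_variables:
  assumes "finite T" "T \<subseteq> S" "r \<in> ps.coeffs"
    and "(\<lambda>m. \<zero>) \<in> J" "\<And>f g. f \<in> J \<Longrightarrow> g \<in> J \<Longrightarrow> (\<lambda>m. f m \<oplus> g m) \<in> J"
    and "\<And>j f. j \<in> T \<Longrightarrow> f \<in> ps.coeffs \<Longrightarrow> ps.conv (ps_var K j) f \<in> J"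
    and "\<And>m. set_mset m \<inter> T = {} \<Longrightarrow> r m = \<zero>"
  shows "r \<in> J"
  using assms
proof (induction T arbitrary: r rule: finite_induct)
  case empty
  then have "r = (\<lambda>m. \<zero>)" by auto
  then show ?case using empty by simp
next
  case (insert j T)
  define r1 where "r1 = (\<lambda>m. if j \<in># m then \<zero> else r m)"
  define r2 where "r2 = (\<lambda>m. r (m + {#j#}))"
  have r2: "r2 \<in> ps.coeffs"
    using insert.prems(2) by (auto simp: r2_def intro!: ps.coeffsI ps.coeffs_outside)
  have "r1 \<in> J"
  proof (rule insert.IH)
    show "r1 \<in> ps.coeffs"
      unfolding r1_def using insert.prems(2) by (intro ps.coeffsI) (simp_all add: ps.coeffs_outside)
    show "r1 m = \<zero>" if "set_mset m \<inter> T = {}" for m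
    proof (cases "j \<in># m")
      case False
      then have "set_mset m \<inter> insert j T = {}"
        using that by auto
      then show ?thesis using insert.prems(6) by (simp add: r1_def)
    qed (simp add: r1_def)
  qed (use insert.prems in auto)
  moreover have "ps.conv (ps_var K j) r2 \<in> J"
    using insert.prems(5) r2 by blast
  moreover have "r = (\<lambda>m. r1 m \<oplus> ps.conv (ps_var K j) r2 m)"
  proof
    fix m
    show "r m = r1 m \<oplus> ps.conv (ps_var K j) r2 m"
      using insert.prems(1,2) by (simp add: ps_var_mult[OF _ r2] r1_def) (simp add: r2_def)
  qed
  ultimately show ?case
    using insert.prems(4)[of r1] by simp
qed

end


section \<open>Admissible paths\<close>

locale string_quiver = quiver Q for Q :: "('v, 'a) pre_digraph" +
  fixes Z :: "('v, 'a) qpath set"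
  assumes Z_paths: "Z \<subseteq> paths Q" and Z_length: "\<And>z. z \<in> Z \<Longrightarrow> 2 \<le> path_length z"
begin

definition acomposable :: "('v, 'a) qpath \<Rightarrow> ('v, 'a) qpath \<Rightarrow> bool" where
  "acomposable q r \<longleftrightarrow> composable q r \<and> admissible Q Z (path_comp q r)"

lemma admissible_paths: "admissible Q Z p \<Longrightarrow> p \<in> paths Q"
  by (simp add: admissible_def)

text \<open>Since the elements of \<open>Z\<close> are nontrivial, their tails are determined by their arrows, and
  admissibility depends on the sequence of arrows only.\<close>

lemma admissible_iff:
  "admissible Q Z (v, as) \<longleftrightarrow> (v, as) \<in> paths Q \<and> (\<forall>z\<in>Z. \<forall>xs ys. as \<noteq> xs @ snd z @ ys)"
proof -
  have "subpath Q z (v, as) \<longleftrightarrow> (\<exists>xs ys. as = xs @ snd z @ ys)"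
    if "z \<in> Z" "(v, as) \<in> paths Q" for z
  proof -
    obtain w zs where z: "z = (w, zs)" by (cases z)
    have "zs \<noteq> []" "(w, zs) \<in> paths Q"
      using that(1) Z_length[of z] Z_paths by (auto simp: z)
    then have "w = path_head Q (v, xs)" if "as = xs @ zs @ ys" for xs ys
      using \<open>(v, as) \<in> paths Q\<close> that by (cases zs) auto
    then show ?thesis
      using that(2) by (auto simp: subpath_iff z)
  qed
  then show ?thesis
    unfolding admissible_def by blast
qed

lemma admissible_factors:
  "admissible Q Z (path_comp q r) \<Longrightarrow> composable q r \<Longrightarrow> admissible Q Z q \<and> admissible Q Z r"
  unfolding admissible_def using subpath_comp subpath_comp' composable_def[of q r] by blast

lemma admissible_trivial: "v \<in> verts Q \<Longrightarrow> admissible Q Z (v, [])"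
  using Z_length by (force simp: admissible_iff path_length_def)

lemma admissible_arrow: "a \<in> arcs Q \<Longrightarrow> admissible Q Z (tail Q a, [a])"
  using Z_length by (force simp: admissible_iff path_length_def Cons_eq_append_conv)

text \<open>If composites that are not admissible are declared undefined, composition stays associative:
  both bracketings of a triple composite are defined iff the whole path is admissible, since factors
  of admissible paths are admissible.\<close>

sublocale adm: partial_monoid "{p. admissible Q Z p}" acomposable path_comp "trivial_path ` verts Q"
proof
  show "finite {(q, r). acomposable q r \<and> path_comp q r = p}" for p
    by (rule finite_subset[OF _ finite_path_factorisations[of p]]) (auto simp: acomposable_def)
  fix q r s :: "('v, 'a) qpath"
  show "acomposable q r \<and> acomposable (path_comp q r) s \<longleftrightarrow>
      acomposable r s \<and> acomposable q (path_comp r s)"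
    unfolding acomposable_def
    using paths.ok_assoc[of q r s] paths.mul_assoc[of q r s]
      admissible_factors[of q "path_comp r s"] admissible_factors[of "path_comp q r" s]
    by metis
  show "path_comp (path_comp q r) s = path_comp q (path_comp r s)"
    by (simp add: path_comp_def)
  show "acomposable q r \<Longrightarrow> acomposable q s \<Longrightarrow> path_comp q r = path_comp q s \<Longrightarrow> r = s"
    "acomposable q s \<Longrightarrow> acomposable r s \<Longrightarrow> path_comp q s = path_comp r s \<Longrightarrow> q = r"
    unfolding acomposable_def using paths.cancel_left paths.cancel_right by blast+
  show "acomposable q r \<Longrightarrow>
      path_comp q r \<in> {p. admissible Q Z p} \<longleftrightarrow> q \<in> {p. admissible Q Z p} \<and> r \<in> {p. admissible Q Z p}"
    unfolding acomposable_def mem_Collect_eq using admissible_factors by blast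
  show "r \<in> trivial_path ` verts Q \<Longrightarrow> acomposable r s \<Longrightarrow> path_comp r s = s"
    using paths.unit_left by (simp add: acomposable_def)
  show "r \<in> trivial_path ` verts Q \<Longrightarrow> acomposable s r \<Longrightarrow> path_comp s r = s"
    using paths.unit_right by (simp add: acomposable_def)
  have left: "acomposable u r \<longleftrightarrow> composable u r"
    if "admissible Q Z r" "u \<in> trivial_path ` verts Q" for u
    unfolding acomposable_def using that paths.unit_left[of u r] by metis
  have right: "acomposable r u \<longleftrightarrow> composable r u"
    if "admissible Q Z r" "u \<in> trivial_path ` verts Q" for u
    unfolding acomposable_def using that paths.unit_right[of u r] by metis
  show "\<exists>!u. u \<in> trivial_path ` verts Q \<and> acomposable u r" if "r \<in> {p. admissible Q Z p}"
    using paths.ex1_unit_left[of r] that left admissible_paths[of r] by (metis mem_Collect_eq)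
  show "\<exists>!u. u \<in> trivial_path ` verts Q \<and> acomposable r u" if "r \<in> {p. admissible Q Z p}"
    using paths.ex1_unit_right[of r] that right admissible_paths[of r] by (metis mem_Collect_eq)
qed (auto simp: trivial_path_def admissible_trivial)

end

text \<open>The common image of the two algebras: arbitrary functions on the admissible paths, with
  convolution over the admissible composites.\<close>

definition admissible_algebra ::
    "('k, 'm) ring_scheme \<Rightarrow> ('v, 'a) pre_digraph \<Rightarrow> ('v, 'a) qpath set
      \<Rightarrow> ('k, ('v, 'a) qpath \<Rightarrow> 'k) module" where
  "admissible_algebra K Q Z = \<lparr>
     carrier = convolution.coeffs {p. admissible Q Z p} K,
     monoid.mult = convolution.conv (string_quiver.acomposable Q Z) path_comp K,
     one = convolution.conv_one (trivial_path ` verts Q) K,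
     ring.zero = (\<lambda>p. \<zero>\<^bsub>K\<^esub>),
     ring.add = (\<lambda>f g p. f p \<oplus>\<^bsub>K\<^esub> g p),
     smult = (\<lambda>k f p. k \<otimes>\<^bsub>K\<^esub> f p)\<rparr>"

locale string_alg = string_quiver Q Z + cring K
  for Q :: "('v, 'a) pre_digraph" and Z and K (structure)
begin

sublocale kq: path_alg Q K ..

sublocale ad: convolution "{p. admissible Q Z p}" acomposable path_comp "trivial_path ` verts Q" K ..

abbreviation KQ where "KQ \<equiv> path_algebra K Q"

abbreviation \<Gamma> where "\<Gamma> \<equiv> admissible_algebra K Q Z"

lemma \<Gamma>_ops [simp]:
  "carrier \<Gamma> = ad.coeffs"
  "monoid.mult \<Gamma> = ad.conv"
  "one \<Gamma> = ad.conv_one"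
  "ring.zero \<Gamma> = (\<lambda>p. \<zero>)"
  "ring.add \<Gamma> = (\<lambda>f g p. f p \<oplus> g p)"
  "smult \<Gamma> = (\<lambda>k f p. k \<otimes> f p)"
  by (simp_all add: admissible_algebra_def)

lemma \<Gamma>_ring: "ring \<Gamma>"
  by (rule ad.ring_of_functions)
    (simp_all add: ad.conv_closed ad.conv_one_closed ad.coeffs_zero ad.coeffs_add ad.coeffs_uminus)

end


section \<open>The completed string algebra\<close>

context string_alg
begin

abbreviation B where "B \<equiv> arrow_ideal K Q"

text \<open>The ideal of the elements supported on paths of length at least \<open>d\<close>; it is \<open>B\<^sup>d\<close>.\<close>

definition long :: "nat \<Rightarrow> (('v, 'a) qpath \<Rightarrow> 'b) set" where
  "long d = {f \<in> carrier KQ. \<forall>p. f p \<noteq> \<zero> \<longrightarrow> d \<le> path_length p}"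

lemma longI:
  "f \<in> carrier KQ \<Longrightarrow> (\<And>p. f p \<noteq> \<zero> \<Longrightarrow> d \<le> path_length p) \<Longrightarrow> f \<in> long d"
  by (simp add: long_def)

lemma long_carrier: "f \<in> long d \<Longrightarrow> f \<in> carrier KQ"
  by (simp add: long_def)

lemma long_nonzero: "f \<in> long d \<Longrightarrow> f p \<noteq> \<zero> \<Longrightarrow> d \<le> path_length p"
  unfolding long_def by blast

lemma long_zero: "f \<in> long d \<Longrightarrow> path_length p < d \<Longrightarrow> f p = \<zero>"
  using long_nonzero[of f d p] by fastforce

lemma long_ideal: "ideal (long d) KQ"
proof -
  have "ideal {f \<in> carrier KQ. \<forall>p. f p \<noteq> \<zero> \<longrightarrow> p \<in> {p. d \<le> path_length p}} KQ"
    by (rule kq.ideal_supported_on) (auto simp: path_comp_def path_length_def)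
  then show ?thesis by (simp add: long_def)
qed

lemma path_last_arrow:
  assumes "p \<in> paths Q" "0 < path_length p"
  obtains a r where "a \<in> arcs Q" "composable (arrow_path Q a) r" "p = path_comp (arrow_path Q a) r"
proof -
  obtain v as where p: "p = (v, as)" by (cases p)
  then obtain bs a where as: "as = bs @ [a]"
    using assms(2) by (cases as rule: rev_cases) auto
  show ?thesis
    using that[of a "(v, bs)"] assms(1) by (auto simp: p as arrow_path_def)
qed

lemma arrow_ideal_eq: "B = long 1"
proof -
  have "arrow_path Q ` arcs Q \<subseteq> paths Q"
    by (auto simp: arrow_path_def)
  from kq.Idl_paths[OF this]
  have "B = {f \<in> carrier KQ. \<forall>p. f p \<noteq> \<zero> \<longrightarrow> (\<exists>z\<in>arrow_path Q ` arcs Q. subpath Q z p)}"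
    by (simp add: arrow_ideal_def image_image)
  moreover have "(\<exists>z\<in>arrow_path Q ` arcs Q. subpath Q z p) \<longleftrightarrow> 1 \<le> path_length p"
    if pp: "p \<in> paths Q" for p
  proof
    assume "\<exists>z\<in>arrow_path Q ` arcs Q. subpath Q z p"
    then show "1 \<le> path_length p"
      by (cases p) (auto simp: arrow_path_def subpath_iff)
  next
    assume "1 \<le> path_length p"
    then obtain a r where "a \<in> arcs Q" "composable (arrow_path Q a) r"
        "p = path_comp (arrow_path Q a) r"
      using path_last_arrow[OF pp] by auto
    moreover from this have "subpath Q (arrow_path Q a) (arrow_path Q a)"
      by (auto simp: arrow_path_def subpath_iff intro!: exI[of _ "[]"])
    ultimately show "\<exists>z\<in>arrow_path Q ` arcs Q. subpath Q z p"
      using subpath_comp' by blast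
  qed
  moreover have "f p \<noteq> \<zero> \<Longrightarrow> p \<in> paths Q" if "f \<in> carrier KQ" for f p
    using that kq.coeffs_outside kq.path_algebra_coeffs by blast
  ultimately show ?thesis
    unfolding long_def by blast
qed

text \<open>A path of length greater than \<open>d\<close> is an arrow composed with a path of length at least \<open>d\<close>.\<close>

lemma ideal_pow_eq: "ideal_pow KQ B d = long d"
proof (induction d)
  case 0
  then show ?case by (simp add: long_def)
next
  case (Suc d)
  interpret L1: ideal "long 1" KQ by (rule long_ideal)
  interpret Ld: ideal "long d" KQ by (rule long_ideal)
  interpret LS: ideal "long (Suc d)" KQ by (rule long_ideal)
  have "ideal_prod KQ (long 1) (long d) = long (Suc d)"
  proof
    show "ideal_prod KQ (long 1) (long d) \<subseteq> long (Suc d)"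
    proof
      fix x assume "x \<in> ideal_prod KQ (long 1) (long d)"
      then show "x \<in> long (Suc d)"
      proof (induction rule: ideal_prod.induct)
        case (prod f g)
        have "Suc d \<le> path_length p" if nz: "kq.conv f g p \<noteq> \<zero>" for p
        proof -
          have "f \<in> kq.coeffs" "g \<in> kq.coeffs"
            using prod L1.Icarr Ld.Icarr kq.path_algebra_coeffs by blast+
          then obtain q r where "composable q r" "p = path_comp q r" "f q \<noteq> \<zero>" "g r \<noteq> \<zero>"
            using kq.conv_nonzero[OF _ _ nz] by blast
          moreover from this have "1 \<le> path_length q" "d \<le> path_length r"
            using prod unfolding long_def by blast+
          ultimately show ?thesis
            by (simp add: path_comp_def path_length_def)
        qed
        moreover have "f \<otimes>\<^bsub>KQ\<^esub> g \<in> carrier KQ"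
          using prod L1.Icarr Ld.Icarr by (intro kq.RQ.m_closed)
        ultimately show ?case
          unfolding long_def mem_Collect_eq kq.path_algebra_ops by blast
      qed (rule LS.a_closed)
    qed
    show "long (Suc d) \<subseteq> ideal_prod KQ (long 1) (long d)"
    proof
      fix f assume f: "f \<in> long (Suc d)"
      show "f \<in> ideal_prod KQ (long 1) (long d)"
      proof (rule kq.path_algebra_span)
        show "f \<in> carrier KQ"
          using f by (rule long_carrier)
        show "(\<lambda>p. \<zero>) \<in> ideal_prod KQ (long 1) (long d)"
          using ideal_prod.prod[of "\<zero>\<^bsub>KQ\<^esub>" "long 1" "\<zero>\<^bsub>KQ\<^esub>" "long d" KQ]
            L1.zero_closed Ld.zero_closed kq.RQ.l_null[OF kq.RQ.zero_closed]
          by (simp del: kq.path_algebra_ops add: kq.path_algebra_ops(3))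
        show "(\<lambda>p. g p \<oplus> h p) \<in> ideal_prod KQ (long 1) (long d)"
          if "g \<in> ideal_prod KQ (long 1) (long d)" "h \<in> ideal_prod KQ (long 1) (long d)" for g h
          using ideal_prod.sum[OF that] by simp
        fix p assume p: "f p \<noteq> \<zero>" "p \<in> paths Q"
        then have len: "Suc d \<le> path_length p" and fp: "f p \<in> carrier K"
          using long_nonzero[OF f] kq.path_algebra_closed[OF long_carrier[OF f]] by blast+
        then obtain a r where a: "a \<in> arcs Q" "composable (arrow_path Q a) r"
            "p = path_comp (arrow_path Q a) r"
          using path_last_arrow[OF p(2)] by auto
        have "kq.single (arrow_path Q a) \<one> \<in> long 1"
          by (rule longI) (use a(2) in \<open>auto simp: composable_def\<close>,
            auto simp: kq.single_def arrow_path_def split: if_splits)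
        moreover have "kq.single r (f p) \<in> long d"
        proof (rule longI)
          show "kq.single r (f p) \<in> carrier KQ"
            using a(2) fp by (simp add: composable_def)
          have "d \<le> path_length r"
            using len by (simp add: a(3) arrow_path_def path_comp_def path_length_def)
          then show "d \<le> path_length q" if "kq.single r (f p) q \<noteq> \<zero>" for q
            using that by (simp add: kq.single_def split: if_splits)
        qed
        ultimately have "kq.single (arrow_path Q a) \<one> \<otimes>\<^bsub>KQ\<^esub> kq.single r (f p)
            \<in> ideal_prod KQ (long 1) (long d)"
          by (rule ideal_prod.prod)
        then show "kq.single p (f p) \<in> ideal_prod KQ (long 1) (long d)"
          using a fp by (simp add: kq.conv_single_single)
      qed
    qed
  qed
  then show ?case
    using Suc by (simp add: arrow_ideal_eq)
qed

subsection \<open>The completion as the algebra of all functions on paths\<close>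

text \<open>The coset of all finitely supported functions that agree with \<open>f\<close> on paths shorter than \<open>d\<close>.
  An element of the completion is a family of such cosets, hence the same thing as an arbitrary
  function on paths.\<close>

definition jet :: "(('v, 'a) qpath \<Rightarrow> 'b) \<Rightarrow> nat \<Rightarrow> (('v, 'a) qpath \<Rightarrow> 'b) set" where
  "jet f d = {g \<in> carrier KQ. \<forall>p. path_length p < d \<longrightarrow> g p = f p}"

definition trunc :: "nat \<Rightarrow> (('v, 'a) qpath \<Rightarrow> 'b) \<Rightarrow> ('v, 'a) qpath \<Rightarrow> 'b" where
  "trunc d f = (\<lambda>p. if path_length p < d then f p else \<zero>)"

lemma trunc_closed: "f \<in> kq.coeffs \<Longrightarrow> trunc d f \<in> carrier KQ"
proof -
  assume f: "f \<in> kq.coeffs"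
  have "{p. trunc d f p \<noteq> \<zero>} \<subseteq> {p \<in> paths Q. path_length p < d}"
    using f kq.coeffs_outside by (auto simp: trunc_def)
  then have "finite {p. trunc d f p \<noteq> \<zero>}"
    using finite_paths_of_length_less finite_subset by blast
  moreover have "trunc d f \<in> kq.coeffs"
    using f by (auto simp: trunc_def kq.coeffs_outside intro!: kq.coeffsI)
  ultimately show ?thesis
    by (simp add: kq.carrier_path_algebra)
qed

lemma trunc_in_jet: "f \<in> kq.coeffs \<Longrightarrow> trunc d f \<in> jet f d"
  by (simp add: jet_def trunc_closed) (simp add: trunc_def)

lemma jet_coset:
  assumes "f \<in> carrier KQ"
  shows "long d +>\<^bsub>KQ\<^esub> f = jet f d"
proof -
  interpret L: ideal "long d" KQ by (rule long_ideal)
  have "g \<in> long d +>\<^bsub>KQ\<^esub> f \<longleftrightarrow> g \<ominus>\<^bsub>KQ\<^esub> f \<in> long d" if "g \<in> carrier KQ" for g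
    using L.a_rcos_module[OF assms that] by (simp add: kq.RQ.minus_eq)
  moreover have "g \<ominus>\<^bsub>KQ\<^esub> f \<in> long d \<longleftrightarrow> g \<in> jet f d" if g: "g \<in> carrier KQ" for g
  proof -
    have "g \<ominus>\<^bsub>KQ\<^esub> f \<in> carrier KQ"
      using g assms by (rule kq.RQ.minus_closed)
    moreover have "g p \<ominus> f p = \<zero> \<longleftrightarrow> g p = f p" for p
      using g assms by (intro r_right_minus_eq) auto
    ultimately show ?thesis
      using g assms unfolding long_def jet_def by (simp add: kq.minus_apply) (metis not_le)
  qed
  moreover have "long d +>\<^bsub>KQ\<^esub> f \<subseteq> carrier KQ" "jet f d \<subseteq> carrier KQ"
    using kq.RQ.a_r_coset_subset_G[OF L.a_subset assms] by (auto simp: jet_def)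
  ultimately show ?thesis by blast
qed

lemma jet_cong: "(\<And>p. path_length p < d \<Longrightarrow> f p = g p) \<Longrightarrow> jet f d = jet g d"
  by (auto simp: jet_def)

lemma jet_trunc:
  assumes "f \<in> kq.coeffs"
  shows "jet f d = long d +>\<^bsub>KQ\<^esub> trunc d f"
  unfolding jet_coset[OF trunc_closed[OF assms]] by (rule jet_cong) (simp add: trunc_def)

lemma jet_inj:
  assumes "f \<in> kq.coeffs" "g \<in> kq.coeffs" "jet f = jet g"
  shows "f = g"
proof
  fix p :: "('v, 'a) qpath"
  have "trunc (Suc (path_length p)) f \<in> jet g (Suc (path_length p))"
    using trunc_in_jet[OF assms(1)] assms(3) by metis
  then show "f p = g p"
    by (simp add: jet_def) (auto simp: trunc_def)
qed

abbreviation C where "C \<equiv> adic_completion KQ B"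

lemma completion_ops:
  "carrier C = {x. \<forall>d. x d \<in> carrier (KQ Quot long d) \<and> long d <+>\<^bsub>KQ\<^esub> x (Suc d) = x d}"
  "x \<otimes>\<^bsub>C\<^esub> y = (\<lambda>d. x d \<otimes>\<^bsub>KQ Quot long d\<^esub> y d)"
  "\<one>\<^bsub>C\<^esub> = (\<lambda>d. \<one>\<^bsub>KQ Quot long d\<^esub>)"
  "\<zero>\<^bsub>C\<^esub> = (\<lambda>d. \<zero>\<^bsub>KQ Quot long d\<^esub>)"
  "x \<oplus>\<^bsub>C\<^esub> y = (\<lambda>d. x d \<oplus>\<^bsub>KQ Quot long d\<^esub> y d)"
  "smult C k x = (\<lambda>d. smult (quotient_algebra KQ (long d)) k (x d))"
  by (simp_all add: adic_completion_def Let_def quotient_algebra_simps ideal_pow_eq)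

text \<open>Representatives of a compatible family agree on every path from some degree on, and their eventual
  values define the function on paths; conversely, the truncations of any function have finite support
  because the quiver is finite.\<close>

lemma completion_carrier: "carrier C = jet ` kq.coeffs"
proof
  show "carrier C \<subseteq> jet ` kq.coeffs"
  proof
    fix x assume x: "x \<in> carrier C"
    have "\<exists>g. g \<in> carrier KQ \<and> x d = jet g d" for d
    proof -
      have "x d \<in> carrier (KQ Quot long d)"
        using x by (simp add: completion_ops)
      then show ?thesis
        unfolding FactRing_carrier using jet_coset by blast
    qed
    then obtain F where F: "\<And>d. F d \<in> carrier KQ" "\<And>d. x d = jet (F d) d"
      by metis
    have step: "F (Suc d) p = F d p" if "path_length p < d" for d p
    proof -
      have "\<zero>\<^bsub>KQ\<^esub> \<in> long d"
        using additive_subgroup.zero_closed[OF ideal.axioms(1)[OF long_ideal]] .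
      moreover have "F (Suc d) \<in> x (Suc d)"
        using F by (simp add: jet_def)
      ultimately have "\<zero>\<^bsub>KQ\<^esub> \<oplus>\<^bsub>KQ\<^esub> F (Suc d) \<in> long d <+>\<^bsub>KQ\<^esub> x (Suc d)"
        unfolding set_add_def' by blast
      then have "F (Suc d) \<in> x d"
        using x F(1)[of "Suc d"] kq.RQ.l_zero by (simp add: completion_ops)
      then show ?thesis
        using that F(2)[of d] by (simp add: jet_def)
    qed
    have stable: "F (d + e) p = F d p" if "path_length p < d" for d e p
      by (induction e) (use that step in auto)
    \<comment> \<open>representatives in degrees above the length of \<open>p\<close> all have the same value at \<open>p\<close>\<close>
    define f where "f = (\<lambda>p. F (Suc (path_length p)) p)"
    have "f \<in> kq.coeffs"
      using F(1) kq.coeffs_outside[OF kq.path_algebra_coeffs[OF F(1)]]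
      by (auto simp: f_def intro!: kq.coeffsI)
    moreover have "x = jet f"
    proof
      fix d
      have "F d p = f p" if "path_length p < d" for p
        using stable[of p "Suc (path_length p)" "d - Suc (path_length p)"] that by (simp add: f_def)
      then show "x d = jet f d"
        unfolding F(2) by (rule jet_cong)
    qed
    ultimately show "x \<in> jet ` kq.coeffs" by blast
  qed
  show "jet ` kq.coeffs \<subseteq> carrier C"
  proof clarify
    fix f assume f: "f \<in> kq.coeffs"
    have "jet f d \<in> carrier (KQ Quot long d)" for d
      using trunc_closed[OF f] unfolding jet_trunc[OF f] FactRing_carrier by blast
    moreover have "long d <+>\<^bsub>KQ\<^esub> jet f (Suc d) = jet f d" for d
    proof
      interpret L: ideal "long d" KQ by (rule long_ideal)
      show "long d <+>\<^bsub>KQ\<^esub> jet f (Suc d) \<subseteq> jet f d"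
      proof
        fix y assume "y \<in> long d <+>\<^bsub>KQ\<^esub> jet f (Suc d)"
        then obtain h g where h: "h \<in> long d" and g: "g \<in> jet f (Suc d)" and y: "y = h \<oplus>\<^bsub>KQ\<^esub> g"
          unfolding set_add_def' by blast
        have "g \<in> carrier KQ"
          using g by (simp add: jet_def)
        moreover have "y p = f p" if p: "path_length p < d" for p
        proof -
          have "h p = \<zero>"
            using h p by (rule long_zero)
          then show ?thesis
            using g p kq.coeffs_closed[OF f, of p] by (simp add: y jet_def)
        qed
        moreover have "y \<in> carrier KQ"
          using kq.RQ.a_closed[OF L.Icarr[OF h] \<open>g \<in> carrier KQ\<close>] y by simp
        ultimately show "y \<in> jet f d"
          by (simp add: jet_def)
      qed
      show "jet f d \<subseteq> long d <+>\<^bsub>KQ\<^esub> jet f (Suc d)"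
      proof
        fix y assume y: "y \<in> jet f d"
        let ?t = "trunc (Suc d) f"
        have t: "?t \<in> carrier KQ" and yc: "y \<in> carrier KQ"
          using y trunc_closed[OF f] by (auto simp: jet_def)
        have "jet ?t d = jet f d"
          by (rule jet_cong) (simp add: trunc_def)
        then have "y \<in> long d +>\<^bsub>KQ\<^esub> ?t"
          using y jet_coset[OF t] by simp
        then obtain h where "h \<in> long d" "y = h \<oplus>\<^bsub>KQ\<^esub> ?t"
          unfolding a_r_coset_def' by blast
        then show "y \<in> long d <+>\<^bsub>KQ\<^esub> jet f (Suc d)"
          using trunc_in_jet[OF f] unfolding set_add_def' by blast
      qed
    qed
    ultimately show "jet f \<in> carrier C"
      by (simp add: completion_ops)
  qed
qed

lemma jet_mult:
  assumes f: "f \<in> kq.coeffs" and g: "g \<in> kq.coeffs"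
  shows "jet f \<otimes>\<^bsub>C\<^esub> jet g = jet (kq.conv f g)"
proof
  fix d
  interpret L: ideal "long d" KQ by (rule long_ideal)
  have "(jet f \<otimes>\<^bsub>C\<^esub> jet g) d = long d +>\<^bsub>KQ\<^esub> (trunc d f \<otimes>\<^bsub>KQ\<^esub> trunc d g)"
    using L.rcoset_mult_add[OF trunc_closed[OF f] trunc_closed[OF g]]
    by (simp add: completion_ops FactRing_def jet_trunc[OF f] jet_trunc[OF g])
  also have "\<dots> = jet (kq.conv (trunc d f) (trunc d g)) d"
    using jet_coset kq.RQ.m_closed[OF trunc_closed[OF f] trunc_closed[OF g]] by simp
  also have "\<dots> = jet (kq.conv f g) d"
  proof (rule jet_cong)
    fix p :: "('v, 'a) qpath" assume "path_length p < d"
    then have "path_length q < d \<and> path_length r < d" if "(q, r) \<in> kq.factorisations p" for q r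
      using that by (auto simp: kq.factorisations_def path_comp_def path_length_def)
    then show "kq.conv (trunc d f) (trunc d g) p = kq.conv f g p"
      unfolding kq.conv_def by (intro finsum_cong') (use f g in \<open>auto simp: trunc_def\<close>)
  qed
  finally show "(jet f \<otimes>\<^bsub>C\<^esub> jet g) d = jet (kq.conv f g) d" .
qed

lemma jet_add:
  assumes f: "f \<in> kq.coeffs" and g: "g \<in> kq.coeffs"
  shows "jet f \<oplus>\<^bsub>C\<^esub> jet g = jet (\<lambda>p. f p \<oplus> g p)"
proof
  fix d
  interpret L: ideal "long d" KQ by (rule long_ideal)
  have "(jet f \<oplus>\<^bsub>C\<^esub> jet g) d = long d +>\<^bsub>KQ\<^esub> (trunc d f \<oplus>\<^bsub>KQ\<^esub> trunc d g)"
    using L.a_rcos_sum[OF trunc_closed[OF f] trunc_closed[OF g]]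
    by (simp add: completion_ops FactRing_def jet_trunc[OF f] jet_trunc[OF g])
  also have "\<dots> = jet (trunc d f \<oplus>\<^bsub>KQ\<^esub> trunc d g) d"
    using jet_coset kq.RQ.a_closed[OF trunc_closed[OF f] trunc_closed[OF g]] by blast
  also have "\<dots> = jet (\<lambda>p. f p \<oplus> g p) d"
    by (rule jet_cong) (simp add: trunc_def)
  finally show "(jet f \<oplus>\<^bsub>C\<^esub> jet g) d = jet (\<lambda>p. f p \<oplus> g p) d" .
qed

lemma jet_one: "\<one>\<^bsub>C\<^esub> = jet kq.conv_one"
  using jet_coset[OF kq.RQ.one_closed] by (auto simp: completion_ops FactRing_def)

lemma jet_zero: "\<zero>\<^bsub>C\<^esub> = jet (\<lambda>p. \<zero>)"
proof
  fix d
  interpret L: ideal "long d" KQ by (rule long_ideal)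
  have "\<zero>\<^bsub>C\<^esub> d = long d +>\<^bsub>KQ\<^esub> \<zero>\<^bsub>KQ\<^esub>"
    using kq.RQ.a_rcos_zero[OF long_ideal L.zero_closed] by (simp add: completion_ops FactRing_def)
  also have "\<dots> = jet (\<lambda>p. \<zero>) d"
    using jet_coset[OF kq.RQ.zero_closed] by simp
  finally show "\<zero>\<^bsub>C\<^esub> d = jet (\<lambda>p. \<zero>) d" .
qed

lemma jet_smult:
  assumes k: "k \<in> carrier K" and f: "f \<in> kq.coeffs"
  shows "smult C k (jet f) = jet (\<lambda>p. k \<otimes> f p)"
proof
  fix d
  interpret L: ideal "long d" KQ by (rule long_ideal)
  note t = trunc_closed[OF f, of d]
  have "smult C k (jet f) d = long d +>\<^bsub>KQ\<^esub> (\<lambda>p. k \<otimes> trunc d f p)"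
    unfolding completion_ops quotient_algebra_smult jet_trunc[OF f] kq.path_algebra_ops
  proof (rule L.quotient_smult_coset[OF t])
    fix x assume x: "x \<in> long d +>\<^bsub>KQ\<^esub> trunc d f"
    then have xj: "x \<in> jet (trunc d f) d"
      using jet_coset[OF t] by simp
    then have xc: "x \<in> carrier KQ"
      by (simp add: jet_def)
    have "(\<lambda>p. k \<otimes> x p) \<in> long d +>\<^bsub>KQ\<^esub> (\<lambda>p. k \<otimes> trunc d f p)"
      using xj kq.smult_closed[OF k xc] jet_coset[OF kq.smult_closed[OF k t]] by (simp add: jet_def)
    then show "(\<lambda>p. k \<otimes> x p) \<ominus>\<^bsub>KQ\<^esub> (\<lambda>p. k \<otimes> trunc d f p) \<in> long d"
      using L.a_rcos_module[OF kq.smult_closed[OF k t] kq.smult_closed[OF k xc]]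
      by (simp add: kq.RQ.minus_eq)
  qed (use kq.smult_closed[OF k] in blast)
  also have "\<dots> = jet (\<lambda>p. k \<otimes> trunc d f p) d"
    using jet_coset[OF kq.smult_closed[OF k t]] .
  also have "\<dots> = jet (\<lambda>p. k \<otimes> f p) d"
    by (rule jet_cong) (simp add: trunc_def)
  finally show "smult C k (jet f) d = jet (\<lambda>p. k \<otimes> f p) d" .
qed

text \<open>The completion is the image of the ring of all functions on paths.\<close>

lemma completion_ring: "ring C"
proof -
  define A :: "(('v, 'a) qpath \<Rightarrow> 'b) ring" where "A = \<lparr>carrier = kq.coeffs, monoid.mult = kq.conv,
    one = kq.conv_one, ring.zero = (\<lambda>p. \<zero>), ring.add = (\<lambda>f g p. f p \<oplus> g p)\<rparr>"
  have "ring A"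
    by (rule kq.ring_of_functions)
      (simp_all add: A_def kq.conv_closed kq.conv_one_closed kq.coeffs_zero kq.coeffs_add
        kq.coeffs_uminus)
  moreover have "jet \<in> ring_hom A C"
    by (rule ring_hom_memI) (auto simp: A_def completion_carrier jet_mult jet_add jet_one)
  ultimately have "ring (C\<lparr>carrier := jet ` carrier A, ring.zero := jet \<zero>\<^bsub>A\<^esub>\<rparr>)"
    by (rule ring.ring_hom_imp_img_ring)
  moreover have "C\<lparr>carrier := jet ` carrier A, ring.zero := jet \<zero>\<^bsub>A\<^esub>\<rparr> = C"
    using completion_carrier jet_zero by (simp add: A_def)
  ultimately show ?thesis by simp
qed


subsection \<open>Restriction to admissible paths\<close>

definition restr :: "(('v, 'a) qpath \<Rightarrow> 'b) \<Rightarrow> ('v, 'a) qpath \<Rightarrow> 'b" where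
  "restr f = (\<lambda>p. if admissible Q Z p then f p else \<zero>)"

text \<open>An element of the completion is the jet of exactly one function on paths.\<close>

definition to_admissible :: "(nat \<Rightarrow> (('v, 'a) qpath \<Rightarrow> 'b) set) \<Rightarrow> ('v, 'a) qpath \<Rightarrow> 'b" where
  "to_admissible x = restr (the_inv_into kq.coeffs jet x)"

lemma to_admissible_jet: "f \<in> kq.coeffs \<Longrightarrow> to_admissible (jet f) = restr f"
  unfolding to_admissible_def
  by (subst the_inv_into_f_f) (auto simp: inj_on_def intro: jet_inj)

lemma restr_closed: "f \<in> kq.coeffs \<Longrightarrow> restr f \<in> ad.coeffs"
  by (rule ad.coeffsI) (auto simp: restr_def)

lemma coeffs_admissible: "f \<in> ad.coeffs \<Longrightarrow> f \<in> kq.coeffs"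
  by (rule kq.coeffsI) (use admissible_paths in \<open>auto intro: ad.coeffs_outside\<close>)

text \<open>An admissible path has the same factorisations in both algebras.\<close>

lemma restr_conv:
  assumes "f \<in> kq.coeffs" "g \<in> kq.coeffs"
  shows "restr (kq.conv f g) = ad.conv (restr f) (restr g)"
proof
  fix p
  show "restr (kq.conv f g) p = ad.conv (restr f) (restr g) p"
  proof (cases "admissible Q Z p")
    case True
    have facs: "ad.factorisations p = kq.factorisations p"
      using True by (auto simp: ad.factorisations_def kq.factorisations_def acomposable_def)
    have "kq.conv f g p = ad.conv (restr f) (restr g) p"
      unfolding kq.conv_def ad.conv_def facs
    proof (rule finsum_cong')
      fix x assume "x \<in> kq.factorisations p"
      then obtain q r where x: "x = (q, r)" "composable q r" "path_comp q r = p"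
        by (auto simp: kq.factorisations_def)
      then have "admissible Q Z q" "admissible Q Z r"
        using True admissible_factors by blast+
      then show "(case x of (q, r) \<Rightarrow> f q \<otimes> g r) = (case x of (q, r) \<Rightarrow> restr f q \<otimes> restr g r)"
        by (simp add: x restr_def)
    qed (use restr_closed[OF assms(1)] restr_closed[OF assms(2)] in auto)
    then show ?thesis
      using True by (simp add: restr_def)
  next
    case False
    then show ?thesis
      using ad.coeffs_outside[OF ad.conv_closed[OF restr_closed[OF assms(1)] restr_closed[OF assms(2)]]]
      by (simp add: restr_def)
  qed
qed

lemma to_admissible_hom: "to_admissible \<in> ring_hom C \<Gamma>"
proof (rule ring_hom_memI)
  fix x y assume "x \<in> carrier C" "y \<in> carrier C"
  then obtain f g where [simp]: "x = jet f" "y = jet g" and f: "f \<in> kq.coeffs" and g: "g \<in> kq.coeffs"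
    by (auto simp: completion_carrier)
  show "to_admissible x \<in> carrier \<Gamma>"
    using f by (simp add: to_admissible_jet restr_closed)
  show "to_admissible (x \<otimes>\<^bsub>C\<^esub> y) = to_admissible x \<otimes>\<^bsub>\<Gamma>\<^esub> to_admissible y"
    using f g by (simp add: to_admissible_jet jet_mult restr_conv kq.conv_closed)
  show "to_admissible (x \<oplus>\<^bsub>C\<^esub> y) = to_admissible x \<oplus>\<^bsub>\<Gamma>\<^esub> to_admissible y"
    using f g by (simp add: to_admissible_jet jet_add kq.coeffs_add) (auto simp: restr_def)
next
  show "to_admissible \<one>\<^bsub>C\<^esub> = \<one>\<^bsub>\<Gamma>\<^esub>"
    unfolding jet_one to_admissible_jet[OF kq.conv_one_closed]
    using ad.coeffs_outside[OF ad.conv_one_closed] by (auto simp: restr_def)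
qed

lemma to_admissible_surj: "to_admissible ` carrier C = carrier \<Gamma>"
proof -
  have "g \<in> to_admissible ` jet ` kq.coeffs" if "g \<in> ad.coeffs" for g
  proof -
    have "restr g = g"
      using that by (auto simp: restr_def ad.coeffs_outside)
    then show ?thesis
      using that coeffs_admissible[OF that] to_admissible_jet[of g] by (metis imageI)
  qed
  then show ?thesis
    by (auto simp: completion_carrier to_admissible_jet restr_closed)
qed

lemma to_admissible_smult:
  assumes "k \<in> carrier K" "x \<in> carrier C"
  shows "to_admissible (smult C k x) = smult \<Gamma> k (to_admissible x)"
  using assms
  by (auto simp: completion_carrier jet_smult to_admissible_jet kq.coeffs_scale) (auto simp: restr_def)

lemma completion_smult_closed: "k \<in> carrier K \<Longrightarrow> x \<in> carrier C \<Longrightarrow> smult C k x \<in> carrier C"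
  by (auto simp: completion_carrier jet_smult kq.coeffs_scale)

text \<open>The closure of \<open>\<langle>Z\<rangle>\<close> consists of the functions that vanish on admissible paths: in every degree such
  a function is congruent to its truncation, which lies in \<open>\<langle>Z\<rangle>\<close>; conversely the value at an admissible
  path \<open>p\<close> is already seen modulo paths longer than \<open>p\<close>, where elements of \<open>\<langle>Z\<rangle>\<close> vanish at \<open>p\<close>.\<close>

lemma to_admissible_kernel:
  "a_kernel C \<Gamma> to_admissible = completion_closure KQ B (path_ideal K Q Z)"
proof -
  have H: "h \<in> kq.coeffs" "to_completion KQ B h = jet h" if "h \<in> path_ideal K Q Z" for h
    using that kq.path_algebra_coeffs jet_coset
    by (auto simp: kq.path_ideal_eq[OF Z_paths] to_completion_def ideal_pow_eq)
  have pow: "completed_pow KQ B d = {y \<in> carrier C. y d = jet (\<lambda>p. \<zero>) d}" for d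
    using fun_cong[OF jet_zero, of d]
    by (auto simp: completed_pow_def a_kernel_def' quotient_algebra_simps ideal_pow_eq completion_ops(4))
  show ?thesis
  proof
    show "a_kernel C \<Gamma> to_admissible \<subseteq> completion_closure KQ B (path_ideal K Q Z)"
    proof
      fix x assume "x \<in> a_kernel C \<Gamma> to_admissible"
      then obtain f where f: "f \<in> kq.coeffs" "x = jet f" "restr f = (\<lambda>p. \<zero>)"
        by (auto simp: a_kernel_def' completion_carrier to_admissible_jet)
      have f0: "f p = \<zero>" if "admissible Q Z p" for p
        using fun_cong[OF f(3), of p] that by (simp add: restr_def)
      have "x \<in> to_completion KQ B ` path_ideal K Q Z <+>\<^bsub>C\<^esub> completed_pow KQ B d" for d
      proof -
        let ?h = "trunc d f" and ?g = "\<lambda>p. if path_length p < d then \<zero> else f p"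
        have "?h \<in> path_ideal K Q Z"
          using trunc_closed[OF f(1)] f0 by (simp add: kq.path_ideal_eq[OF Z_paths]) (simp add: trunc_def)
        moreover have g: "?g \<in> kq.coeffs"
          using f(1) by (auto simp: kq.coeffs_outside intro!: kq.coeffsI)
        moreover have "jet ?g \<in> completed_pow KQ B d"
          using g by (auto simp: pow completion_carrier intro!: jet_cong)
        moreover have "x = jet ?h \<oplus>\<^bsub>C\<^esub> jet ?g"
        proof -
          have "f = (\<lambda>p. ?h p \<oplus> ?g p)"
            using f(1) by (auto simp: trunc_def)
          then show ?thesis
            using jet_add[OF H(1)[OF \<open>?h \<in> path_ideal K Q Z\<close>] g] f(2) by simp
        qed
        ultimately show ?thesis
          unfolding set_add_def' using H(2)[OF \<open>?h \<in> path_ideal K Q Z\<close>]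
          by (intro UN_I[of "jet ?h"] UN_I[of "jet ?g"]) (simp_all add: image_iff, metis)
      qed
      then show "x \<in> completion_closure KQ B (path_ideal K Q Z)"
        by (simp add: completion_closure_def)
    qed
    show "completion_closure KQ B (path_ideal K Q Z) \<subseteq> a_kernel C \<Gamma> to_admissible"
    proof
      fix x assume x: "x \<in> completion_closure KQ B (path_ideal K Q Z)"
      have dec: "\<exists>h\<in>path_ideal K Q Z. \<exists>g\<in>kq.coeffs. jet g d = jet (\<lambda>p. \<zero>) d \<and>
          x = jet (\<lambda>p. h p \<oplus> g p)" if "0 < d" for d
      proof -
        have "x \<in> to_completion KQ B ` path_ideal K Q Z <+>\<^bsub>C\<^esub> completed_pow KQ B d"
          using x that by (auto simp: completion_closure_def)
        then obtain h y where h: "h \<in> path_ideal K Q Z" and y: "y \<in> completed_pow KQ B d"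
            and xe: "x = to_completion KQ B h \<oplus>\<^bsub>C\<^esub> y"
          unfolding set_add_def' by blast
        then obtain g where g: "g \<in> kq.coeffs" "y = jet g" "jet g d = jet (\<lambda>p. \<zero>) d"
          by (auto simp: pow completion_carrier)
        have "x = jet (\<lambda>p. h p \<oplus> g p)"
          using xe H(2)[OF h] jet_add[OF H(1)[OF h] g(1)] g(2) by simp
        then show ?thesis
          using h g by blast
      qed
      obtain h g where "h \<in> path_ideal K Q Z" "g \<in> kq.coeffs" "x = jet (\<lambda>p. h p \<oplus> g p)"
        using dec[of 1] by auto
      then obtain f where f: "f \<in> kq.coeffs" "x = jet f"
        using H(1) kq.coeffs_add by blast
      have "f p = \<zero>" if p: "admissible Q Z p" for p
      proof -
        obtain h g where h: "h \<in> path_ideal K Q Z" and g: "g \<in> kq.coeffs"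
            and g0: "jet g (Suc (path_length p)) = jet (\<lambda>p. \<zero>) (Suc (path_length p))"
            and xe: "x = jet (\<lambda>p. h p \<oplus> g p)"
          using dec[of "Suc (path_length p)"] by auto
        have "f = (\<lambda>p. h p \<oplus> g p)"
          using f xe H(1)[OF h] g kq.coeffs_add by (intro jet_inj) auto
        moreover have "h p = \<zero>"
          using h p by (simp add: kq.path_ideal_eq[OF Z_paths])
        moreover have "g p = \<zero>"
          using trunc_in_jet[OF g, of "Suc (path_length p)"] unfolding g0
          by (simp add: jet_def) (auto simp: trunc_def)
        ultimately show ?thesis by simp
      qed
      then show "x \<in> a_kernel C \<Gamma> to_admissible"
        using f by (auto simp: a_kernel_def' completion_carrier to_admissible_jet restr_def)
    qed
  qed
qed

end


section \<open>Primitive cycles\<close>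

abbreviation rep :: "nat \<Rightarrow> 'a list \<Rightarrow> 'a list" where
  "rep m xs \<equiv> concat (replicate m xs)"

lemma rep_add: "rep (m + n) xs = rep m xs @ rep n xs"
  by (simp add: replicate_add)

lemma rep_mult: "rep (m * n) xs = rep m (rep n xs)"
  by (induction m) (simp_all add: rep_add)

lemma length_rep: "length (rep m xs) = m * length xs"
  by (induction m) simp_all

lemma rep_rotate: "a # rep m (xs @ [a]) = rep m (a # xs) @ [a]"
  by (induction m) simp_all

lemma rep_Suc_right: "rep (Suc m) xs = rep m xs @ xs"
  using rep_add[of m 1 xs] by simp

lemma hd_rep: "0 < m \<Longrightarrow> xs \<noteq> [] \<Longrightarrow> hd (rep m xs) = hd xs"
  by (cases m) simp_all

lemma last_rep: "0 < m \<Longrightarrow> xs \<noteq> [] \<Longrightarrow> last (rep m xs) = last xs"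
  using rep_Suc_right[of "m - 1" xs] by simp

lemma rep_eq_Nil: "rep m xs = [] \<longleftrightarrow> m = 0 \<or> xs = []"
  by (induction m) auto

lemma successively_rep:
  assumes "successively P xs" "P (last xs) (hd xs)"
  shows "successively P (rep m xs)"
proof (cases "xs = []")
  case True
  then show ?thesis by simp
next
  case False
  show ?thesis
  proof (induction m)
    case (Suc m)
    show ?case
    proof (cases m)
      case (Suc n)
      then show ?thesis
        using \<open>successively P (rep m xs)\<close> assms False hd_rep[of m xs]
        by (simp add: successively_append_iff)
    qed (use assms in simp)
  qed simp
qed

lemma rep_one [simp]: "rep 1 xs = xs"
  by (simp add: One_nat_def)

lemma replicate_mset_one [simp]: "replicate_mset 1 x = {#x#}"
  by (simp add: One_nat_def)

locale special_quiver = string_quiver Q Z for Q :: "('v, 'a) pre_digraph" and Z +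
  assumes special: "special Q Z"
begin

text \<open>Arrow \<open>b\<close> may follow arrow \<open>a\<close> in an admissible path; by specialness this relation is a
  partial injection, so an admissible path is determined by its length and its first arrow.\<close>

definition follows :: "'a \<Rightarrow> 'a \<Rightarrow> bool" where
  "follows a b \<longleftrightarrow> a \<in> arcs Q \<and> b \<in> arcs Q \<and> tail Q b = head Q a \<and> (tail Q a, [a, b]) \<notin> Z"

lemma follows_unique:
  assumes "follows a b" "follows a b'" shows "b = b'"
proof -
  have "\<exists>\<^sub>\<le>\<^sub>1 b. b \<in> arcs Q \<and> tail Q b = head Q a \<and> path_comp (arrow_path Q b) (arrow_path Q a) \<notin> Z"
    using special assms(1) unfolding special_def follows_def by blast
  then show ?thesis
    using assms by (auto simp: Uniq_def follows_def arrow_path_def)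
qed

lemma follows_unique':
  assumes "follows a b" "follows a' b" shows "a = a'"
proof -
  have "\<exists>\<^sub>\<le>\<^sub>1 c. c \<in> arcs Q \<and> head Q c = tail Q b \<and> path_comp (arrow_path Q b) (arrow_path Q c) \<notin> Z"
    using special assms(1) unfolding special_def follows_def by blast
  then show ?thesis
    using assms by (auto simp: Uniq_def follows_def arrow_path_def)
qed

lemma admissible_append:
  "admissible Q Z (v, xs @ ys) \<Longrightarrow> admissible Q Z (v, xs) \<and> admissible Q Z (path_head Q (v, xs), ys)"
  using admissible_factors[of "(path_head Q (v, xs), ys)" "(v, xs)"] admissible_paths[of "(v, xs @ ys)"]
  by auto

lemma admissible_follows:
  assumes "admissible Q Z (v, a # b # as)"
  shows "follows a b"
proof -
  have p: "(v, a # b # as) \<in> paths Q"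
    using assms by (rule admissible_paths)
  have "a # b # as = [] @ snd z @ as \<Longrightarrow> z \<notin> Z" for z
    using assms unfolding admissible_iff by blast
  then have "(tail Q a, [a, b]) \<notin> Z"
    by auto
  then show ?thesis
    using p by (auto simp: follows_def)
qed

lemma admissible_successively: "admissible Q Z (v, as) \<Longrightarrow> successively follows as"
proof (induction as arbitrary: v)
  case (Cons a as)
  have "admissible Q Z (head Q a, as)"
    using admissible_append[of v "[a]" as] Cons.prems by simp
  then have "successively follows as"
    by (rule Cons.IH)
  then show ?case
    using Cons.prems admissible_follows by (cases as) (auto simp: successively_Cons)
qed simp

lemma successively_determined:
  "successively follows (a # xs) \<Longrightarrow> successively follows (a # ys) \<Longrightarrow> length xs \<le> length ys
    \<Longrightarrow> xs = take (length xs) ys"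
proof (induction xs arbitrary: a ys)
  case (Cons x xs)
  then obtain y ys' where ys: "ys = y # ys'"
    by (cases ys) auto
  then have "x = y"
    using Cons.prems follows_unique by (auto simp: successively_Cons)
  then show ?case
    using Cons ys by (auto simp: successively_Cons)
qed simp

lemma successively_prefix:
  assumes "successively follows xs" "successively follows ys" "length xs \<le> length ys"
    and "xs \<noteq> []" "hd xs = hd ys"
  shows "xs = take (length xs) ys"
proof -
  obtain a xs' where xs: "xs = a # xs'" using assms(4) by (cases xs) auto
  obtain ys' where ys: "ys = a # ys'" using assms xs by (cases ys) auto
  show ?thesis
    using successively_determined[of a xs' ys'] assms by (simp add: xs ys)
qed

abbreviation prim where "prim v as \<equiv> primitive_cycle Q Z (v, as)"

lemma quiver_cycle_iff:
  "quiver_cycle Q (v, as) \<longleftrightarrow> (v, as) \<in> paths Q \<and> as \<noteq> [] \<and> path_head Q (v, as) = v"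
  by (auto simp: quiver_cycle_def)

lemma prim_iff:
  "prim v as \<longleftrightarrow> quiver_cycle Q (v, as) \<and> (\<forall>m\<ge>1. admissible Q Z (v, rep m as)) \<and>
    (\<forall>bs m. quiver_cycle Q (v, bs) \<longrightarrow> length bs < length as \<longrightarrow> as \<noteq> rep m bs)"
  by (auto simp: primitive_cycle_def path_pow_def path_length_def split_paired_Ex)

lemma prim_cycle:
  assumes "prim v as"
  shows "as \<noteq> []" "(v, as) \<in> paths Q" "path_head Q (v, as) = v" "v \<in> verts Q" "tail Q (hd as) = v"
    "head Q (last as) = v"
proof -
  show *: "as \<noteq> []" "(v, as) \<in> paths Q" "path_head Q (v, as) = v"
    using assms unfolding prim_iff quiver_cycle_iff by blast+
  show "v \<in> verts Q"
    using *(2) by (rule path_tail_in_verts)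
  show "tail Q (hd as) = v"
    using *(1,2) by (cases as) auto
  show "head Q (last as) = v"
    using *(3) path_head_nonempty[OF *(1)] by simp
qed

lemma prim_power_admissible:
  assumes "prim v as"
  shows "admissible Q Z (v, rep m as)"
proof (cases "m = 0")
  case True
  then show ?thesis using admissible_trivial prim_cycle(4)[OF assms] by simp
next
  case False
  then have "1 \<le> m" by simp
  then show ?thesis using assms unfolding prim_iff by blast
qed

lemma prim_power_head: "prim v as \<Longrightarrow> path_head Q (v, rep m as) = v"
  by (induction m) (simp_all add: prim_cycle(3))

lemma prim_follows:
  assumes "prim v as"
  shows "successively follows as" "follows (last as) (hd as)"
proof -
  have "successively follows (as @ as)"
    using admissible_successively[OF prim_power_admissible[OF assms, of 2]]
    by (simp add: numeral_2_eq_2)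
  then show "successively follows as" "follows (last as) (hd as)"
    using prim_cycle(1)[OF assms] by (auto simp: successively_append_iff)
qed

text \<open>Between two consecutive copies of the root, the path has to return to its start.\<close>

lemma cycle_root:
  assumes "quiver_cycle Q (v, rep m bs)"
  shows "quiver_cycle Q (v, bs)"
proof -
  have ne: "bs \<noteq> []" "m \<noteq> 0" and p: "(v, rep m bs) \<in> paths Q" and h: "path_head Q (v, rep m bs) = v"
    using assms by (auto simp: quiver_cycle_iff rep_eq_Nil)
  then obtain n where m: "m = Suc n" by (cases m) auto
  obtain b cs where b: "bs = b # cs" using ne by (cases bs) auto
  have "path_head Q (v, bs) = v"
  proof (cases n)
    case 0
    then show ?thesis using h m by simp
  next
    case (Suc k)
    then show ?thesis using p m by (auto simp: b)
  qed
  then show ?thesis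
    using p ne by (simp add: m quiver_cycle_iff)
qed

lemma prim_root:
  assumes "prim v as" "as = rep m bs"
  shows "bs = as"
proof -
  have c: "quiver_cycle Q (v, bs)"
    using assms cycle_root[of v m bs] by (simp add: prim_iff)
  have "m \<noteq> 0"
    using assms prim_cycle(1)[OF assms(1)] by auto
  moreover have "\<not> length bs < length as"
    using assms c unfolding prim_iff by blast
  then have "m * length bs \<le> length bs"
    using arg_cong[OF assms(2), of length] unfolding length_rep by linarith
  moreover have "0 < length bs"
    using c by (simp add: quiver_cycle_iff)
  ultimately have "m = 1"
    by (cases m) auto
  then show ?thesis using assms(2) by simp
qed

text \<open>If two primitive cycles have the same first arrow, then either may be followed by the other.  The
  two concatenations have the same length and the same first arrow, hence agree; so the cycles commute
  as words and are powers of a common word.\<close>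

lemma prim_unique:
  assumes "prim v as" "prim w bs" "hd as = hd bs"
  shows "v = w" "as = bs"
proof -
  show "v = w"
    using prim_cycle(5)[OF assms(1)] prim_cycle(5)[OF assms(2)] assms(3) by simp
  have ne: "as \<noteq> []" "bs \<noteq> []"
    using prim_cycle(1) assms(1,2) by blast+
  have "successively follows (as @ bs)" "successively follows (bs @ as)"
    using prim_follows[OF assms(1)] prim_follows[OF assms(2)] assms(3) ne
    by (auto simp: successively_append_iff)
  then have "as @ bs = take (length (as @ bs)) (bs @ as)"
    using ne assms(3) by (intro successively_prefix) auto
  then have "as @ bs = bs @ as" by simp
  then obtain m n zs where "rep m zs = as" "rep n zs = bs"
    using comm_append_are_replicate[of as bs] by blast
  then show "as = bs"
    using prim_root[OF assms(1), of m zs] prim_root[OF assms(2), of n zs] by simp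
qed

lemma prim_arcs: "prim v as \<Longrightarrow> hd as \<in> arcs Q"
  using prim_cycle(1,2)[of v as] path_arcs[of v as] by auto

lemma finite_primitive_cycles: "finite {c. primitive_cycle Q Z c}"
proof (rule inj_on_finite)
  show "inj_on (\<lambda>c. hd (snd c)) {c. primitive_cycle Q Z c}"
    by (rule inj_onI) (auto dest: prim_unique)
  show "(\<lambda>c. hd (snd c)) ` {c. primitive_cycle Q Z c} \<subseteq> arcs Q"
    by (auto dest: prim_arcs)
qed simp

text \<open>A power of the rotated cycle sits inside the next power of the cycle, which gives admissibility.
  If the rotated cycle were a proper power, then rotating back would make the cycle itself one.\<close>

lemma prim_rotate1:
  assumes "prim v (a # as)"
  shows "prim (head Q a) (as @ [a])"
proof -
  note c = prim_cycle[OF assms]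
  have cyc: "quiver_cycle Q (head Q a, as @ [a])"
    using c by (auto simp: quiver_cycle_iff)
  moreover have "admissible Q Z (head Q a, rep m (as @ [a]))" for m
  proof -
    have "rep (Suc m) (a # as) = [a] @ rep m (as @ [a]) @ as"
      using rep_rotate[of a m as] by (simp only: rep_Suc_right) simp
    then have "admissible Q Z (v, [a] @ rep m (as @ [a]) @ as)"
      using prim_power_admissible[OF assms, of "Suc m"] by metis
    then show ?thesis
      using admissible_append[of v "[a]" "rep m (as @ [a]) @ as"]
        admissible_append[of "head Q a" "rep m (as @ [a])" as] by simp
  qed
  moreover have "as @ [a] \<noteq> rep m bs" if "length bs < length (as @ [a])" for m bs
  proof
    assume eq: "as @ [a] = rep m bs"
    then have ne: "bs \<noteq> []" "0 < m"
      by (auto simp: rep_eq_Nil intro: Nat.gr0I)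
    then have "last bs = a"
      using last_rep[of m bs] eq by (metis last_snoc)
    then obtain cs where bs: "bs = cs @ [a]"
      using ne by (metis append_butlast_last_id)
    have "(a # as) @ [a] = rep m (a # cs) @ [a]"
      using rep_rotate[of a m cs] eq by (simp add: bs)
    then have "a # as = rep m (a # cs)" by simp
    then have "a # cs = a # as"
      by (rule prim_root[OF assms])
    then show False using that by (simp add: bs)
  qed
  ultimately show ?thesis
    unfolding prim_iff by blast
qed

lemma prim_rotate:
  assumes "prim v (xs @ ys)"
  shows "prim (path_head Q (v, xs)) (ys @ xs)"
  using assms
proof (induction xs arbitrary: v ys)
  case (Cons a xs)
  then show ?case
    using Cons.IH[of "head Q a" "ys @ [a]"] prim_rotate1[of v a "xs @ ys"] by simp
qed simp

lemma prim_rotate1':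
  assumes "prim v (as @ [a])"
  shows "prim (tail Q a) (a # as)"
proof -
  have "path_head Q (v, as) = tail Q a"
    using prim_cycle(2)[OF assms] by auto
  then show ?thesis
    using prim_rotate[OF assms] by simp
qed

text \<open>After a power of a primitive cycle an admissible path can only continue along the cycle, because the
  last arrow of the cycle has only one successor; dually for the arrow in front of such a power.\<close>

lemma power_then_arrow:
  assumes "prim u cs" "0 < j" "admissible Q Z (u, rep j cs @ s)" "s \<noteq> []"
  shows "hd s = hd cs"
proof -
  have "cs \<noteq> []" using prim_cycle(1)[OF assms(1)] .
  then have "follows (last cs) (hd s)"
    using admissible_successively[OF assms(3)] assms last_rep[of j cs]
    by (auto simp: successively_append_iff rep_eq_Nil)
  then show ?thesis
    using prim_follows(2)[OF assms(1)] follows_unique by blast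
qed

lemma arrow_then_power:
  assumes "prim u cs" "0 < j" "admissible Q Z (v, s @ rep j cs)" "s \<noteq> []"
  shows "last s = last cs"
proof -
  have "cs \<noteq> []" using prim_cycle(1)[OF assms(1)] .
  then have "follows (last s) (hd cs)"
    using admissible_successively[OF assms(3)] assms hd_rep[of j cs]
    by (auto simp: successively_append_iff rep_eq_Nil)
  then show ?thesis
    using prim_follows(2)[OF assms(1)] follows_unique' by blast
qed

lemma powers_compose:
  assumes "prim u cs" "prim v ds" "0 < j" "0 < k" "admissible Q Z (u, rep j cs @ rep k ds)"
  shows "ds = cs" "v = u"
proof -
  have "hd (rep k ds) = hd cs"
    using assms prim_cycle(1)[OF assms(2)] by (intro power_then_arrow) (auto simp: rep_eq_Nil)
  then have "hd cs = hd ds"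
    using assms prim_cycle(1)[OF assms(2)] hd_rep[of k ds] by simp
  then show "ds = cs" "v = u"
    using prim_unique[OF assms(1,2)] by auto
qed


subsection \<open>Arrows on primitive cycles\<close>

text \<open>By rotation, the arrows that start a primitive cycle are exactly the arrows on primitive cycles.\<close>

definition cyclic :: "'a \<Rightarrow> bool" where
  "cyclic a \<longleftrightarrow> (\<exists>v as. prim v as \<and> hd as = a)"

definition cycle_at :: "'a \<Rightarrow> 'a list" where
  "cycle_at a = (THE as. \<exists>v. prim v as \<and> hd as = a)"

lemma cycle_at_eq: "prim v as \<Longrightarrow> cycle_at (hd as) = as"
  unfolding cycle_at_def by (rule the_equality) (use prim_unique in blast)+

lemma cyclic_prim:
  assumes "cyclic a" shows "prim (tail Q a) (cycle_at a)" "hd (cycle_at a) = a"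
proof -
  obtain v as where "prim v as" "hd as = a"
    using assms by (auto simp: cyclic_def)
  then show "prim (tail Q a) (cycle_at a)" "hd (cycle_at a) = a"
    using cycle_at_eq prim_cycle(5) by auto
qed

lemma cyclicI: "prim v as \<Longrightarrow> cyclic (hd as)"
  unfolding cyclic_def by blast

text \<open>If admissible paths starting with \<open>a\<close> are arbitrarily long, some arrow repeats; as every arrow
  has at most one predecessor, the first repeating arrow is \<open>a\<close>, and the walk is purely periodic.\<close>

lemma repeats_first:
  assumes "successively follows as" "\<not> distinct as"
  obtains k where "0 < k" "k < length as" "as ! k = as ! 0"
proof -
  obtain i j where ij: "i < j" "j < length as" "as ! i = as ! j"
    using assms(2) unfolding distinct_conv_nth by (metis linorder_neqE_nat)
  have "as ! (j - i) = as ! 0"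
    using ij
  proof (induction i arbitrary: j)
    case (Suc i)
    then obtain j' where j: "j = Suc j'" by (cases j) auto
    have "follows (as ! i) (as ! Suc i)" "follows (as ! j') (as ! Suc j')"
      using successively_nth[OF assms(1)] Suc.prems(1,2) j by auto
    then have "as ! i = as ! j'"
      using Suc j follows_unique' by auto
    then show ?case
      using Suc.IH[of j'] Suc.prems j by simp
  qed simp
  then show ?thesis
    using that[of "j - i"] ij by simp
qed

lemma noncyclic_bounded:
  assumes "\<not> cyclic a"
  shows "\<exists>N. \<forall>v as. admissible Q Z (v, a # as) \<longrightarrow> length as < N"
proof (rule ccontr)
  assume "\<not> ?thesis"
  then have long: "\<exists>v as. admissible Q Z (v, a # as) \<and> N \<le> length as" for N
    by (meson not_le)
  obtain v as where as: "admissible Q Z (v, a # as)" "card (arcs Q) \<le> length as"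
    using long by blast
  have sub: "set (a # as) \<subseteq> arcs Q"
    using path_arcs admissible_paths[OF as(1)] by blast
  have "\<not> distinct (a # as)"
  proof
    assume "distinct (a # as)"
    then have "length (a # as) = card (set (a # as))"
      using distinct_card by metis
    also have "\<dots> \<le> card (arcs Q)"
      using sub by (intro card_mono) auto
    finally show False using as(2) by simp
  qed
  then obtain k where k: "0 < k" "k < length (a # as)" "(a # as) ! k = a"
    using repeats_first[OF admissible_successively[OF as(1)]] by (metis nth_Cons_0)
  define u where "u = take k (a # as)"
  have split: "a # as = u @ drop k (a # as)" "drop k (a # as) \<noteq> []" "hd (drop k (a # as)) = a"
    using k by (auto simp: u_def hd_drop_conv_nth)
  have une: "u \<noteq> []" and hdu: "hd u = a"
    using k by (auto simp: u_def hd_conv_nth)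
  have "successively follows (u @ drop k (a # as))"
    using admissible_successively[OF as(1)] split(1) by simp
  then have "successively follows u" "follows (last u) (hd (drop k (a # as)))"
    using une split(2) unfolding successively_append_iff by blast+
  then have succ_u: "successively follows u" "follows (last u) (hd u)"
    unfolding hdu split(3) by blast+
  have "admissible Q Z (v, u @ drop k (a # as))"
    using as(1) split(1) by simp
  then have up: "(v, u) \<in> paths Q"
    using admissible_append[of v u] admissible_paths by blast
  then have v: "v = tail Q a"
    using une hdu by (cases u) auto
  then have cyc: "quiver_cycle Q (v, u)"
    using up une succ_u(2) hdu path_head_nonempty[OF une, of v]
    by (simp add: quiver_cycle_iff follows_def)
  \<comment> \<open>every power of \<open>u\<close> is the beginning of a long enough admissible path starting with \<open>a\<close>\<close>
  have adm: "admissible Q Z (v, rep m u)" if "0 < m" for m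
  proof -
    obtain w bs where bs: "admissible Q Z (w, a # bs)" "m * length u \<le> length bs"
      using long by blast
    have "w = v"
      using admissible_paths[OF bs(1)] v by simp
    have "rep m u = take (length (rep m u)) (a # bs)"
      using succ_u une hdu that bs admissible_successively[OF bs(1)]
      by (intro successively_prefix successively_rep) (auto simp: length_rep rep_eq_Nil hd_rep)
    then have "a # bs = rep m u @ drop (length (rep m u)) (a # bs)"
      by (metis append_take_drop_id)
    then show ?thesis
      using bs(1) admissible_append[of v "rep m u"] \<open>w = v\<close> by metis
  qed
  \<comment> \<open>the shortest root of the periodic part is the primitive cycle\<close>
  obtain cs m where cs: "u = rep m cs" and minimal: "\<And>ds l. u = rep l ds \<Longrightarrow> length cs \<le> length ds"
  proof -
    have "\<exists>cs. (\<exists>m. u = rep m cs)"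
      by (rule exI[of _ u], rule exI[of _ 1]) simp
    then obtain cs where "\<exists>m. u = rep m cs" "\<forall>ds. (\<exists>l. u = rep l ds) \<longrightarrow> length cs \<le> length ds"
      using ex_has_least_nat[of "\<lambda>cs. \<exists>m. u = rep m cs" _ length] by metis
    then show ?thesis using that by blast
  qed
  have m: "0 < m" and csne: "cs \<noteq> []"
    using une cs by (auto simp: rep_eq_Nil)
  have "prim v cs"
    unfolding prim_iff
  proof (intro conjI allI impI)
    show "quiver_cycle Q (v, cs)"
      using cyc cycle_root by (simp add: cs)
    show "admissible Q Z (v, rep l cs)" if "1 \<le> l" for l
    proof -
      have "m * l = l + (m - 1) * l"
        using m by (cases m) auto
      then have "rep l u = rep l cs @ rep ((m - 1) * l) cs"
        by (metis cs mult.commute rep_add rep_mult)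
      then show ?thesis
        using adm[of l] admissible_append[of v "rep l cs"] that by simp
    qed
    show "cs \<noteq> rep l ds" if "quiver_cycle Q (v, ds)" "length ds < length cs" for ds l
    proof
      assume "cs = rep l ds"
      then have "u = rep (m * l) ds"
        using cs by (simp add: rep_mult)
      then show False using minimal that(2) by fastforce
    qed
  qed
  moreover have "hd cs = a"
    using hd_rep[OF m csne] cs hdu by simp
  ultimately show False
    using assms by (auto simp: cyclic_def)
qed


subsection \<open>Splitting off powers of a primitive cycle\<close>

text \<open>The number of turns of the cycle that can be split off while leaving a nontrivial path; so a
  primitive cycle itself has exponent 0 and is its own base.  Paths that do not start on a primitive
  cycle have exponent 0.\<close>

definition exponent :: "('v, 'a) qpath \<Rightarrow> nat" where
  "exponent p = (if snd p \<noteq> [] \<and> cyclic (hd (snd p))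
    then (length (snd p) - 1) div length (cycle_at (hd (snd p))) else 0)"

definition base :: "('v, 'a) qpath \<Rightarrow> ('v, 'a) qpath" where
  "base p = (fst p, drop (exponent p * length (cycle_at (hd (snd p)))) (snd p))"

lemma base_noncyclic: "snd p = [] \<or> \<not> cyclic (hd (snd p)) \<Longrightarrow> base p = p \<and> exponent p = 0"
  by (auto simp: base_def exponent_def)

text \<open>An admissible path that starts with an arrow of a primitive cycle runs along this cycle.\<close>

lemma cyclic_split:
  assumes p: "admissible Q Z (v, as)" "as \<noteq> []" "cyclic (hd as)"
  defines "cs \<equiv> cycle_at (hd as)"
  obtains qs where "as = rep (exponent (v, as)) cs @ qs" "base (v, as) = (v, qs)"
    "qs \<noteq> []" "length qs \<le> length cs" "hd qs = hd as" "admissible Q Z (v, qs)" "prim v cs"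
proof -
  let ?k = "exponent (v, as)"
  define qs where "qs = drop (?k * length cs) as"
  have v: "tail Q (hd as) = v"
    using admissible_paths[OF p(1)] p(2) by (cases as) auto
  have pr: "prim v cs" and hd_cs: "hd cs = hd as"
    using cyclic_prim[OF p(3)] v by (auto simp: cs_def)
  have len: "0 < length cs"
    using prim_cycle(1)[OF pr] by simp
  have k: "?k = (length as - 1) div length cs"
    using p by (simp add: exponent_def cs_def)
  have "?k * length cs \<le> length as - 1" "length as - 1 < ?k * length cs + length cs"
    unfolding k using len by (simp_all add: div_times_less_eq_dividend dividend_less_div_times add.commute)
  moreover have "0 < length as" using p(2) by simp
  ultimately have lens: "?k * length cs < length as" "length as \<le> ?k * length cs + length cs"
    by linarith+
  have "rep ?k cs = take (?k * length cs) as"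
  proof (cases "?k = 0")
    case False
    have "rep ?k cs = take (length (rep ?k cs)) as"
      using False prim_follows[OF pr] admissible_successively[OF p(1)] lens(1) len hd_cs
      by (intro successively_prefix successively_rep) (auto simp: length_rep rep_eq_Nil hd_rep)
    then show ?thesis by (simp add: length_rep)
  qed simp
  then have as: "as = rep ?k cs @ qs"
    by (simp add: qs_def)
  have ne: "qs \<noteq> []" "length qs \<le> length cs"
    using lens by (auto simp: qs_def)
  have adm: "admissible Q Z (v, rep ?k cs @ qs)"
    using p(1) as by simp
  have "hd qs = hd as"
  proof (cases "?k = 0")
    case True
    then show ?thesis using as by simp
  next
    case False
    then show ?thesis
      using power_then_arrow[OF pr _ adm ne(1)] hd_cs by simp
  qed
  moreover have "admissible Q Z (v, qs)"
    using admissible_append[OF adm] prim_power_head[OF pr] by simp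
  moreover have "base (v, as) = (v, qs)"
    by (simp add: base_def qs_def cs_def)
  ultimately show ?thesis
    using that as ne pr by blast
qed

lemma cyclic_split_unique:
  assumes "prim v cs" "qs \<noteq> []" "length qs \<le> length cs" "hd qs = hd cs"
  shows "exponent (v, rep k cs @ qs) = k" "base (v, rep k cs @ qs) = (v, qs)"
proof -
  have csne: "cs \<noteq> []" using prim_cycle(1)[OF assms(1)] .
  have hd: "hd (rep k cs @ qs) = hd cs"
    using assms csne hd_rep[of k cs] by (cases "k = 0") (auto simp: hd_append rep_eq_Nil)
  have cyc: "cyclic (hd cs)" "cycle_at (hd cs) = cs"
    using cyclicI[OF assms(1)] cycle_at_eq[OF assms(1)] by auto
  have l: "length (rep k cs @ qs) - 1 = k * length cs + (length qs - 1)"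
    using assms(2) by (cases qs) (auto simp: length_rep)
  have "length qs - 1 < length cs"
    using assms by (cases qs) auto
  then have "(length (rep k cs @ qs) - 1) div length cs = k"
    unfolding l using csne by simp
  then show e: "exponent (v, rep k cs @ qs) = k"
    using hd cyc assms(2) by (simp add: exponent_def)
  show "base (v, rep k cs @ qs) = (v, qs)"
    unfolding base_def e snd_conv fst_conv hd cyc(2) by (simp add: length_rep)
qed


text \<open>A base path makes at most one turn of a primitive cycle, or starts with an arrow from which admissible
  paths have bounded length.\<close>

lemma finite_base_paths: "finite {p. admissible Q Z p \<and> base p = p}"
proof -
  have "\<exists>N. \<forall>v as. admissible Q Z (v, a # as) \<and> base (v, a # as) = (v, a # as) \<longrightarrow> length as < N" for a
  proof (cases "cyclic a")
    case True
    have "length as < length (cycle_at a)"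
      if as: "admissible Q Z (v, a # as)" "base (v, a # as) = (v, a # as)" for v as
    proof -
      obtain qs where "base (v, a # as) = (v, qs)" "length qs \<le> length (cycle_at a)"
        using cyclic_split[OF as(1)] True by auto
      then show ?thesis using as(2) by auto
    qed
    then show ?thesis by blast
  next
    case False
    then show ?thesis using noncyclic_bounded by blast
  qed
  then obtain N where N: "\<And>a v as. admissible Q Z (v, a # as) \<Longrightarrow> base (v, a # as) = (v, a # as)
      \<Longrightarrow> length as < N a"
    by metis
  have "path_length p < Suc (\<Sum>a\<in>arcs Q. N a)" if p: "admissible Q Z p" "base p = p" for p
  proof -
    obtain v as where pe: "p = (v, as)" by (cases p)
    show ?thesis
    proof (cases as)
      case (Cons a bs)
      then have "a \<in> arcs Q"
        using admissible_paths[OF p(1)] pe by simp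
      then have "N a \<le> (\<Sum>a\<in>arcs Q. N a)"
        by (intro member_le_sum) auto
      then show ?thesis
        using N[of v a bs] p Cons pe by simp
    qed (simp add: pe)
  qed
  then have "{p. admissible Q Z p \<and> base p = p}
      \<subseteq> {p \<in> paths Q. path_length p < Suc (\<Sum>a\<in>arcs Q. N a)}"
    using admissible_paths by blast
  then show ?thesis
    using finite_paths_of_length_less finite_subset by blast
qed


subsection \<open>The primitive-nerve partition\<close>

lemma nerve_equiv_equiv: "equiv (nerve_verts Q Z) (nerve_equiv Q Z)"
proof -
  let ?V = "nerve_verts Q Z"
  let ?S = "\<Union>c\<in>{c. primitive_cycle Q Z c}. path_verts Q c \<times> path_verts Q c"
  have univ: "?V \<times> ?V \<in> {E. equiv ?V E \<and> ?S \<subseteq> E}"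
    by (auto simp: nerve_verts_def intro!: equivI refl_onI symI transI)
  show ?thesis
    unfolding nerve_equiv_def
  proof (rule equivI)
    show "\<Inter>{E. equiv ?V E \<and> ?S \<subseteq> E} \<subseteq> ?V \<times> ?V"
      using univ by blast
    show "refl_on ?V (\<Inter>{E. equiv ?V E \<and> ?S \<subseteq> E})"
      by (rule refl_onI) (auto simp: equiv_def refl_on_def)
    show "sym (\<Inter>{E. equiv ?V E \<and> ?S \<subseteq> E})"
      by (rule symI) (auto simp: equiv_def dest: symD)
    show "trans (\<Inter>{E. equiv ?V E \<and> ?S \<subseteq> E})"
      by (rule transI) (auto simp: equiv_def dest: transD)
  qed
qed

lemma nerve_equivI:
  "primitive_cycle Q Z c \<Longrightarrow> u \<in> path_verts Q c \<Longrightarrow> w \<in> path_verts Q c \<Longrightarrow> (u, w) \<in> nerve_equiv Q Z"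
  unfolding nerve_equiv_def by blast

end


(* This keeps the index set {1..n} in one syntactic form. *)
declare One_nat_def [simp del]

section \<open>Power series acting on the algebra of admissible paths\<close>

locale nerve_setting = special_quiver Q Z + string_alg Q Z K
  for Q :: "('v, 'a) pre_digraph" and Z and K (structure) +
  fixes n :: nat and W :: "nat \<Rightarrow> 'v set"
  assumes W_bij: "bij_betw W {1..n} (nerve_partition Q Z)"
begin

sublocale pser: power_series K "{1..n}" ..

abbreviation R where "R \<equiv> power_series_ring K {1..n}"

sublocale rq: path_alg Q R
  by (intro path_alg.intro quiver_axioms pser.ps_cring)

declare pser.ps_carrier [simp]

abbreviation RQ where "RQ \<equiv> path_algebra R Q"

abbreviation series where "series \<equiv> pser.ps.coeffs"

lemma W_class: "i \<in> {1..n} \<Longrightarrow> W i \<in> nerve_verts Q Z // nerve_equiv Q Z"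
  using W_bij by (auto simp: bij_betw_def nerve_partition_def)

lemma nerve_verts_subset: "nerve_verts Q Z \<subseteq> verts Q"
proof
  fix v assume "v \<in> nerve_verts Q Z"
  then obtain u as where c: "prim u as" and v: "v \<in> path_verts Q (u, as)"
    by (auto simp: nerve_verts_def)
  have "set as \<subseteq> arcs Q"
    using path_arcs prim_cycle(2)[OF c] by blast
  then show "v \<in> verts Q"
    using v by (auto simp: path_verts_def)
qed

lemma W_verts: "i \<in> {1..n} \<Longrightarrow> W i \<subseteq> verts Q"
  using in_quotient_imp_subset[OF nerve_equiv_equiv W_class] nerve_verts_subset by blast

lemma W_disjoint:
  assumes "i \<in> {1..n}" "j \<in> {1..n}" "v \<in> W i" "v \<in> W j"
  shows "i = j"
proof -
  have "W i = W j"
    using quotient_disj[OF nerve_equiv_equiv W_class[OF assms(1)] W_class[OF assms(2)]] assms by blast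
  then show ?thesis
    using inj_onD[OF bij_betw_imp_inj_on[OF W_bij]] assms(1,2) by blast
qed

definition cls :: "'v \<Rightarrow> nat" where
  "cls v = (THE i. i \<in> {1..n} \<and> v \<in> W i)"

lemma cls_eq: "i \<in> {1..n} \<Longrightarrow> v \<in> W i \<Longrightarrow> cls v = i"
  unfolding cls_def by (rule the_equality) (use W_disjoint in blast)+

lemma prim_vertex: "prim v as \<Longrightarrow> v \<in> path_verts Q (v, as)"
  using prim_cycle(1,5)[of v as] by (auto simp: path_verts_def intro!: image_eqI[of _ _ "hd as"])

lemma cls_prim:
  assumes "prim v as"
  shows "cls v \<in> {1..n}" "v \<in> W (cls v)"
proof -
  have "v \<in> nerve_verts Q Z"
    using assms prim_vertex by (auto simp: nerve_verts_def)
  then have "v \<in> \<Union>(nerve_verts Q Z // nerve_equiv Q Z)"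
    using Union_quotient[OF nerve_equiv_equiv] by simp
  then obtain i where "i \<in> {1..n}" "v \<in> W i"
    using bij_betw_imp_surj_on[OF W_bij] unfolding nerve_partition_def by blast
  then show "cls v \<in> {1..n}" "v \<in> W (cls v)"
    using cls_eq by auto
qed

lemma cls_path_verts:
  assumes "prim v as" "u \<in> path_verts Q (v, as)"
  shows "cls u = cls v"
proof -
  have "(v, u) \<in> nerve_equiv Q Z"
    using nerve_equivI[OF assms(1) prim_vertex[OF assms(1)] assms(2)] .
  then have "u \<in> W (cls v)"
    using in_quotient_imp_closed[OF nerve_equiv_equiv W_class[OF cls_prim(1)[OF assms(1)]]]
      cls_prim(2)[OF assms(1)] by blast
  then show ?thesis
    using cls_eq cls_prim(1)[OF assms(1)] by blast
qed

text \<open>The \<open>j\<close>-th power of a primitive cycle of class \<open>i\<close> corresponds to the monomial \<open>t\<^sub>i\<^sup>j\<close>; the trivial paths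
  are the zeroth powers.  So \<open>act r\<close> is the image in \<open>\<Gamma>\<close> of the power series \<open>r\<close> when every \<open>t\<^sub>i\<close> is
  replaced by the sum of all primitive cycles of class \<open>i\<close>.\<close>

definition power_monomial :: "('v, 'a) qpath \<Rightarrow> nat multiset option" where
  "power_monomial w = (if w \<in> trivial_path ` verts Q then Some {#}
     else if \<exists>as j. 0 < j \<and> prim (fst w) as \<and> snd w = rep j as
     then Some (replicate_mset (THE j. \<exists>as. prim (fst w) as \<and> snd w = rep j as) (cls (fst w)))
     else None)"

definition act :: "(nat multiset \<Rightarrow> 'b) \<Rightarrow> ('v, 'a) qpath \<Rightarrow> 'b" where
  "act r w = (case power_monomial w of None \<Rightarrow> \<zero> | Some m \<Rightarrow> r m)"

lemma act_trivial: "v \<in> verts Q \<Longrightarrow> act r (v, []) = r {#}"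
  by (auto simp: act_def power_monomial_def trivial_path_def)

lemma power_eq_iff:
  assumes "prim v as" "prim v bs" "rep j as = rep k bs" "0 < j"
  shows "bs = as" "k = j"
proof -
  have ne: "as \<noteq> []" "bs \<noteq> []"
    using assms prim_cycle(1) by blast+
  have "0 < k"
    using assms ne by (cases k) (auto simp: rep_eq_Nil)
  then have "hd as = hd bs"
    using hd_rep[of j as] hd_rep[of k bs] assms ne by simp
  then show "bs = as"
    using prim_unique(2)[OF assms(1,2)] by simp
  then show "k = j"
    using arg_cong[OF assms(3), of length] ne by (simp add: length_rep)
qed

lemma act_power:
  assumes "prim v as"
  shows "act r (v, rep j as) = r (replicate_mset j (cls v))"
proof (cases "j = 0")
  case True
  then show ?thesis
    using act_trivial[OF prim_cycle(4)[OF assms]] by simp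
next
  case False
  have "(THE k. \<exists>bs. prim v bs \<and> rep j as = rep k bs) = j"
  proof (rule the_equality)
    fix k assume "\<exists>bs. prim v bs \<and> rep j as = rep k bs"
    then show "k = j"
      using power_eq_iff(2)[OF assms] False by blast
  qed (use assms in blast)
  moreover have "(v, rep j as) \<notin> trivial_path ` verts Q"
    using False prim_cycle(1)[OF assms] by (auto simp: trivial_path_def rep_eq_Nil)
  moreover have "\<exists>bs k. 0 < k \<and> prim v bs \<and> rep j as = rep k bs"
    using assms False by blast
  ultimately show ?thesis
    by (simp add: act_def power_monomial_def)
qed

lemma act_nonzero:
  assumes "act r w \<noteq> \<zero>"
  obtains v where "v \<in> verts Q" "w = (v, [])"
  | v as j where "prim v as" "0 < j" "w = (v, rep j as)"
proof (cases "w \<in> trivial_path ` verts Q")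
  case True
  then show ?thesis using that(1) by (auto simp: trivial_path_def)
next
  case False
  then have "\<exists>as j. 0 < j \<and> prim (fst w) as \<and> snd w = rep j as"
    using assms by (auto simp: act_def power_monomial_def split: if_splits)
  then show ?thesis
    using that(2) by (metis prod.collapse)
qed

lemma act_closed: "r \<in> series \<Longrightarrow> act r \<in> ad.coeffs"
proof (rule ad.coeffsI)
  show "act r w \<in> carrier K" if "r \<in> series" for w
    using that by (simp add: act_def split: option.split)
  show "act r w = \<zero>" if w: "w \<notin> {p. admissible Q Z p}" for w
  proof (rule ccontr)
    assume "act r w \<noteq> \<zero>"
    then show False
      by (rule act_nonzero) (use w admissible_trivial prim_power_admissible in auto)
  qed
qed

lemma act_zero: "act (\<lambda>m. \<zero>) = (\<lambda>w. \<zero>)"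
  by (rule ext) (simp add: act_def split: option.split)

lemma act_add:
  "r \<in> series \<Longrightarrow> s \<in> series \<Longrightarrow> act (\<lambda>m. r m \<oplus> s m) = (\<lambda>w. act r w \<oplus> act s w)"
  by (rule ext) (simp add: act_def split: option.split)

lemma act_scale:
  "k \<in> carrier K \<Longrightarrow> r \<in> series \<Longrightarrow> act (\<lambda>m. k \<otimes> r m) = (\<lambda>w. k \<otimes> act r w)"
  by (rule ext) (simp add: act_def split: option.split)

lemma act_one: "act pser.ps.conv_one = ad.conv_one"
proof
  fix w
  have "act pser.ps.conv_one w = \<zero>" if w: "w \<notin> trivial_path ` verts Q"
  proof (rule ccontr)
    assume nz: "act pser.ps.conv_one w \<noteq> \<zero>"
    then show False
    proof (rule act_nonzero)
      fix v as j assume "prim v as" "0 < j" "w = (v, rep j as)"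
      then show False
        using nz by (simp add: act_power pser.ps.conv_one_def)
    qed (use w in \<open>auto simp: trivial_path_def\<close>)
  qed
  moreover have "act pser.ps.conv_one w = \<one>" if "w \<in> trivial_path ` verts Q"
    using that act_trivial[of _ pser.ps.conv_one] by (auto simp: pser.ps.conv_one_def trivial_path_def)
  ultimately show "act pser.ps.conv_one w = ad.conv_one w"
    by (simp add: ad.conv_one_def)
qed

text \<open>A product of powers of primitive cycles is admissible only if the cycles agree, so powers of
  one cycle multiply like powers of one variable and mixed products vanish.\<close>

lemma act_mult:
  assumes r: "r \<in> series" and s: "s \<in> series"
  shows "act (pser.ps.conv r s) = ad.conv (act r) (act s)"
proof
  fix w :: "('v, 'a) qpath"
  obtain v ws where w: "w = (v, ws)" by (cases w)
  note rs = pser.ps.conv_closed[OF r s]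
  have ar: "act r \<in> ad.coeffs" and as: "act s \<in> ad.coeffs"
    using r s act_closed by auto
  have split: "(case x of (q, u) \<Rightarrow> act r q \<otimes> act s u) = \<zero>"
    if "\<And>q u. x = (q, u) \<Longrightarrow> act r q = \<zero> \<or> act s u = \<zero>" for x
    using that ar as by (cases x) auto
  consider "\<not> admissible Q Z w" | "ws = []" "v \<in> verts Q"
    | as j where "prim v as" "0 < j" "ws = rep j as"
    | "admissible Q Z w" "ws \<noteq> []" "\<And>as j. prim v as \<Longrightarrow> 0 < j \<Longrightarrow> ws \<noteq> rep j as"
    using admissible_paths[of w] path_tail_in_verts by (cases ws) (auto simp: w)
  then show "act (pser.ps.conv r s) w = ad.conv (act r) (act s) w"
  proof cases
    case 1
    then show ?thesis
      using ad.coeffs_outside[OF act_closed[OF rs]] ad.coeffs_outside[OF ad.conv_closed[OF ar as]]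
      by simp
  next
    case 2
    have "ad.conv (act r) (act s) w = (case (w, w) of (q, u) \<Rightarrow> act r q \<otimes> act s u)"
      unfolding ad.conv_def
    proof (rule finsum_eq_single)
      show "(w, w) \<in> ad.factorisations w"
        using 2 by (auto simp: w ad.factorisations_def acomposable_def admissible_trivial)
      show "(case x of (q, u) \<Rightarrow> act r q \<otimes> act s u) = \<zero>"
        if "x \<in> ad.factorisations w" "x \<noteq> (w, w)" for x
        using that 2 by (auto simp: w ad.factorisations_def acomposable_def path_comp_def
            composable_def path_head_def path_tail_def)
    qed (use ar as in auto)
    moreover have "pser.ps.conv r s {#} = r {#} \<otimes> s {#}"
      using pser.ps_mult_replicate[OF r s, of 0] r s by simp
    ultimately show ?thesis
      using 2 by (simp add: w act_trivial)
  next
    case (3 as' j)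
    \<comment> \<open>only factorisations into two powers of the same cycle contribute\<close>
    let ?h = "\<lambda>k. ((v, rep k as'), (v, rep (j - k) as'))"
    let ?f = "\<lambda>(q, u). act r q \<otimes> act s u"
    have inj: "inj_on ?h {..j}"
      using prim_cycle(1)[OF 3(1)] by (auto simp: inj_on_def dest: arg_cong[where f = length] simp: length_rep)
    have "ad.conv (act r) (act s) w = finsum K ?f (?h ` {..j})"
      unfolding ad.conv_def
    proof (rule add.finprod_mono_neutral_cong_right)
      show "?h ` {..j} \<subseteq> ad.factorisations w"
      proof clarify
        fix k assume "k \<le> j"
        then have e: "rep j as' = rep (j - k) as' @ rep k as'"
          using rep_add[of "j - k" k as'] by simp
        have "admissible Q Z (v, rep (j - k) as' @ rep k as')"
          using prim_power_admissible[OF 3(1), of j] e by simp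
        then show "?h k \<in> ad.factorisations w"
          using admissible_paths[OF prim_power_admissible[OF 3(1)]] prim_power_head[OF 3(1)] e 3(3)
          by (auto simp: w ad.factorisations_def acomposable_def)
      qed
      show "?f x = \<zero>" if x: "x \<in> ad.factorisations w - ?h ` {..j}" for x
      proof (rule split)
        fix q u assume xe: "x = (q, u)"
        show "act r q = \<zero> \<or> act s u = \<zero>"
        proof (rule ccontr)
          assume nz: "\<not> ?thesis"
          obtain q1 q2 u1 u2 where qu: "q = (q1, q2)" "u = (u1, u2)"
            by (cases q, cases u)
          have comp: "u1 = v" "u2 @ q2 = rep j as'" "q1 = path_head Q (v, u2)"
            using x 3(3) by (auto simp: xe qu w ad.factorisations_def acomposable_def)
          from nz have "act s u \<noteq> \<zero>" by simp
          then have "\<exists>l\<le>j. u2 = rep l as'"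
          proof (rule act_nonzero)
            fix v' assume "u = (v', [])"
            then show ?thesis by (auto simp: qu intro!: exI[of _ 0])
          next
            fix v' ds l assume ds: "prim v' ds" "0 < l" "u = (v', rep l ds)"
            have ne: "ds \<noteq> []" "as' \<noteq> []"
              using ds(1) 3(1) prim_cycle(1) by blast+
            have "hd (rep j as') = hd (rep l ds)"
              using comp(2) ds ne qu by (metis hd_append2 rep_eq_Nil less_numeral_extra(3) snd_conv)
            then have "hd as' = hd ds"
              using hd_rep[of j as'] hd_rep[of l ds] 3(2) ds(2) ne by simp
            then have "ds = as'"
              using prim_unique(2)[OF 3(1) ds(1)] by simp
            moreover have "length (rep l as') \<le> length (rep j as')"
              using comp(2) ds(3) qu \<open>ds = as'\<close> by (metis length_append le_add1 snd_conv)
            ultimately show ?thesis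
              using ds(3) qu ne by (auto simp: length_rep)
          qed
          then obtain l where l: "l \<le> j" "u2 = rep l as'" by blast
          have "rep j as' = rep l as' @ rep (j - l) as'"
            using rep_add[of l "j - l" as'] l(1) by simp
          then have "q2 = rep (j - l) as'"
            using comp(2) l(2) by simp
          then have "x = ?h (j - l)"
            using comp l prim_power_head[OF 3(1)] by (simp add: xe qu)
          then show False using x by auto
        qed
      qed
    qed (use ar as in auto)
    also have "\<dots> = (\<Oplus>k\<in>{..j}. ?f (?h k))"
      using inj ar as by (intro finsum_reindex) auto
    also have "\<dots> = (\<Oplus>k\<in>{..j}. r (replicate_mset k (cls v)) \<otimes> s (replicate_mset (j - k) (cls v)))"
      by (rule finsum_cong') (use r s in \<open>auto simp: act_power[OF 3(1)]\<close>)
    also have "\<dots> = act (pser.ps.conv r s) w"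
      by (simp add: w 3(3) act_power[OF 3(1)] pser.ps_mult_replicate[OF r s])
    finally show ?thesis by simp
  next
    case 4
    have "act (pser.ps.conv r s) w = \<zero>"
    proof (rule ccontr)
      assume "act (pser.ps.conv r s) w \<noteq> \<zero>"
      then show False
        by (rule act_nonzero) (use 4 w in auto)
    qed
    moreover have "ad.conv (act r) (act s) w = \<zero>"
      unfolding ad.conv_def
    proof (rule finsum_eq_zero, rule split)
      fix x q u assume x: "x \<in> ad.factorisations w" and xe: "x = (q, u)"
      show "act r q = \<zero> \<or> act s u = \<zero>"
      proof (rule ccontr)
        assume nz: "\<not> ?thesis"
        obtain q1 q2 u1 u2 where qu: "q = (q1, q2)" "u = (u1, u2)"
          by (cases q, cases u)
        have comp: "u1 = v" "u2 @ q2 = ws" "q1 = path_head Q (v, u2)"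
          using x by (auto simp: xe qu w ad.factorisations_def acomposable_def)
        from nz have "act s u \<noteq> \<zero>" "act r q \<noteq> \<zero>" by auto
        from this(1) show False
        proof (rule act_nonzero)
          fix v' assume u: "u = (v', [])"
          from \<open>act r q \<noteq> \<zero>\<close> show False
            by (rule act_nonzero) (use u comp qu 4(2,3) in auto)
        next
          fix v' cs k assume u: "prim v' cs" "0 < k" "u = (v', rep k cs)"
          from \<open>act r q \<noteq> \<zero>\<close> show False
          proof (rule act_nonzero)
            fix v'' assume "q = (v'', [])"
            then show False using u comp qu 4(3) by auto
          next
            fix v'' ds l assume q: "prim v'' ds" "0 < l" "q = (v'', rep l ds)"
            have "admissible Q Z (v', rep k cs @ rep l ds)"
              using 4(1) comp u(3) q(3) by (simp add: w qu)
            then have "ds = cs"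
              using powers_compose(1)[OF u(1) q(1) u(2) q(2)] by simp
            then have "ws = rep (k + l) cs"
              using comp u q by (simp add: qu rep_add)
            then show False using 4(3)[of cs "k + l"] u comp qu by simp
          qed
        qed
      qed
    qed
    ultimately show ?thesis by simp
  qed
qed

text \<open>The image of a path in \<open>\<Gamma>\<close>.\<close>

definition adm_path :: "('v, 'a) qpath \<Rightarrow> ('v, 'a) qpath \<Rightarrow> 'b" where
  "adm_path p = (if admissible Q Z p then ad.single p \<one> else (\<lambda>_. \<zero>))"

lemma adm_path_closed: "adm_path p \<in> ad.coeffs"
  by (simp add: adm_path_def ad.single_in_coeffs ad.coeffs_zero)

lemma conv_zero_left: "f \<in> ad.coeffs \<Longrightarrow> ad.conv (\<lambda>_. \<zero>) f = (\<lambda>_. \<zero>)"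
  unfolding ad.conv_def by (rule ext, rule finsum_eq_zero) auto

lemma conv_zero_right: "f \<in> ad.coeffs \<Longrightarrow> ad.conv f (\<lambda>_. \<zero>) = (\<lambda>_. \<zero>)"
  unfolding ad.conv_def by (rule ext, rule finsum_eq_zero) auto

lemma adm_path_mult:
  "ad.conv (adm_path p) (adm_path q) = (if composable p q then adm_path (path_comp p q) else (\<lambda>_. \<zero>))"
proof (cases "admissible Q Z p \<and> admissible Q Z q")
  case True
  then show ?thesis
    by (simp add: adm_path_def ad.conv_single_single acomposable_def)
next
  case False
  then have "adm_path p = (\<lambda>_. \<zero>) \<or> adm_path q = (\<lambda>_. \<zero>)"
    by (auto simp: adm_path_def)
  then have "ad.conv (adm_path p) (adm_path q) = (\<lambda>_. \<zero>)"
    using conv_zero_left[OF adm_path_closed[of q]] conv_zero_right[OF adm_path_closed[of p]] by auto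
  moreover have "\<not> admissible Q Z (path_comp p q)" if "composable p q"
    using admissible_factors[OF _ that] False by blast
  ultimately show ?thesis
    by (simp add: adm_path_def)
qed

lemma adm_path_conv_comp:
  "admissible Q Z q \<Longrightarrow> acomposable q w \<Longrightarrow> f \<in> ad.coeffs \<Longrightarrow> ad.conv (adm_path q) f (path_comp q w) = f w"
  by (simp add: adm_path_def ad.conv_single_left)

lemma conv_adm_path_comp:
  "admissible Q Z q \<Longrightarrow> acomposable w q \<Longrightarrow> f \<in> ad.coeffs \<Longrightarrow> ad.conv f (adm_path q) (path_comp w q) = f w"
  by (simp add: adm_path_def ad.conv_single_right)

text \<open>Multiplication with a path shifts coefficients, so commuting with it means that every path in the
  support can be moved to its other side without changing the coefficient.\<close>

lemma adm_path_commuteI: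
  assumes q: "admissible Q Z q" and f: "f \<in> ad.coeffs"
    and right: "\<And>w. acomposable w q \<Longrightarrow> f w \<noteq> \<zero>
      \<Longrightarrow> \<exists>w'. acomposable q w' \<and> path_comp q w' = path_comp w q \<and> f w' = f w"
    and left: "\<And>w. acomposable q w \<Longrightarrow> f w \<noteq> \<zero>
      \<Longrightarrow> \<exists>w'. acomposable w' q \<and> path_comp w' q = path_comp q w \<and> f w' = f w"
  shows "ad.conv f (adm_path q) = ad.conv (adm_path q) f" (is "?L = ?R")
proof
  fix p
  have q': "adm_path q u \<noteq> \<zero> \<Longrightarrow> u = q" for u
    by (simp add: adm_path_def ad.single_def split: if_splits)
  show "?L p = ?R p"
  proof (cases "?L p = \<zero>")
    case False
    obtain w where w: "acomposable w q" "p = path_comp w q" "f w \<noteq> \<zero>"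
      using ad.conv_nonzero[OF f adm_path_closed False] q' by metis
    then obtain w' where "acomposable q w'" "path_comp q w' = p" "f w' = f w"
      using right by blast
    then have "?R p = f w"
      using adm_path_conv_comp[OF q _ f, of w'] by simp
    then show ?thesis
      using conv_adm_path_comp[OF q w(1) f] w(2) by simp
  next
    case L: True
    show ?thesis
    proof (rule ccontr)
      assume "?L p \<noteq> ?R p"
      then have R: "?R p \<noteq> \<zero>" using L by simp
      obtain w where w: "acomposable q w" "p = path_comp q w" "f w \<noteq> \<zero>"
        using ad.conv_nonzero[OF adm_path_closed f R] q' by metis
      then obtain w' where "acomposable w' q" "path_comp w' q = p" "f w' = f w"
        using left by blast
      then have "?L p = f w"
        using conv_adm_path_comp[OF q _ f, of w'] by simp
      then show False using L w(3) by simp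
    qed
  qed
qed

text \<open>Moving a primitive cycle past an arrow rotates it, which changes neither its exponent nor its
  class; hence power series act by central elements.\<close>

lemma act_commutes_arrow:
  assumes a: "a \<in> arcs Q" and r: "r \<in> series"
  shows "ad.conv (act r) (adm_path (tail Q a, [a])) = ad.conv (adm_path (tail Q a, [a])) (act r)"
proof (rule adm_path_commuteI[OF admissible_arrow[OF a] act_closed[OF r]])
  let ?a = "(tail Q a, [a])"
  have same: "act r (head Q a, rep j (ds @ [a])) = act r (tail Q a, rep j (a # ds))"
    if "prim (head Q a) (ds @ [a])" "prim (tail Q a) (a # ds)" for j ds
  proof -
    have "cls (head Q a) = cls (tail Q a)"
      using that(2) by (intro cls_path_verts) (auto simp: path_verts_def)
    then show ?thesis
      using act_power[OF that(1)] act_power[OF that(2)] by simp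
  qed
  show "\<exists>w'. acomposable ?a w' \<and> path_comp ?a w' = path_comp w ?a \<and> act r w' = act r w"
    if w: "acomposable w ?a" "act r w \<noteq> \<zero>" for w
    using w(2)
  proof (rule act_nonzero)
    fix v assume "w = (v, [])"
    then show ?thesis
      using w(1) a by (intro exI[of _ "(tail Q a, [])"]) (auto simp: acomposable_def act_trivial)
  next
    fix v cs j assume cs: "prim v cs" "0 < j" "w = (v, rep j cs)"
    have v: "v = head Q a" and adm: "admissible Q Z (tail Q a, [a] @ rep j cs)"
      using w(1) by (simp_all add: cs acomposable_def)
    have "last cs = a"
      using arrow_then_power[OF cs(1,2) adm] by simp
    then obtain ds where ds: "cs = ds @ [a]"
      using prim_cycle(1)[OF cs(1)] by (metis append_butlast_last_id)
    have pr: "prim (tail Q a) (a # ds)"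
      using prim_rotate1' cs(1) ds by simp
    have "acomposable ?a (tail Q a, rep j (a # ds))"
      using adm ds rep_rotate[of a j ds] a admissible_paths[OF prim_power_admissible[OF pr]]
        prim_power_head[OF pr] by (simp add: acomposable_def)
    then show ?thesis
      using same[of ds j] pr cs v ds rep_rotate[of a j ds]
      by (intro exI[of _ "(tail Q a, rep j (a # ds))"]) simp
  qed
  show "\<exists>w'. acomposable w' ?a \<and> path_comp w' ?a = path_comp ?a w \<and> act r w' = act r w"
    if w: "acomposable ?a w" "act r w \<noteq> \<zero>" for w
    using w(2)
  proof (rule act_nonzero)
    fix v assume "w = (v, [])"
    then show ?thesis
      using w(1) a by (intro exI[of _ "(head Q a, [])"]) (auto simp: acomposable_def act_trivial)
  next
    fix v cs j assume cs: "prim v cs" "0 < j" "w = (v, rep j cs)"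
    have v: "v = tail Q a" and adm: "admissible Q Z (v, rep j cs @ [a])"
      using w(1) prim_power_head[OF cs(1)] by (simp_all add: cs acomposable_def)
    have "hd cs = a"
      using power_then_arrow[OF cs(1,2) adm] by simp
    then obtain ds where ds: "cs = a # ds"
      using prim_cycle(1)[OF cs(1)] by (cases cs) auto
    have pr: "prim (head Q a) (ds @ [a])"
      using prim_rotate1 cs(1) ds by simp
    have "acomposable (head Q a, rep j (ds @ [a])) ?a"
      using adm v ds rep_rotate[of a j ds] a admissible_paths[OF prim_power_admissible[OF pr]]
        admissible_paths[OF prim_power_admissible[OF cs(1)]] prim_power_head[OF cs(1)]
      by (simp add: acomposable_def)
    then show ?thesis
      using same[of ds j] pr cs v ds rep_rotate[of a j ds]
      by (intro exI[of _ "(head Q a, rep j (ds @ [a]))"]) simp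
  qed
qed

text \<open>Powers of cycles start and end at the same vertex.\<close>

lemma act_commutes_trivial:
  assumes v: "v \<in> verts Q" and r: "r \<in> series"
  shows "ad.conv (act r) (adm_path (v, [])) = ad.conv (adm_path (v, [])) (act r)"
proof (rule adm_path_commuteI[OF admissible_trivial[OF v] act_closed[OF r]])
  have closed: "path_head Q w = path_tail w" if "act r w \<noteq> \<zero>" for w
    using that by (rule act_nonzero) (auto simp: prim_power_head)
  show "\<exists>w'. acomposable (v, []) w' \<and> path_comp (v, []) w' = path_comp w (v, []) \<and> act r w' = act r w"
    if "acomposable w (v, [])" "act r w \<noteq> \<zero>" for w
    using that closed[OF that(2)] v by (intro exI[of _ w]) (cases w; auto simp: acomposable_def)
  show "\<exists>w'. acomposable w' (v, []) \<and> path_comp w' (v, []) = path_comp (v, []) w \<and> act r w' = act r w"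
    if "acomposable (v, []) w" "act r w \<noteq> \<zero>" for w
    using that closed[OF that(2)] v by (intro exI[of _ w]) (cases w; auto simp: acomposable_def)
qed

lemma act_commutes:
  assumes "(v, as) \<in> paths Q" and r: "r \<in> series"
  shows "ad.conv (act r) (adm_path (v, as)) = ad.conv (adm_path (v, as)) (act r)"
  using assms(1)
proof (induction as arbitrary: v)
  case Nil
  then show ?case using act_commutes_trivial[OF _ r] by simp
next
  case (Cons a as)
  note cl = adm_path_closed act_closed[OF r] ad.conv_closed
  let ?a = "adm_path (v, [a])" and ?p = "adm_path (head Q a, as)"
  have e: "adm_path (v, a # as) = ad.conv ?p ?a"
    using Cons.prems by (simp add: adm_path_mult)
  have "ad.conv (act r) (ad.conv ?p ?a) = ad.conv (ad.conv (act r) ?p) ?a"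
    by (simp add: ad.conv_assoc cl)
  also have "\<dots> = ad.conv ?p (ad.conv (act r) ?a)"
    using Cons by (simp add: ad.conv_assoc cl)
  also have "\<dots> = ad.conv ?p (ad.conv ?a (act r))"
    using Cons.prems act_commutes_arrow[OF _ r] by auto
  also have "\<dots> = ad.conv (ad.conv ?p ?a) (act r)"
    by (simp add: ad.conv_assoc cl)
  finally show ?case unfolding e .
qed


subsection \<open>The homomorphism from the path algebra over power series\<close>

text \<open>The map that sends \<open>r p\<close> to the product of the images of \<open>p\<close> and of \<open>r\<close>, evaluated at a path.\<close>

definition \<psi> :: "(('v, 'a) qpath \<Rightarrow> nat multiset \<Rightarrow> 'b) \<Rightarrow> ('v, 'a) qpath \<Rightarrow> 'b" where
  "\<psi> f = (\<lambda>p. finsum K (\<lambda>(s, w). act (f s) w) (ad.factorisations p))"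

lemma RQ_series: "f \<in> carrier RQ \<Longrightarrow> f p \<in> series"
  using rq.path_algebra_closed by simp

lemma act_RQ_closed: "f \<in> carrier RQ \<Longrightarrow> act (f s) w \<in> carrier K"
  using RQ_series act_closed ad.coeffs_closed by blast

lemma \<psi>_closed:
  assumes "f \<in> carrier RQ"
  shows "\<psi> f \<in> ad.coeffs"
proof (rule ad.coeffsI)
  show "\<psi> f p \<in> carrier K" for p
    unfolding \<psi>_def using act_RQ_closed[OF assms] by (intro finsum_closed) auto
  show "\<psi> f p = \<zero>" if "p \<notin> {p. admissible Q Z p}" for p
    unfolding \<psi>_def by (rule finsum_eq_zero) (use that in \<open>auto simp: ad.factorisations_def acomposable_def\<close>)
qed

lemma \<psi>_add:
  assumes f: "f \<in> carrier RQ" and g: "g \<in> carrier RQ"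
  shows "\<psi> (f \<oplus>\<^bsub>RQ\<^esub> g) = (\<lambda>p. \<psi> f p \<oplus> \<psi> g p)"
proof
  fix p
  have "\<psi> (f \<oplus>\<^bsub>RQ\<^esub> g) p
      = (\<Oplus>x\<in>ad.factorisations p. (case x of (s, w) \<Rightarrow> act (f s) w) \<oplus> (case x of (s, w) \<Rightarrow> act (g s) w))"
    unfolding \<psi>_def
    by (rule finsum_cong')
      (use act_RQ_closed[OF f] act_RQ_closed[OF g] in
        \<open>auto simp: act_add RQ_series[OF f] RQ_series[OF g]\<close>)
  also have "\<dots> = \<psi> f p \<oplus> \<psi> g p"
    unfolding \<psi>_def
    by (rule finsum_addf) (use act_RQ_closed[OF f] act_RQ_closed[OF g] in auto)
  finally show "\<psi> (f \<oplus>\<^bsub>RQ\<^esub> g) p = \<psi> f p \<oplus> \<psi> g p" .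
qed

lemma \<psi>_zero: "\<psi> (\<lambda>p m. \<zero>) = (\<lambda>p. \<zero>)"
  unfolding \<psi>_def by (rule ext, rule finsum_eq_zero) (auto simp: act_zero)

lemma \<psi>_single:
  assumes "r \<in> series"
  shows "\<psi> (rq.single p r) = ad.conv (adm_path p) (act r)"
  unfolding \<psi>_def ad.conv_def
proof (rule ext, rule finsum_cong')
  fix x y assume "y \<in> ad.factorisations x"
  then obtain s w where y: "y = (s, w)" and "acomposable s w"
    by (auto simp: ad.factorisations_def)
  then have adm: "admissible Q Z s"
    unfolding acomposable_def using admissible_factors by blast
  show "(case y of (s, w) \<Rightarrow> act (rq.single p r s) w) = (case y of (s, w) \<Rightarrow> adm_path p s \<otimes> act r w)"
    using adm ad.coeffs_closed[OF act_closed[OF assms]]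
    by (auto simp: y rq.single_def adm_path_def ad.single_def act_zero)
qed (rule refl, rule ad.conv_summand_closed[OF adm_path_closed act_closed[OF assms]])

lemma \<psi>_single_mult:
  assumes p: "p \<in> paths Q" and q: "q \<in> paths Q" and r: "r \<in> series" and s: "s \<in> series"
  shows "\<psi> (rq.single p r \<otimes>\<^bsub>RQ\<^esub> rq.single q s) = ad.conv (\<psi> (rq.single p r)) (\<psi> (rq.single q s))"
proof -
  note cl = adm_path_closed act_closed[OF r] act_closed[OF s] ad.conv_closed
  have "ad.conv (\<psi> (rq.single p r)) (\<psi> (rq.single q s))
      = ad.conv (adm_path p) (ad.conv (ad.conv (act r) (adm_path q)) (act s))"
    by (simp add: \<psi>_single r s ad.conv_assoc cl)
  also have "ad.conv (act r) (adm_path q) = ad.conv (adm_path q) (act r)"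
    using act_commutes[OF _ r] q by (cases q) simp
  also have "ad.conv (adm_path p) (ad.conv (ad.conv (adm_path q) (act r)) (act s))
      = ad.conv (ad.conv (adm_path p) (adm_path q)) (ad.conv (act r) (act s))"
    by (simp add: ad.conv_assoc cl)
  also have "\<dots> = ad.conv (ad.conv (adm_path p) (adm_path q)) (act (pser.ps.conv r s))"
    by (simp add: act_mult r s)
  also have "\<dots> = \<psi> (rq.single p r \<otimes>\<^bsub>RQ\<^esub> rq.single q s)"
    using r s act_closed[OF pser.ps.conv_closed[OF r s]]
    by (simp add: adm_path_mult rq.conv_single_single \<psi>_single pser.ps.conv_closed conv_zero_left \<psi>_zero)
  finally show ?thesis by simp
qed

text \<open>Both sides are additive in either factor, so it is enough to compare them on multiples of paths.\<close>

lemma \<psi>_mult: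
  assumes f: "f \<in> carrier RQ" and g: "g \<in> carrier RQ"
  shows "\<psi> (f \<otimes>\<^bsub>RQ\<^esub> g) = ad.conv (\<psi> f) (\<psi> g)"
proof -
  have single: "\<psi> (rq.single p r \<otimes>\<^bsub>RQ\<^esub> g) = ad.conv (\<psi> (rq.single p r)) (\<psi> g)"
    if p: "p \<in> paths Q" and r: "r \<in> series" for p r
  proof -
    note sc = rq.single_closed[OF p, unfolded pser.ps_carrier, OF r]
    have "g \<in> {g \<in> carrier RQ. \<psi> (rq.single p r \<otimes>\<^bsub>RQ\<^esub> g) = ad.conv (\<psi> (rq.single p r)) (\<psi> g)}"
      (is "g \<in> ?J")
    proof (rule rq.path_algebra_span[OF g])
      have "rq.single p r \<otimes>\<^bsub>RQ\<^esub> \<zero>\<^bsub>RQ\<^esub> = \<zero>\<^bsub>RQ\<^esub>"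
        using sc by (rule rq.RQ.r_null)
      then show "(\<lambda>p. \<zero>\<^bsub>R\<^esub>) \<in> ?J"
        using rq.RQ.zero_closed by (simp add: \<psi>_zero conv_zero_right \<psi>_closed sc)
      show "(\<lambda>p. x p \<oplus>\<^bsub>R\<^esub> y p) \<in> ?J" if "x \<in> ?J" "y \<in> ?J" for x y
      proof -
        have c: "x \<in> carrier RQ" "y \<in> carrier RQ" using that by auto
        have "\<psi> (rq.single p r \<otimes>\<^bsub>RQ\<^esub> (x \<oplus>\<^bsub>RQ\<^esub> y)) = ad.conv (\<psi> (rq.single p r)) (\<psi> (x \<oplus>\<^bsub>RQ\<^esub> y))"
          unfolding rq.RQ.r_distr[OF c sc]
          using that c sc by (subst \<psi>_add) (auto simp: \<psi>_add[OF c] ad.conv_add_right \<psi>_closed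
              intro!: rq.RQ.m_closed simp del: rq.path_algebra_ops)
        then show ?thesis
          using rq.RQ.a_closed[OF c] by simp
      qed
      show "rq.single q (g q) \<in> ?J" if "q \<in> paths Q" for q
        using \<psi>_single_mult[OF p that r RQ_series[OF g]] rq.single_closed[OF that] RQ_series[OF g]
        by simp
    qed
    then show ?thesis by simp
  qed
  have "f \<in> {f \<in> carrier RQ. \<psi> (f \<otimes>\<^bsub>RQ\<^esub> g) = ad.conv (\<psi> f) (\<psi> g)}" (is "f \<in> ?J")
  proof (rule rq.path_algebra_span[OF f])
    have "\<zero>\<^bsub>RQ\<^esub> \<otimes>\<^bsub>RQ\<^esub> g = \<zero>\<^bsub>RQ\<^esub>"
      using g by (rule rq.RQ.l_null)
    then show "(\<lambda>p. \<zero>\<^bsub>R\<^esub>) \<in> ?J"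
      using rq.RQ.zero_closed by (simp add: \<psi>_zero conv_zero_left \<psi>_closed g)
    show "(\<lambda>p. x p \<oplus>\<^bsub>R\<^esub> y p) \<in> ?J" if "x \<in> ?J" "y \<in> ?J" for x y
    proof -
      have c: "x \<in> carrier RQ" "y \<in> carrier RQ" using that by auto
      have "\<psi> ((x \<oplus>\<^bsub>RQ\<^esub> y) \<otimes>\<^bsub>RQ\<^esub> g) = ad.conv (\<psi> (x \<oplus>\<^bsub>RQ\<^esub> y)) (\<psi> g)"
        unfolding rq.RQ.l_distr[OF c g]
        using that c g by (subst \<psi>_add) (auto simp: \<psi>_add[OF c] ad.conv_add_left \<psi>_closed
            intro!: rq.RQ.m_closed simp del: rq.path_algebra_ops)
      then show ?thesis
        using rq.RQ.a_closed[OF c] by simp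
    qed
    show "rq.single q (f q) \<in> ?J" if "q \<in> paths Q" for q
      using single[OF that RQ_series[OF f]] rq.single_closed[OF that] RQ_series[OF f] by simp
  qed
  then show ?thesis by simp
qed

lemma \<psi>_product_form:
  assumes "\<And>s w. act (f s) w = g s \<otimes> h w"
  shows "\<psi> f = ad.conv g h"
proof -
  have "(\<lambda>(s, w). act (f s) w) = (\<lambda>(s, w). g s \<otimes> h w)"
    using assms by fast
  then show ?thesis
    unfolding \<psi>_def ad.conv_def by (rule arg_cong)
qed

lemma \<psi>_one: "\<psi> \<one>\<^bsub>RQ\<^esub> = ad.conv_one"
proof -
  have "\<psi> \<one>\<^bsub>RQ\<^esub> = ad.conv ad.conv_one ad.conv_one"
  proof (rule \<psi>_product_form)
    fix s w
    show "act (\<one>\<^bsub>RQ\<^esub> s) w = ad.conv_one s \<otimes> ad.conv_one w"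
      using ad.coeffs_closed[OF ad.conv_one_closed]
      by (simp add: rq.conv_one_def act_one act_zero) (simp add: ad.conv_one_def)
  qed
  then show ?thesis
    by (simp add: ad.conv_one_left ad.conv_one_closed)
qed

lemma \<psi>_hom: "\<psi> \<in> ring_hom RQ \<Gamma>"
  by (rule ring_hom_memI) (simp_all add: \<psi>_closed \<psi>_mult \<psi>_add \<psi>_one del: rq.path_algebra_ops)

end


section \<open>The nerve ideal\<close>

context nerve_setting
begin

abbreviation csum where "csum v \<equiv> cycle_sum R Q Z v"

abbreviation t where "t i \<equiv> ps_var K i"

abbreviation I where "I \<equiv> nerve_ideal R t Q Z n W"

lemmas t_series = pser.ps_var_closed

lemma csum_apply: "csum v p = (if primitive_cycle Q Z p \<and> path_tail p = v then \<one>\<^bsub>R\<^esub> else \<zero>\<^bsub>R\<^esub>)"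
  and csum_closed: "csum v \<in> carrier RQ"
proof -
  let ?A = "{c. primitive_cycle Q Z c \<and> path_tail c = v}"
  have fin: "finite ?A"
    using finite_primitive_cycles by (rule finite_subset[rotated]) auto
  have cl: "path_elem R c \<in> carrier RQ" if "c \<in> ?A" for c
    using that prim_cycle(2) unfolding rq.path_elem_single
    by (cases c) (auto intro!: rq.single_closed simp: pser.ps.conv_one_closed)
  show "csum v \<in> carrier RQ"
    unfolding cycle_sum_def using cl by (intro rq.RQ.finsum_closed) auto
  have "csum v p = finsum R (\<lambda>c. path_elem R c p) ?A"
    unfolding cycle_sum_def by (rule rq.finsum_apply[OF fin cl])
  also have "\<dots> = (if p \<in> ?A then \<one>\<^bsub>R\<^esub> else \<zero>\<^bsub>R\<^esub>)"
  proof (cases "p \<in> ?A")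
    case True
    have "finsum R (\<lambda>c. path_elem R c p) ?A = path_elem R p p"
      by (rule rq.finsum_eq_single[OF fin True]) (auto simp: path_elem_def pser.ps.conv_one_closed)
    then show ?thesis
      using True by (simp add: path_elem_def)
  next
    case False
    have "finsum R (\<lambda>c. path_elem R c p) ?A = \<zero>\<^bsub>R\<^esub>"
      by (rule rq.finsum_eq_zero) (use False in \<open>auto simp: path_elem_def\<close>)
    then show ?thesis
      using False by (simp only: if_False)
  qed
  finally show "csum v p = (if primitive_cycle Q Z p \<and> path_tail p = v then \<one>\<^bsub>R\<^esub> else \<zero>\<^bsub>R\<^esub>)"
    by simp
qed

text \<open>The element \<open>t\<^sub>i e\<^sub>v\<close>.\<close>

abbreviation te where "te i v \<equiv> rq.single (v, []) (t i)"

lemma te_eq: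
  assumes "i \<in> {1..n}"
  shows "t i \<odot>\<^bsub>RQ\<^esub> path_elem R (trivial_path v) = te i v"
proof -
  have "t i \<otimes>\<^bsub>R\<^esub> \<one>\<^bsub>R\<^esub> = t i" "t i \<otimes>\<^bsub>R\<^esub> \<zero>\<^bsub>R\<^esub> = \<zero>\<^bsub>R\<^esub>"
    using t_series[OF assms] rq.r_one[of "t i"] rq.r_null[of "t i"] by simp_all
  then show ?thesis
    by (auto simp: path_elem_def rq.single_def trivial_path_def)
qed

lemma te_closed: "i \<in> {1..n} \<Longrightarrow> v \<in> verts Q \<Longrightarrow> te i v \<in> carrier RQ"
  using t_series by (intro rq.single_closed) auto

definition gens_on :: "nat \<Rightarrow> (('v, 'a) qpath \<Rightarrow> nat multiset \<Rightarrow> 'b) set" where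
  "gens_on i = {te i v \<ominus>\<^bsub>RQ\<^esub> csum v | v. v \<in> W i}"

definition gens_off :: "nat \<Rightarrow> (('v, 'a) qpath \<Rightarrow> nat multiset \<Rightarrow> 'b) set" where
  "gens_off i = {te i v | v. v \<in> verts Q - W i}"

lemma gens_closed: "i \<in> {1..n} \<Longrightarrow> gens_on i \<subseteq> carrier RQ" "i \<in> {1..n} \<Longrightarrow> gens_off i \<subseteq> carrier RQ"
proof -
  assume i: "i \<in> {1..n}"
  show "gens_on i \<subseteq> carrier RQ"
  proof
    fix x assume "x \<in> gens_on i"
    then obtain v where "v \<in> W i" "x = te i v \<ominus>\<^bsub>RQ\<^esub> csum v"
      by (auto simp: gens_on_def)
    then show "x \<in> carrier RQ"
      using te_closed[OF i] csum_closed W_verts[OF i] rq.RQ.minus_closed by blast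
  qed
next
  assume i: "i \<in> {1..n}"
  show "gens_off i \<subseteq> carrier RQ"
    using te_closed[OF i] unfolding gens_off_def by blast
qed

lemma nerve_ideal_eq:
  "I = path_ideal R Q Z <+>\<^bsub>RQ\<^esub>
    foldr (\<lambda>i J. (Idl\<^bsub>RQ\<^esub> (gens_on i) <+>\<^bsub>RQ\<^esub> Idl\<^bsub>RQ\<^esub> (gens_off i)) <+>\<^bsub>RQ\<^esub> J) [1..<Suc n] {\<zero>\<^bsub>RQ\<^esub>}"
proof -
  have "foldr (\<lambda>i J.
         (Idl\<^bsub>RQ\<^esub> {t i \<odot>\<^bsub>RQ\<^esub> path_elem R (trivial_path v) \<ominus>\<^bsub>RQ\<^esub> csum v | v. v \<in> W i} <+>\<^bsub>RQ\<^esub>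
          Idl\<^bsub>RQ\<^esub> {t i \<odot>\<^bsub>RQ\<^esub> path_elem R (trivial_path v) | v. v \<in> verts Q - W i}) <+>\<^bsub>RQ\<^esub> J)
       [1..<Suc n] {\<zero>\<^bsub>RQ\<^esub>}
    = foldr (\<lambda>i J. (Idl\<^bsub>RQ\<^esub> (gens_on i) <+>\<^bsub>RQ\<^esub> Idl\<^bsub>RQ\<^esub> (gens_off i)) <+>\<^bsub>RQ\<^esub> J) [1..<Suc n] {\<zero>\<^bsub>RQ\<^esub>}"
    by (rule foldr_cong) (auto simp only: gens_on_def gens_off_def te_eq set_upt atLeastLessThan_iff
        atLeastAtMost_iff less_Suc_eq_le)
  then show ?thesis
    unfolding nerve_ideal_def Let_def by (simp only:)
qed

lemma path_ideal_ideal: "ideal (path_ideal R Q Z) RQ"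
  unfolding path_ideal_def
  by (rule rq.RQ.genideal_ideal)
    (use Z_paths in \<open>auto simp: rq.path_elem_single pser.ps.conv_one_closed intro!: rq.single_closed\<close>)

lemma gens_ideal:
  "i \<in> set [1..<Suc n] \<Longrightarrow> ideal (Idl\<^bsub>RQ\<^esub> (gens_on i) <+>\<^bsub>RQ\<^esub> Idl\<^bsub>RQ\<^esub> (gens_off i)) RQ"
  by (intro rq.RQ.add_ideals rq.RQ.genideal_ideal gens_closed) auto

lemma I_ideal: "ideal I RQ"
  unfolding nerve_ideal_eq
  by (intro rq.RQ.add_ideals path_ideal_ideal rq.RQ.ideal_sum_fold(1) gens_ideal)

lemma path_ideal_in_I: "path_ideal R Q Z \<subseteq> I"
  unfolding nerve_ideal_eq
  by (intro rq.RQ.add_ideals_upper(1) path_ideal_ideal rq.RQ.ideal_sum_fold(1) gens_ideal)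

lemma gens_in_I:
  assumes "i \<in> {1..n}"
  shows "gens_on i \<subseteq> I" "gens_off i \<subseteq> I"
proof -
  have i: "i \<in> set [1..<Suc n]"
    using assms by auto
  let ?N = "\<lambda>i. Idl\<^bsub>RQ\<^esub> (gens_on i) <+>\<^bsub>RQ\<^esub> Idl\<^bsub>RQ\<^esub> (gens_off i)"
  have "?N i \<subseteq> foldr (\<lambda>i J. ?N i <+>\<^bsub>RQ\<^esub> J) [1..<Suc n] {\<zero>\<^bsub>RQ\<^esub>}"
    by (rule rq.RQ.ideal_sum_fold(2)[OF gens_ideal i])
  also have "\<dots> \<subseteq> I"
    unfolding nerve_ideal_eq
    by (intro rq.RQ.add_ideals_upper(2) path_ideal_ideal rq.RQ.ideal_sum_fold(1) gens_ideal)
  finally have N: "?N i \<subseteq> I" .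
  have "Idl\<^bsub>RQ\<^esub> (gens_on i) \<subseteq> ?N i" "Idl\<^bsub>RQ\<^esub> (gens_off i) \<subseteq> ?N i"
    using rq.RQ.add_ideals_upper[OF rq.RQ.genideal_ideal[OF gens_closed(1)[OF assms]]
        rq.RQ.genideal_ideal[OF gens_closed(2)[OF assms]]] by blast+
  then show "gens_on i \<subseteq> I" "gens_off i \<subseteq> I"
    using N rq.RQ.genideal_self[OF gens_closed(1)[OF assms]]
      rq.RQ.genideal_self[OF gens_closed(2)[OF assms]] by blast+
qed

lemma I_least:
  assumes "ideal L RQ" "path_ideal R Q Z \<subseteq> L"
    and "\<And>i. i \<in> {1..n} \<Longrightarrow> gens_on i \<subseteq> L" "\<And>i. i \<in> {1..n} \<Longrightarrow> gens_off i \<subseteq> L"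
  shows "I \<subseteq> L"
  unfolding nerve_ideal_eq
proof (rule rq.RQ.add_ideals_least[OF assms(1,2)], rule rq.RQ.ideal_sum_fold(3)[OF gens_ideal assms(1)])
  fix i assume "i \<in> set [1..<Suc n]"
  then have "i \<in> {1..n}" by auto
  then show "Idl\<^bsub>RQ\<^esub> (gens_on i) <+>\<^bsub>RQ\<^esub> Idl\<^bsub>RQ\<^esub> (gens_off i) \<subseteq> L"
    using assms by (intro rq.RQ.add_ideals_least rq.RQ.genideal_minimal) auto
qed

sublocale II: ideal I RQ
  by (rule I_ideal)


subsection \<open>The homomorphism kills the nerve ideal\<close>

lemma conv_trivial_path:
  assumes v: "v \<in> verts Q" and f: "f \<in> ad.coeffs"
  shows "ad.conv f (adm_path (v, [])) p = (if path_tail p = v then f p else \<zero>)"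
proof (cases "admissible Q Z p \<and> path_tail p = v")
  case True
  then have "acomposable p (v, [])" "path_comp p (v, []) = p"
    using admissible_paths[of p] v by (cases p; simp add: acomposable_def)+
  then show ?thesis
    using conv_adm_path_comp[OF admissible_trivial[OF v] _ f, of p] True by simp
next
  case False
  have "ad.conv f (adm_path (v, [])) p = \<zero>"
  proof (rule ccontr)
    assume nz: "ad.conv f (adm_path (v, [])) p \<noteq> \<zero>"
    obtain w u where "acomposable w u" "p = path_comp w u" "adm_path (v, []) u \<noteq> \<zero>"
      using ad.conv_nonzero[OF f adm_path_closed nz] by blast
    then show False
      using False by (auto simp: adm_path_def ad.single_def acomposable_def path_comp_def path_tail_def
          split: if_splits)
  qed
  then show ?thesis
    using False ad.coeffs_outside[OF f, of p] by auto
qed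

lemma act_variable:
  "act (t i) p = (if primitive_cycle Q Z p \<and> cls (path_tail p) = i then \<one> else \<zero>)"
proof (cases "primitive_cycle Q Z p")
  case True
  then show ?thesis
    using act_power[of "fst p" "snd p" "t i" 1] by (simp add: ps_var_def path_tail_def)
next
  case False
  have "act (t i) p = \<zero>"
  proof (rule ccontr)
    assume nz: "act (t i) p \<noteq> \<zero>"
    then show False
    proof (rule act_nonzero)
      fix u assume "u \<in> verts Q" "p = (u, [])"
      then show False using nz by (simp add: act_trivial ps_var_def)
    next
      fix u cs j assume cs: "prim u cs" "0 < j" "p = (u, rep j cs)"
      then have "replicate_mset j (cls u) = {#i#}"
        using nz act_power[OF cs(1), of "t i" j] by (auto simp: ps_var_def split: if_splits)
      then have "j = 1"
        by (metis size_replicate_mset size_single)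
      then show False using cs False by simp
    qed
  qed
  then show ?thesis using False by simp
qed

lemma \<psi>_te:
  assumes i: "i \<in> {1..n}" and v: "v \<in> verts Q"
  shows "\<psi> (te i v) = (\<lambda>p. if primitive_cycle Q Z p \<and> path_tail p = v \<and> cls v = i then \<one> else \<zero>)"
proof
  fix p
  have "\<psi> (te i v) p = ad.conv (act (t i)) (adm_path (v, [])) p"
    using act_commutes_trivial[OF v t_series[OF i]] \<psi>_single[OF t_series[OF i]] by simp
  then show "\<psi> (te i v) p = (if primitive_cycle Q Z p \<and> path_tail p = v \<and> cls v = i then \<one> else \<zero>)"
    by (auto simp: conv_trivial_path[OF v act_closed[OF t_series[OF i]]] act_variable)
qed

lemma \<psi>_csum: "\<psi> (csum v) = (\<lambda>p. if primitive_cycle Q Z p \<and> path_tail p = v then \<one> else \<zero>)"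
    (is "_ = ?g")
proof -
  have "\<psi> (csum v) = ad.conv ?g ad.conv_one"
  proof (rule \<psi>_product_form)
    fix s w
    show "act (csum v s) w = ?g s \<otimes> ad.conv_one w"
      using ad.coeffs_closed[OF ad.conv_one_closed, of w] by (simp add: csum_apply act_one act_zero)
  qed
  moreover have "?g \<in> ad.coeffs"
  proof (rule ad.coeffsI)
    fix p assume "p \<notin> {p. admissible Q Z p}"
    then show "?g p = \<zero>"
      using prim_power_admissible[of "fst p" "snd p" 1] by auto
  qed auto
  ultimately show ?thesis
    by (simp add: ad.conv_one_right)
qed

sublocale \<psi>: ring_hom_ring RQ \<Gamma> \<psi>
  by (rule ring_hom_ringI2) (use rq.path_algebra_ring \<Gamma>_ring \<psi>_hom in auto)

lemma in_kernel_iff: "x \<in> a_kernel RQ \<Gamma> \<psi> \<longleftrightarrow> x \<in> carrier RQ \<and> \<psi> x = (\<lambda>p. \<zero>)"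
  unfolding a_kernel_def' mem_Collect_eq \<Gamma>_ops by (rule refl)

text \<open>The central element replacing \<open>t\<^sub>i\<close> restricts at a vertex of the \<open>i\<close>-th class to the sum of the
  primitive cycles there, and to zero at every other vertex.\<close>

lemma I_in_kernel: "I \<subseteq> a_kernel RQ \<Gamma> \<psi>"
proof (rule I_least)
  show "ideal (a_kernel RQ \<Gamma> \<psi>) RQ"
    by (rule \<psi>.kernel_is_ideal)
  show "path_ideal R Q Z \<subseteq> a_kernel RQ \<Gamma> \<psi>"
    unfolding path_ideal_def
  proof (rule rq.RQ.genideal_minimal[OF \<psi>.kernel_is_ideal], clarify)
    fix v as assume z: "(v, as) \<in> Z"
    then have "\<not> admissible Q Z (v, as)"
      unfolding admissible_iff by (auto intro!: bexI[of _ "(v, as)"] exI[of _ "[]"])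
    then have "\<psi> (path_elem R (v, as)) = (\<lambda>_. \<zero>)"
      using \<psi>_single[OF pser.ps.conv_one_closed, of "(v, as)"]
        conv_zero_left[OF act_closed[OF pser.ps.conv_one_closed]]
      by (simp add: rq.path_elem_single adm_path_def)
    moreover have "path_elem R (v, as) \<in> carrier RQ"
      unfolding rq.path_elem_single using z Z_paths by (intro rq.single_closed) (auto simp: pser.ps.conv_one_closed)
    ultimately show "path_elem R (v, as) \<in> a_kernel RQ \<Gamma> \<psi>"
      unfolding in_kernel_iff by blast
  qed
  fix i assume i: "i \<in> {1..n}"
  show "gens_on i \<subseteq> a_kernel RQ \<Gamma> \<psi>"
  proof
    fix x assume "x \<in> gens_on i"
    then obtain v where v: "v \<in> W i" "x = te i v \<ominus>\<^bsub>RQ\<^esub> csum v"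
      by (auto simp: gens_on_def)
    have vv: "v \<in> verts Q" using v W_verts[OF i] by blast
    note tc = te_closed[OF i vv] csum_closed[of v]
    have "\<psi> (te i v) = \<psi> (csum v)"
      using cls_eq[OF i v(1)] by (simp add: \<psi>_te[OF i vv] \<psi>_csum)
    then have "\<psi> x = \<zero>\<^bsub>\<Gamma>\<^esub>"
      unfolding v(2) rq.RQ.minus_eq \<psi>.hom_add[OF tc(1) rq.RQ.a_inv_closed[OF tc(2)]]
        \<psi>.hom_a_inv[OF tc(2)]
      using \<psi>.S.r_neg[OF \<psi>.hom_closed[OF tc(2)]] by simp
    moreover have "x \<in> carrier RQ"
      unfolding v(2) using tc by (rule rq.RQ.minus_closed)
    ultimately show "x \<in> a_kernel RQ \<Gamma> \<psi>"
      unfolding in_kernel_iff \<Gamma>_ops by blast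
  qed
  show "gens_off i \<subseteq> a_kernel RQ \<Gamma> \<psi>"
  proof
    fix x assume "x \<in> gens_off i"
    then obtain v where v: "v \<in> verts Q" "v \<notin> W i" "x = te i v"
      by (auto simp: gens_off_def)
    have "\<not> (primitive_cycle Q Z p \<and> path_tail p = v \<and> cls v = i)" for p
      using cls_prim(2)[of "fst p" "snd p"] v(2) by (auto simp: path_tail_def)
    then have "\<psi> x = (\<lambda>p. \<zero>)"
      unfolding v(3) \<psi>_te[OF i v(1)] by (intro ext) (simp only: if_False)
    then show "x \<in> a_kernel RQ \<Gamma> \<psi>"
      using te_closed[OF i v(1)] unfolding v(3) in_kernel_iff by blast
  qed
qed

end


section \<open>Normal forms modulo the nerve ideal\<close>

context nerve_setting
begin

text \<open>The terms \<open>m s\<close>, for a path \<open>s\<close> and a monomial \<open>m\<close>, that are allowed in normal forms: a base path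
  with a power of the variable of its class if it starts on a primitive cycle, and with the monomial 1
  otherwise.  Such a term stands for the admissible path that makes the corresponding number of turns
  before \<open>s\<close>.  The map \<open>\<theta>\<close> collects the coefficients of a function on admissible paths in this way.\<close>

definition reduced :: "('v, 'a) qpath \<Rightarrow> nat multiset \<Rightarrow> bool" where
  "reduced s m \<longleftrightarrow> admissible Q Z s \<and> base s = s \<and> m = replicate_mset (size m) (cls (fst s)) \<and>
     (m = {#} \<or> snd s \<noteq> [] \<and> cyclic (hd (snd s)))"

definition extend :: "('v, 'a) qpath \<Rightarrow> nat \<Rightarrow> ('v, 'a) qpath" where
  "extend s k = (fst s, rep k (cycle_at (hd (snd s))) @ snd s)"

definition \<theta> :: "(('v, 'a) qpath \<Rightarrow> 'b) \<Rightarrow> ('v, 'a) qpath \<Rightarrow> nat multiset \<Rightarrow> 'b" where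
  "\<theta> g = (\<lambda>s m. if reduced s m then g (extend s (size m)) else \<zero>)"

text \<open>Extending a base path by full turns of its cycle is inverse to splitting them off.\<close>

lemma extend_reduced:
  assumes "reduced s m"
  shows "admissible Q Z (extend s (size m))" "base (extend s (size m)) = s"
    "exponent (extend s (size m)) = size m"
proof -
  obtain v qs where s: "s = (v, qs)" by (cases s)
  have adm: "admissible Q Z (v, qs)" and b: "base (v, qs) = (v, qs)"
    using assms by (auto simp: reduced_def s)
  show "admissible Q Z (extend s (size m))" "base (extend s (size m)) = s"
    "exponent (extend s (size m)) = size m"
  proof (atomize (full), cases "qs \<noteq> [] \<and> cyclic (hd qs)")
    case True
    define cs where "cs = cycle_at (hd qs)"
    obtain qs' where "base (v, qs) = (v, qs')" and len: "length qs' \<le> length cs" and pr: "prim v cs"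
      using cyclic_split[OF adm] True unfolding cs_def by metis
    then have len: "length qs \<le> length cs"
      using b by simp
    have hd: "hd qs = hd cs"
      using cyclic_prim(2) True by (simp add: cs_def)
    note u = cyclic_split_unique[OF pr _ len hd, of "size m"]
    have "qs = take (length qs) cs"
      using admissible_successively[OF adm] prim_follows(1)[OF pr] len True hd
      by (intro successively_prefix) auto
    then have "rep (size m) cs @ cs = (rep (size m) cs @ qs) @ drop (length qs) cs"
      by (metis append.assoc append_take_drop_id)
    then have "admissible Q Z (v, (rep (size m) cs @ qs) @ drop (length qs) cs)"
      using prim_power_admissible[OF pr, of "Suc (size m)"] by (metis rep_Suc_right)
    then have "admissible Q Z (v, rep (size m) cs @ qs)"
      using admissible_append by blast
    then show "admissible Q Z (extend s (size m)) \<and> base (extend s (size m)) = s \<and>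
        exponent (extend s (size m)) = size m"
      using u True by (simp add: extend_def s cs_def)
  next
    case False
    then have "m = {#}"
      using assms by (auto simp: reduced_def s)
    then show "admissible Q Z (extend s (size m)) \<and> base (extend s (size m)) = s \<and>
        exponent (extend s (size m)) = size m"
      using adm False base_noncyclic[of s] by (auto simp: extend_def s)
  qed
qed

text \<open>Only the variable of the class of a primitive cycle occurs, and the classes are numbered from 1 to \<open>n\<close>.\<close>

lemma \<theta>_series: "g \<in> ad.coeffs \<Longrightarrow> \<theta> g s \<in> series"
proof (rule pser.ps.coeffsI)
  show "\<theta> g s m \<in> carrier K" if "g \<in> ad.coeffs" for m
    using that by (simp add: \<theta>_def)
  show "\<theta> g s m = \<zero>" if m: "m \<notin> {m. set_mset m \<subseteq> {1..n}}" for m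
  proof (rule ccontr)
    assume "\<theta> g s m \<noteq> \<zero>"
    then have nm: "reduced s m" by (auto simp: \<theta>_def split: if_splits)
    have ne: "m \<noteq> {#}" using m by auto
    obtain v qs where s: "s = (v, qs)" by (cases s)
    have adm: "admissible Q Z (v, qs)" and cyc: "qs \<noteq> []" "cyclic (hd qs)"
      and mr: "m = replicate_mset (size m) (cls v)"
      using nm ne by (auto simp: reduced_def s)
    have "tail Q (hd qs) = v"
      using admissible_paths[OF adm] cyc(1) by (cases qs) auto
    then have "cls v \<in> {1..n}"
      using cls_prim(1)[OF cyclic_prim(1)[OF cyc(2)]] by simp
    moreover have "set_mset m \<subseteq> {cls v}"
      by (subst mr) auto
    ultimately show False using m by blast
  qed
qed

lemma \<theta>_closed:
  assumes "g \<in> ad.coeffs"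
  shows "\<theta> g \<in> carrier RQ"
proof -
  have nz: "admissible Q Z s \<and> base s = s" if "\<theta> g s \<noteq> (\<lambda>m. \<zero>)" for s
    using that by (auto simp: \<theta>_def reduced_def fun_eq_iff split: if_splits)
  have "\<theta> g \<in> rq.coeffs"
  proof (rule rq.coeffsI)
    show "\<theta> g s \<in> carrier R" for s
      using \<theta>_series[OF assms] by simp
    show "\<theta> g s = \<zero>\<^bsub>R\<^esub>" if "s \<notin> paths Q" for s
      using nz[of s] that admissible_paths[of s] by auto
  qed
  moreover have "finite {s. \<theta> g s \<noteq> \<zero>\<^bsub>R\<^esub>}"
    by (rule finite_subset[OF _ finite_base_paths]) (use nz in auto)
  ultimately show ?thesis
    by (simp add: rq.carrier_path_algebra)
qed

lemma \<theta>_add: "\<theta> (\<lambda>p. g p \<oplus> h p) = \<theta> g \<oplus>\<^bsub>RQ\<^esub> \<theta> h"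
  by (intro ext) (simp add: \<theta>_def)

lemma \<theta>_zero: "\<theta> (\<lambda>p. \<zero>) = \<zero>\<^bsub>RQ\<^esub>"
  by (intro ext) (simp add: \<theta>_def)

text \<open>Of all factorisations of an admissible path into a power of a primitive cycle followed by a path,
  only the one that leaves the base contributes.\<close>

lemma \<psi>_\<theta>:
  assumes g: "g \<in> ad.coeffs"
  shows "\<psi> (\<theta> g) = g"
proof
  fix p :: "('v, 'a) qpath"
  obtain v as where p: "p = (v, as)" by (cases p)
  show "\<psi> (\<theta> g) p = g p"
  proof (cases "admissible Q Z p")
    case False
    then show ?thesis
      using ad.coeffs_outside[OF \<psi>_closed[OF \<theta>_closed[OF g]]] ad.coeffs_outside[OF g] by simp
  next
    case adm: True
    define cs where "cs = cycle_at (hd as)"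
    define e where "e = exponent p"
    have vv: "v \<in> verts Q" and pp: "(v, as) \<in> paths Q"
      using adm admissible_paths path_tail_in_verts by (auto simp: p)
    \<comment> \<open>the factorisation into the base and the turns split off from it\<close>
    have first: "(base p, (v, rep e cs)) \<in> ad.factorisations p \<and>
        act (\<theta> g (base p)) (v, rep e cs) = g p"
    proof (cases "as \<noteq> [] \<and> cyclic (hd as)")
      case True
      then obtain qs where as: "as = rep e cs @ qs" and b: "base p = (v, qs)"
          and qs: "qs \<noteq> []" "length qs \<le> length cs" "hd qs = hd as" "admissible Q Z (v, qs)" "prim v cs"
        using cyclic_split[of v as] adm unfolding p e_def cs_def by metis
      have hd: "hd cs = hd as"
        using True cyclic_prim(2) by (simp add: cs_def)
      have "base (v, qs) = (v, qs)"
        using cyclic_split_unique(2)[OF qs(5,1,2), of 0] qs(3) hd by simp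
      then have "reduced (base p) (replicate_mset e (cls v))"
        using qs True by (simp add: reduced_def b)
      moreover have "extend (base p) e = p"
        unfolding b using as[symmetric] qs(3) by (simp add: extend_def p cs_def)
      ultimately have "act (\<theta> g (base p)) (v, rep e cs) = g p"
        using act_power[OF qs(5)] by (simp add: \<theta>_def)
      moreover have "(base p, (v, rep e cs)) \<in> ad.factorisations p"
        using adm pp as b prim_power_head[OF qs(5)]
        by (auto simp: ad.factorisations_def acomposable_def p)
      ultimately show ?thesis by blast
    next
      case False
      then have b: "base p = p" "e = 0"
        using base_noncyclic[of p] by (auto simp: p e_def)
      then have "reduced p {#}"
        using adm by (simp add: reduced_def)
      then have "act (\<theta> g p) (v, []) = g p"
        by (simp add: act_trivial vv \<theta>_def extend_def)
      moreover have "(p, (v, [])) \<in> ad.factorisations p"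
        using adm pp vv by (auto simp: ad.factorisations_def acomposable_def p)
      ultimately show ?thesis
        using b by simp
    qed
    have "\<psi> (\<theta> g) p = (case (base p, (v, rep e cs)) of (s, w) \<Rightarrow> act (\<theta> g s) w)"
      unfolding \<psi>_def
    proof (rule finsum_eq_single)
      show "(base p, (v, rep e cs)) \<in> ad.factorisations p"
        using first by blast
      show "(case (base p, (v, rep e cs)) of (s, w) \<Rightarrow> act (\<theta> g s) w) \<in> carrier K"
        using first g by simp
      fix x assume x: "x \<in> ad.factorisations p" "x \<noteq> (base p, (v, rep e cs))"
      obtain u ss v' ws where xe: "x = ((u, ss), (v', ws))"
        by (cases x) auto
      have comp: "v' = v" "as = ws @ ss" "u = path_head Q (v, ws)"
        using x(1) by (auto simp: xe p ad.factorisations_def acomposable_def)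
      have "act (\<theta> g (u, ss)) (v, ws) = \<zero>"
      proof (rule ccontr)
        assume nz: "act (\<theta> g (u, ss)) (v, ws) \<noteq> \<zero>"
        then show False
        proof (rule act_nonzero)
          fix w assume w: "(v, ws) = (w, [])"
          then have s: "(u, ss) = p"
            using comp by (simp add: p)
          have "reduced p {#}"
            using nz s w vv by (auto simp: act_trivial \<theta>_def split: if_splits)
          from extend_reduced[OF this] have "base p = p" "e = 0"
            by (simp_all add: extend_def e_def)
          then show False using x(2) s w comp by (simp add: xe)
        next
          fix w ds j assume ds: "prim w ds" "0 < j" "(v, ws) = (w, rep j ds)"
          then have wv: "w = v" "ws = rep j ds" by auto
          have u: "u = v"
            using comp(3) prim_power_head[OF ds(1)] wv by simp
          have nm: "reduced (u, ss) (replicate_mset j (cls v))"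
            using nz act_power[OF ds(1)] wv by (auto simp: \<theta>_def split: if_splits)
          then have ss: "ss \<noteq> []" "cyclic (hd ss)"
            using ds(2) by (auto simp: reduced_def)
          have "admissible Q Z (w, rep j ds @ ss)"
            using adm comp(2) wv by (simp add: p)
          then have "hd ss = hd ds"
            using power_then_arrow[OF ds(1,2)] ss(1) by blast
          then have cyc: "cycle_at (hd ss) = ds"
            using cycle_at_eq[OF ds(1)] by simp
          have "ds \<noteq> []" using prim_cycle(1)[OF ds(1)] .
          then have "hd as = hd ds"
            using comp(2) wv(2) ds(2) hd_rep[of j ds] by (simp add: hd_append rep_eq_Nil)
          then have "cs = ds"
            using cycle_at_eq[OF ds(1)] by (simp add: cs_def)
          moreover have "extend (u, ss) j = p"
            using comp(2) wv u by (simp add: extend_def cyc p)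
          then have "base p = (u, ss)" "e = j"
            using extend_reduced[OF nm] by (simp_all add: e_def)
          ultimately show False
            using x(2) comp wv by (simp add: xe)
        qed
      qed
      then show "(case x of (s, w) \<Rightarrow> act (\<theta> g s) w) = \<zero>"
        using comp(1) by (simp add: xe)
    qed simp
    then show ?thesis
      using first by simp
  qed
qed

text \<open>The elements that have a normal form modulo the nerve ideal.  They form an additive subgroup that
  contains the nerve ideal.\<close>

definition reducible :: "(('v, 'a) qpath \<Rightarrow> nat multiset \<Rightarrow> 'b) set" where
  "reducible = {\<theta> g \<oplus>\<^bsub>RQ\<^esub> y | g y. g \<in> ad.coeffs \<and> y \<in> I}"

lemma reducible_closed: "x \<in> reducible \<Longrightarrow> x \<in> carrier RQ"
  unfolding reducible_def using \<theta>_closed II.Icarr rq.RQ.a_closed by blast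

lemma reducible_add:
  assumes "x \<in> reducible" "x' \<in> reducible"
  shows "x \<oplus>\<^bsub>RQ\<^esub> x' \<in> reducible"
proof -
  obtain g y g' y' where g: "g \<in> ad.coeffs" "y \<in> I" "x = \<theta> g \<oplus>\<^bsub>RQ\<^esub> y"
      and g': "g' \<in> ad.coeffs" "y' \<in> I" "x' = \<theta> g' \<oplus>\<^bsub>RQ\<^esub> y'"
    using assms by (auto simp: reducible_def simp del: rq.path_algebra_ops)
  have "x \<oplus>\<^bsub>RQ\<^esub> x' = (\<theta> g \<oplus>\<^bsub>RQ\<^esub> \<theta> g') \<oplus>\<^bsub>RQ\<^esub> (y \<oplus>\<^bsub>RQ\<^esub> y')"
    unfolding g(3) g'(3)
    using \<theta>_closed[OF g(1)] \<theta>_closed[OF g'(1)] II.Icarr[OF g(2)] II.Icarr[OF g'(2)]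
    by (simp add: rq.RQ.a_ac del: rq.path_algebra_ops)
  also have "\<theta> g \<oplus>\<^bsub>RQ\<^esub> \<theta> g' = \<theta> (\<lambda>p. g p \<oplus> g' p)"
    by (rule \<theta>_add[symmetric])
  finally show ?thesis
    unfolding reducible_def using ad.coeffs_add[OF g(1) g'(1)] II.a_closed[OF g(2) g'(2)] by blast
qed

lemma I_reducible: "y \<in> I \<Longrightarrow> y \<in> reducible"
proof -
  assume y: "y \<in> I"
  have "y = \<theta> (\<lambda>p. \<zero>) \<oplus>\<^bsub>RQ\<^esub> y"
    unfolding \<theta>_zero using II.Icarr[OF y] by (simp add: rq.RQ.l_zero del: rq.path_algebra_ops)
  then show ?thesis
    unfolding reducible_def using ad.coeffs_zero y by blast
qed

lemma \<theta>_reducible: "g \<in> ad.coeffs \<Longrightarrow> \<theta> g \<in> reducible"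
proof -
  assume g: "g \<in> ad.coeffs"
  have "\<theta> g = \<theta> g \<oplus>\<^bsub>RQ\<^esub> \<zero>\<^bsub>RQ\<^esub>"
    using \<theta>_closed[OF g] by (simp add: rq.RQ.r_zero del: rq.path_algebra_ops)
  then show ?thesis
    unfolding reducible_def using g II.zero_closed by blast
qed

lemma reducible_cong:
  assumes "x \<in> carrier RQ" "z \<in> reducible" "x \<ominus>\<^bsub>RQ\<^esub> z \<in> I"
  shows "x \<in> reducible"
proof -
  have "x = (x \<ominus>\<^bsub>RQ\<^esub> z) \<oplus>\<^bsub>RQ\<^esub> z"
    using assms(1) reducible_closed[OF assms(2)]
    by (simp add: rq.RQ.minus_eq rq.RQ.a_assoc rq.RQ.l_neg rq.RQ.r_zero del: rq.path_algebra_ops)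
  then show ?thesis
    using reducible_add[OF I_reducible[OF assms(3)] assms(2)] by simp
qed

lemma zero_reducible: "(\<lambda>p m. \<zero>) \<in> reducible"
  using I_reducible[OF II.zero_closed] by simp

text \<open>A multiple of a base path by a power series in the allowed monomials is already in normal form.\<close>

lemma reduced_single_reducible:
  assumes p: "admissible Q Z p" and r: "r \<in> series" and nm: "\<And>m. r m \<noteq> \<zero> \<Longrightarrow> reduced p m"
  shows "rq.single p r \<in> reducible"
proof -
  define g where "g = (\<lambda>q. if admissible Q Z q \<and> base q = p
    then r (replicate_mset (exponent q) (cls (fst q))) else \<zero>)"
  have "g \<in> ad.coeffs"
    using r by (intro ad.coeffsI) (auto simp: g_def)
  moreover have "\<theta> g = rq.single p r"
  proof (intro ext)
    fix s m
    show "\<theta> g s m = rq.single p r s m"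
    proof (cases "reduced s m")
      case True
      have "g (extend s (size m)) = (if s = p then r m else \<zero>)"
        using extend_reduced[OF True] True by (auto simp: g_def reduced_def extend_def)
      then show ?thesis
        using True by (simp add: \<theta>_def rq.single_def)
    next
      case False
      then show ?thesis
        using nm[of m] by (cases "r m = \<zero>") (auto simp: \<theta>_def rq.single_def)
    qed
  qed
  ultimately show ?thesis
    using \<theta>_reducible by metis
qed

text \<open>This is \<open>f p\<close> times the generator \<open>t\<^sub>j e\<^sub>v\<close>, where \<open>v\<close> is the tail of \<open>p\<close>.\<close>

lemma variable_off_class:
  assumes p: "p \<in> paths Q" and j: "j \<in> {1..n}" "path_tail p \<notin> W j" and f: "f \<in> series"
  shows "rq.single p (pser.ps.conv (t j) f) \<in> I"
proof -
  obtain v as where pe: "p = (v, as)" by (cases p)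
  have v: "v \<in> verts Q"
    using p path_tail_in_verts by (simp add: pe)
  have "te j v \<in> gens_off j"
    using v j(2) by (auto simp: gens_off_def pe)
  then have "te j v \<in> I"
    using gens_in_I(2)[OF j(1)] by blast
  moreover have "rq.single p f \<in> carrier RQ"
    using p f by (intro rq.single_closed) auto
  ultimately have "rq.single p f \<otimes>\<^bsub>RQ\<^esub> te j v \<in> I"
    by (rule II.I_l_closed)
  moreover have "rq.single p f \<otimes>\<^bsub>RQ\<^esub> te j v = rq.single p (f \<otimes>\<^bsub>R\<^esub> t j)"
    using p v f t_series[OF j(1)] by (subst rq.single_mult) (auto simp: pe)
  moreover have "f \<otimes>\<^bsub>R\<^esub> t j = pser.ps.conv (t j) f"
    using pser.ps_conv_commute[OF f t_series[OF j(1)]] by simp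
  ultimately show ?thesis by simp
qed

text \<open>Multiplying the generator \<open>t\<^sub>i e\<^sub>v - \<sigma>\<^sub>v\<close> from the left by \<open>f p\<close>, for a path \<open>p\<close> starting at \<open>v\<close>, shows that
  \<open>t\<^sub>i f p\<close> is congruent to the sum \<open>Y\<close> of the \<open>f p c\<close> over the primitive cycles \<open>c\<close> at \<open>v\<close>.\<close>

lemma path_times_cycle_sum:
  assumes p: "(v, as) \<in> paths Q" and f: "f \<in> series"
  defines "Y \<equiv> rq.single (v, as) f \<otimes>\<^bsub>RQ\<^esub> csum v"
  shows "Y \<in> carrier RQ"
    and "prim v cs \<Longrightarrow> Y (v, cs @ as) = f"
    and "Y x \<noteq> \<zero>\<^bsub>R\<^esub> \<Longrightarrow> \<exists>cs. prim v cs \<and> x = (v, cs @ as)"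
    and "i \<in> {1..n} \<Longrightarrow> v \<in> W i \<Longrightarrow> rq.single (v, as) (pser.ps.conv (t i) f) \<ominus>\<^bsub>RQ\<^esub> Y \<in> I"
proof -
  have sc: "rq.single (v, as) f \<in> carrier RQ"
    using p f by (intro rq.single_closed) auto
  show "Y \<in> carrier RQ"
    unfolding Y_def using sc csum_closed by (rule rq.RQ.m_closed)
  note cc = rq.path_algebra_coeffs[OF csum_closed[of v]]
  have f': "f \<in> carrier R" using f by simp
  have val: "Y (path_comp (v, as) w) = f \<otimes>\<^bsub>R\<^esub> csum v w" if "composable (v, as) w" for w
    using rq.conv_single_left[OF cc f' that] by (simp add: Y_def)
  show "Y (v, cs @ as) = f" if cs: "prim v cs"
  proof -
    have "csum v (v, cs) = \<one>\<^bsub>R\<^esub>"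
      unfolding csum_apply using cs by simp
    then show ?thesis
      using val[of "(v, cs)"] prim_cycle(2,3)[OF cs] p rq.r_one[OF f'] by simp
  qed
  show "\<exists>cs. prim v cs \<and> x = (v, cs @ as)" if "Y x \<noteq> \<zero>\<^bsub>R\<^esub>"
  proof -
    have nz: "rq.conv (rq.single (v, as) f) (csum v) x \<noteq> \<zero>\<^bsub>R\<^esub>"
      using that by (simp add: Y_def)
    obtain q w where "x = path_comp q w" "rq.single (v, as) f q \<noteq> \<zero>\<^bsub>R\<^esub>" "csum v w \<noteq> \<zero>\<^bsub>R\<^esub>"
      using rq.conv_nonzero[OF rq.path_algebra_coeffs[OF sc] cc nz] by blast
    then have "q = (v, as)" "primitive_cycle Q Z w" "path_tail w = v" "x = path_comp q w"
      unfolding rq.single_def csum_apply by metis+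
    then show ?thesis
      by (cases w) auto
  qed
  show "rq.single (v, as) (pser.ps.conv (t i) f) \<ominus>\<^bsub>RQ\<^esub> Y \<in> I" if i: "i \<in> {1..n}" "v \<in> W i"
  proof -
    have v: "v \<in> verts Q"
      using p by (rule path_tail_in_verts)
    note tc = te_closed[OF i(1) v]
    have "te i v \<ominus>\<^bsub>RQ\<^esub> csum v \<in> I"
      using gens_in_I(1)[OF i(1)] i(2) unfolding gens_on_def by blast
    then have "rq.single (v, as) f \<otimes>\<^bsub>RQ\<^esub> (te i v \<ominus>\<^bsub>RQ\<^esub> csum v) \<in> I"
      using sc by (rule II.I_l_closed)
    moreover have "rq.single (v, as) f \<otimes>\<^bsub>RQ\<^esub> (te i v \<ominus>\<^bsub>RQ\<^esub> csum v)
        = rq.single (v, as) f \<otimes>\<^bsub>RQ\<^esub> te i v \<ominus>\<^bsub>RQ\<^esub> Y"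
      unfolding Y_def rq.RQ.minus_eq rq.RQ.r_distr[OF tc rq.RQ.a_inv_closed[OF csum_closed] sc]
        rq.RQ.r_minus[OF sc csum_closed] by (rule refl)
    moreover have "rq.single (v, as) f \<otimes>\<^bsub>RQ\<^esub> te i v = rq.single (v, as) (f \<otimes>\<^bsub>R\<^esub> t i)"
      using p v f t_series[OF i(1)] by (subst rq.single_mult) auto
    moreover have "f \<otimes>\<^bsub>R\<^esub> t i = pser.ps.conv (t i) f"
      using pser.ps_conv_commute[OF f t_series[OF i(1)]] by simp
    ultimately show ?thesis by simp
  qed
qed

lemma vanishing_in_I: "f \<in> carrier RQ \<Longrightarrow> (\<And>p. admissible Q Z p \<Longrightarrow> f p = \<zero>\<^bsub>R\<^esub>) \<Longrightarrow> f \<in> I"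
  using path_ideal_in_I unfolding rq.path_ideal_eq[OF Z_paths] by blast

lemma monomial_closed: "p \<in> paths Q \<Longrightarrow> r \<in> series \<Longrightarrow> rq.single p r \<in> carrier RQ"
  by (intro rq.single_closed) auto

lemma reducible_add_apply:
  "x \<in> reducible \<Longrightarrow> y \<in> reducible \<Longrightarrow> (\<lambda>p m. x p m \<oplus> y p m) \<in> reducible"
  using reducible_add[of x y] by simp

lemma series_if:
  "r \<in> series \<Longrightarrow> (\<lambda>m. if P m then r m else \<zero>) \<in> series"
  "r \<in> series \<Longrightarrow> (\<lambda>m. if P m then \<zero> else r m) \<in> series"
  by (rule pser.ps.coeffsI; simp add: pser.ps.coeffs_outside)+

text \<open>Normal forms absorb every variable in \<open>T\<close>, so only the part of the coefficient that is free of
  these variables matters.\<close>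

lemma single_series_reducible:
  assumes p: "p \<in> paths Q" and r: "r \<in> series" and T: "T \<subseteq> {1..n}"
    and step: "\<And>j f. j \<in> T \<Longrightarrow> f \<in> series \<Longrightarrow> rq.single p (pser.ps.conv (t j) f) \<in> reducible"
    and low: "rq.single p (\<lambda>m. if set_mset m \<inter> T = {} then r m else \<zero>) \<in> reducible"
  shows "rq.single p r \<in> reducible"
proof -
  let ?r0 = "\<lambda>m. if set_mset m \<inter> T = {} then r m else \<zero>"
  let ?r1 = "\<lambda>m. if set_mset m \<inter> T = {} then \<zero> else r m"
  have split: "rq.single p (\<lambda>m. f m \<oplus> g m) = (\<lambda>q m. rq.single p f q m \<oplus> rq.single p g q m)"
    if "f \<in> series" "g \<in> series" for f g
    by (intro ext) (simp add: rq.single_def)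
  have r01: "?r0 \<in> series" "?r1 \<in> series"
    using r by (rule series_if)+
  have "?r1 \<in> {f \<in> series. rq.single p f \<in> reducible}"
  proof (rule pser.ps_in_span_of_variables[of T])
    show "finite T"
      using T finite_subset by blast
    show "(\<lambda>m. \<zero>) \<in> {f \<in> series. rq.single p f \<in> reducible}"
      using zero_reducible rq.single_zero[of p] by (simp add: pser.ps.coeffs_zero)
    show "(\<lambda>m. f m \<oplus> g m) \<in> {f \<in> series. rq.single p f \<in> reducible}"
      if "f \<in> {f \<in> series. rq.single p f \<in> reducible}" "g \<in> {f \<in> series. rq.single p f \<in> reducible}" for f g
      using that reducible_add_apply by (auto simp: split pser.ps.coeffs_add)
    show "pser.ps.conv (t j) f \<in> {f \<in> series. rq.single p f \<in> reducible}"
      if "j \<in> T" "f \<in> series" for j f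
      using that step T t_series pser.ps.conv_closed by blast
  qed (use T r01 in auto)
  then have "rq.single p (\<lambda>m. ?r0 m \<oplus> ?r1 m) \<in> reducible"
    unfolding split[OF r01] using low reducible_add_apply by blast
  moreover have "(\<lambda>m. ?r0 m \<oplus> ?r1 m) = r"
    using r by auto
  ultimately show ?thesis by simp
qed

text \<open>By induction on the length: a path \<open>p c\<close> that makes more than one turn of the cycle \<open>c\<close> is congruent to
  \<open>t\<^sub>i p\<close>, as no other primitive cycle composes with \<open>p\<close>.  If there is at most one turn, then all variables
  other than \<open>t\<^sub>i\<close> kill the path.\<close>

lemma cyclic_reducible:
  assumes "admissible Q Z (v, as)" "as \<noteq> []" "cyclic (hd as)" "r \<in> series"
  shows "rq.single (v, as) r \<in> reducible"
  using assms
proof (induction "length as" arbitrary: as r rule: less_induct)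
  case less
  note pp = admissible_paths[OF less.prems(1)]
  define cs where "cs = cycle_at (hd as)"
  define e where "e = exponent (v, as)"
  obtain qs where as: "as = rep e cs @ qs" and b: "base (v, as) = (v, qs)"
      and qs: "qs \<noteq> []" "length qs \<le> length cs" "hd qs = hd as" and cs: "prim v cs"
    using cyclic_split[OF less.prems(1-3)] unfolding e_def cs_def by metis
  note i = cls_prim[OF cs]
  show ?case
  proof (cases e)
    case 0
    then have base: "base (v, as) = (v, as)"
      using as b by simp
    show ?thesis
    proof (rule single_series_reducible[OF pp less.prems(4), of "{1..n} - {cls v}"])
      show "rq.single (v, as) (pser.ps.conv (t j) f) \<in> reducible"
        if "j \<in> {1..n} - {cls v}" "f \<in> series" for j f
        using variable_off_class[OF pp, of j f] that cls_eq[of j v] I_reducible by auto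
      let ?r0 = "\<lambda>m. if set_mset m \<inter> ({1..n} - {cls v}) = {} then r m else \<zero>"
      show "rq.single (v, as) ?r0 \<in> reducible"
      proof (rule reduced_single_reducible[OF less.prems(1)])
        show "?r0 \<in> series"
          using less.prems(4) by (rule series_if)
        fix m assume "?r0 m \<noteq> \<zero>"
        then have "r m \<noteq> \<zero>" and d: "set_mset m \<inter> ({1..n} - {cls v}) = {}"
          by (auto split: if_splits)
        then have "set_mset m \<subseteq> {1..n}"
          using pser.ps.coeffs_outside[OF less.prems(4), of m] by blast
        then have "set_mset m \<subseteq> {cls v}"
          using d by blast
        then have "m = replicate_mset (size m) (cls v)"
          by (rule set_mset_subset_singletonD)
        then show "reduced (v, as) m"
          using less.prems base by (simp add: reduced_def)
      qed
    qed auto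
  next
    case (Suc k)
    define as' where "as' = rep k cs @ qs"
    have as': "as = cs @ as'" "as' \<noteq> []"
      using as qs(1) by (simp_all add: Suc as'_def)
    have adm: "admissible Q Z (v, as')"
      using admissible_append[of v cs as'] less.prems(1) as' prim_cycle(3)[OF cs] by simp
    have "hd as' = hd cs"
      using power_then_arrow[OF cs, of 1 as'] less.prems(1) as' by simp
    then have cyc: "cyclic (hd as')" "cycle_at (hd as') = cs"
      using cyclicI[OF cs] cycle_at_eq[OF cs] by simp_all
    have tr: "pser.ps.conv (t (cls v)) r \<in> series"
      using t_series[OF i(1)] less.prems(4) by (rule pser.ps.conv_closed)
    have "length as' < length as"
      using as'(1) prim_cycle(1)[OF cs] by simp
    then have IH: "rq.single (v, as') (pser.ps.conv (t (cls v)) r) \<in> reducible"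
      by (rule less.hyps[OF _ adm as'(2) cyc(1) tr])
    let ?Y = "rq.single (v, as') r \<otimes>\<^bsub>RQ\<^esub> csum v"
    note Y = path_times_cycle_sum[OF admissible_paths[OF adm] less.prems(4)]
    note sc = monomial_closed[OF pp less.prems(4)]
    have "rq.single (v, as) r \<ominus>\<^bsub>RQ\<^esub> ?Y \<in> I"
    proof (rule vanishing_in_I)
      show "rq.single (v, as) r \<ominus>\<^bsub>RQ\<^esub> ?Y \<in> carrier RQ"
        using sc Y(1) by (rule rq.RQ.minus_closed)
      fix p assume p: "admissible Q Z p"
      have "?Y p = rq.single (v, as) r p"
      proof (cases "p = (v, as)")
        case True
        then show ?thesis
          using Y(2)[OF cs] as'(1) by (simp only: rq.single_def refl if_True)
      next
        case False
        have "?Y p = \<zero>\<^bsub>R\<^esub>"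
        proof (rule ccontr)
          assume "?Y p \<noteq> \<zero>\<^bsub>R\<^esub>"
          then obtain ds where ds: "prim v ds" "p = (v, ds @ as')"
            using Y(3) by blast
          then have "hd as' = hd ds"
            using power_then_arrow[OF ds(1), of 1 as'] p as'(2) by simp
          then have "ds = cs"
            using prim_unique(2)[OF cs ds(1)] \<open>hd as' = hd cs\<close> by simp
          then show False
            using False ds(2) as'(1) by simp
        qed
        then show ?thesis
          using False by (simp only: rq.single_def if_False)
      qed
      moreover have "rq.single (v, as) r p \<in> carrier R"
        using rq.path_algebra_closed[OF sc] .
      ultimately show "(rq.single (v, as) r \<ominus>\<^bsub>RQ\<^esub> ?Y) p = \<zero>\<^bsub>R\<^esub>"
        unfolding rq.minus_apply[OF sc Y(1)] rq.minus_eq by (simp only: rq.r_neg)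
    qed
    moreover have "?Y \<in> reducible"
    proof (rule reducible_cong[OF Y(1) IH])
      have "\<ominus>\<^bsub>RQ\<^esub> (rq.single (v, as') (pser.ps.conv (t (cls v)) r) \<ominus>\<^bsub>RQ\<^esub> ?Y) \<in> I"
        using II.a_inv_closed[OF Y(4)[OF i]] .
      moreover have "\<ominus>\<^bsub>RQ\<^esub> (rq.single (v, as') (pser.ps.conv (t (cls v)) r) \<ominus>\<^bsub>RQ\<^esub> ?Y)
          = ?Y \<ominus>\<^bsub>RQ\<^esub> rq.single (v, as') (pser.ps.conv (t (cls v)) r)"
        using Y(1) monomial_closed[OF admissible_paths[OF adm] tr]
        by (simp only: rq.RQ.minus_eq rq.RQ.minus_add rq.RQ.minus_minus rq.RQ.a_inv_closed rq.RQ.a_comm)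
      ultimately show "?Y \<ominus>\<^bsub>RQ\<^esub> rq.single (v, as') (pser.ps.conv (t (cls v)) r) \<in> I"
        by simp
    qed
    ultimately show ?thesis
      using reducible_cong[OF sc] by blast
  qed
qed

text \<open>An admissible path that does not start on a primitive cycle is its own base.  If it is nontrivial, then
  every variable kills it, since no primitive cycle composes with it to an admissible path.  If it is
  trivial, then the variable of the class of its vertex, if there is one, turns it into the sum of the
  primitive cycles there, to which \<open>cyclic_reducible\<close> applies.\<close>

lemma single_reducible:
  assumes p: "p \<in> paths Q" and r: "r \<in> series"
  shows "rq.single p r \<in> reducible"
proof -
  obtain v as where pe: "p = (v, as)" by (cases p)
  consider "\<not> admissible Q Z p" | "admissible Q Z p" "as \<noteq> []" "cyclic (hd as)"
    | "admissible Q Z p" "as = [] \<or> \<not> cyclic (hd as)"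
    by blast
  then show ?thesis
  proof cases
    case 1
    have "rq.single p r \<in> I"
      by (rule vanishing_in_I[OF monomial_closed[OF p r]]) (use 1 in \<open>auto simp: rq.single_def\<close>)
    then show ?thesis by (rule I_reducible)
  next
    case 2
    then show ?thesis using cyclic_reducible r by (simp add: pe)
  next
    case 3
    have base: "base p = p"
      using 3(2) base_noncyclic[of p] by (simp add: pe)
    show ?thesis
    proof (rule single_series_reducible[OF p r, of "{1..n}"])
      let ?r0 = "\<lambda>m. if set_mset m \<inter> {1..n} = {} then r m else \<zero>"
      show "rq.single p ?r0 \<in> reducible"
      proof (rule reduced_single_reducible[OF 3(1)])
        show "?r0 \<in> series"
          using r by (rule series_if)+
        fix m assume "?r0 m \<noteq> \<zero>"
        then have "r m \<noteq> \<zero>" and d: "set_mset m \<inter> {1..n} = {}"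
          by (auto split: if_splits)
        then have "set_mset m \<subseteq> {1..n}"
          using pser.ps.coeffs_outside[OF r, of m] by blast
        then have "m = {#}"
          using d by auto
        then show "reduced p m"
          using 3(1) base by (simp add: reduced_def)
      qed
      fix j f assume j: "j \<in> {1..n}" and f: "f \<in> series"
      show "rq.single p (pser.ps.conv (t j) f) \<in> reducible"
      proof (cases "v \<in> W j")
        case False
        then show ?thesis
          using variable_off_class[OF p j _ f] I_reducible by (simp add: pe)
      next
        case v: True
        note Y = path_times_cycle_sum[OF p[unfolded pe] f]
        let ?Y = "rq.single (v, as) f \<otimes>\<^bsub>RQ\<^esub> csum v"
        have "?Y \<in> reducible"
        proof (cases "as = []")
          case False
          have "?Y \<in> I"
          proof (rule vanishing_in_I[OF Y(1)], rule ccontr)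
            fix x assume x: "admissible Q Z x" "?Y x \<noteq> \<zero>\<^bsub>R\<^esub>"
            then obtain cs where cs: "prim v cs" "x = (v, cs @ as)"
              using Y(3) by blast
            then have "hd as = hd cs"
              using power_then_arrow[OF cs(1), of 1 as] x(1) False by simp
            then show False
              using 3(2) False cyclicI[OF cs(1)] by simp
          qed
          then show ?thesis by (rule I_reducible)
        next
          case True
          show ?thesis
          proof (rule rq.path_algebra_span[OF Y(1)])
            show "(\<lambda>p. \<zero>\<^bsub>R\<^esub>) \<in> reducible"
              using zero_reducible by simp
            show "(\<lambda>p. x p \<oplus>\<^bsub>R\<^esub> y p) \<in> reducible" if "x \<in> reducible" "y \<in> reducible" for x y
              using reducible_add_apply[OF that] by simp
            fix x assume "?Y x \<noteq> \<zero>\<^bsub>R\<^esub>"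
            then obtain cs where cs: "prim v cs" "x = (v, cs @ as)"
              using Y(3) by blast
            have "rq.single (v, cs) (?Y x) \<in> reducible"
            proof (rule cyclic_reducible)
              show "admissible Q Z (v, cs)"
                using prim_power_admissible[OF cs(1), of 1] by simp
              show "?Y x \<in> series"
                using RQ_series[OF Y(1)] .
            qed (use cs prim_cycle(1) cyclicI in auto)
            then show "rq.single x (?Y x) \<in> reducible"
              using cs(2) True by simp
          qed
        qed
        then show ?thesis
          using reducible_cong[OF monomial_closed[OF p pser.ps.conv_closed[OF t_series[OF j] f]] _ ]
            Y(4)[OF j v] by (simp only: pe)
      qed
    qed auto
  qed
qed

lemma all_reducible:
  assumes "x \<in> carrier RQ"
  shows "x \<in> reducible"
proof (rule rq.path_algebra_span[OF assms])
  show "(\<lambda>p. \<zero>\<^bsub>R\<^esub>) \<in> reducible"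
    using zero_reducible by simp
  show "(\<lambda>p. x p \<oplus>\<^bsub>R\<^esub> y p) \<in> reducible" if "x \<in> reducible" "y \<in> reducible" for x y
    using reducible_add_apply[OF that] by simp
  show "rq.single p (x p) \<in> reducible" if "p \<in> paths Q" for p
    using single_reducible[OF that RQ_series[OF assms]] .
qed

text \<open>An element of the kernel has a normal form \<open>\<theta> g\<close>, and \<open>g\<close> is the image of the element.\<close>

lemma \<psi>_kernel: "a_kernel RQ \<Gamma> \<psi> = I"
proof
  show "I \<subseteq> a_kernel RQ \<Gamma> \<psi>"
    by (rule I_in_kernel)
  show "a_kernel RQ \<Gamma> \<psi> \<subseteq> I"
  proof
    fix x assume "x \<in> a_kernel RQ \<Gamma> \<psi>"
    then have x: "x \<in> carrier RQ" "\<psi> x = (\<lambda>p. \<zero>)"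
      unfolding in_kernel_iff by blast+
    obtain g y where g: "g \<in> ad.coeffs" and y: "y \<in> I" and xe: "x = \<theta> g \<oplus>\<^bsub>RQ\<^esub> y"
      using all_reducible[OF x(1)] unfolding reducible_def by blast
    have "\<psi> y = (\<lambda>p. \<zero>)"
      using subsetD[OF I_in_kernel y] unfolding in_kernel_iff by (rule conjunct2)
    then have "\<psi> x = (\<lambda>p. g p \<oplus> \<zero>)"
      unfolding xe \<psi>_add[OF \<theta>_closed[OF g] II.Icarr[OF y]] \<psi>_\<theta>[OF g] by simp
    then have "g = (\<lambda>p. \<zero>)"
      using x(2) g by (simp add: fun_eq_iff)
    then have "x = y"
      unfolding xe using \<theta>_zero rq.RQ.l_zero[OF II.Icarr[OF y]] by simp
    then show "x \<in> I" using y by simp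
  qed
qed

lemma \<psi>_surj: "\<psi> ` carrier RQ = carrier \<Gamma>"
proof
  show "\<psi> ` carrier RQ \<subseteq> carrier \<Gamma>"
    using \<psi>_closed by auto
  show "carrier \<Gamma> \<subseteq> \<psi> ` carrier RQ"
  proof
    fix g assume "g \<in> carrier \<Gamma>"
    then have "g \<in> ad.coeffs" by simp
    then show "g \<in> \<psi> ` carrier RQ"
      using \<psi>_\<theta> \<theta>_closed by (metis image_eqI)
  qed
qed

abbreviation RQ\<^sub>K where "RQ\<^sub>K \<equiv> restrict_scalars R RQ"

lemma restrict_scalars_simps:
  "carrier RQ\<^sub>K = carrier RQ" "monoid.mult RQ\<^sub>K = monoid.mult RQ" "one RQ\<^sub>K = one RQ"
  "ring.zero RQ\<^sub>K = ring.zero RQ" "ring.add RQ\<^sub>K = ring.add RQ"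
  by (simp_all add: restrict_scalars_def)

lemma restrict_scalars_ring: "ring RQ\<^sub>K"
proof -
  have "id \<in> ring_hom RQ RQ\<^sub>K"
    unfolding ring_hom_def restrict_scalars_simps by simp
  then have "ring (RQ\<^sub>K\<lparr>carrier := id ` carrier RQ, ring.zero := id \<zero>\<^bsub>RQ\<^esub>\<rparr>)"
    by (rule rq.RQ.ring_hom_imp_img_ring)
  moreover have "RQ\<^sub>K\<lparr>carrier := id ` carrier RQ, ring.zero := id \<zero>\<^bsub>RQ\<^esub>\<rparr> = RQ\<^sub>K"
    by (simp add: restrict_scalars_def)
  ultimately show ?thesis by simp
qed

lemma scalar_series:
  "k \<in> carrier K \<Longrightarrow> k \<odot>\<^bsub>R\<^esub> \<one>\<^bsub>R\<^esub> \<in> series"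
  "k \<in> carrier K \<Longrightarrow> f \<in> series \<Longrightarrow> (k \<odot>\<^bsub>R\<^esub> \<one>\<^bsub>R\<^esub>) \<otimes>\<^bsub>R\<^esub> f = (\<lambda>m. k \<otimes> f m)"
  using pser.ps.conv_one_closed
  by (simp_all add: pser.ps.coeffs_scale pser.ps.conv_scale_left pser.ps.conv_one_left)

lemma scalar_mult:
  assumes "k \<in> carrier K" "x \<in> carrier RQ"
  shows "k \<odot>\<^bsub>RQ\<^sub>K\<^esub> x = (\<lambda>p m. k \<otimes> x p m)" "k \<odot>\<^bsub>RQ\<^sub>K\<^esub> x \<in> carrier RQ"
proof -
  have e: "k \<odot>\<^bsub>RQ\<^sub>K\<^esub> x = (\<lambda>p. (k \<odot>\<^bsub>R\<^esub> \<one>\<^bsub>R\<^esub>) \<otimes>\<^bsub>R\<^esub> x p)"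
    by (simp add: restrict_scalars_def)
  show "k \<odot>\<^bsub>RQ\<^sub>K\<^esub> x = (\<lambda>p m. k \<otimes> x p m)"
    unfolding e scalar_series(2)[OF assms(1) RQ_series[OF assms(2)]] by (rule refl)
  show "k \<odot>\<^bsub>RQ\<^sub>K\<^esub> x \<in> carrier RQ"
    unfolding e using scalar_series(1)[OF assms(1)] assms(2) by (intro rq.smult_closed) auto
qed

lemma \<psi>_smult:
  assumes k: "k \<in> carrier K" and x: "x \<in> carrier RQ"
  shows "\<psi> (k \<odot>\<^bsub>RQ\<^sub>K\<^esub> x) = k \<odot>\<^bsub>\<Gamma>\<^esub> \<psi> x"
proof
  fix p
  have "\<psi> (k \<odot>\<^bsub>RQ\<^sub>K\<^esub> x) p = (\<Oplus>y\<in>ad.factorisations p. k \<otimes> (case y of (s, w) \<Rightarrow> act (x s) w))"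
    unfolding \<psi>_def scalar_mult(1)[OF k x]
    by (rule finsum_cong')
      (use act_RQ_closed[OF x] k in \<open>auto simp: act_scale[OF k RQ_series[OF x]]\<close>)
  also have "\<dots> = k \<otimes> \<psi> x p"
    unfolding \<psi>_def
    by (rule finsum_rdistr[symmetric]) (use act_RQ_closed[OF x] k in auto)
  finally show "\<psi> (k \<odot>\<^bsub>RQ\<^sub>K\<^esub> x) p = (k \<odot>\<^bsub>\<Gamma>\<^esub> \<psi> x) p"
    by simp
qed

lemma completed_string_algebra_iso:
  "is_alg_iso K (completed_string_algebra K Q Z) (quotient_algebra RQ\<^sub>K I)"
  unfolding completed_string_algebra_def
proof (rule alg_iso_of_common_image)
  show "ring C" by (rule completion_ring)
  show "ring RQ\<^sub>K" by (rule restrict_scalars_ring)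
  show "ring \<Gamma>" by (rule \<Gamma>_ring)
  show "to_admissible \<in> ring_hom C \<Gamma>" by (rule to_admissible_hom)
  show "to_admissible ` carrier C = carrier \<Gamma>" by (rule to_admissible_surj)
  show "a_kernel C \<Gamma> to_admissible = completion_closure KQ B (path_ideal K Q Z)"
    by (rule to_admissible_kernel)
  show "\<psi> \<in> ring_hom RQ\<^sub>K \<Gamma>"
    using \<psi>_hom unfolding ring_hom_def restrict_scalars_simps .
  show "\<psi> ` carrier RQ\<^sub>K = carrier \<Gamma>"
    unfolding restrict_scalars_simps by (rule \<psi>_surj)
  show "a_kernel RQ\<^sub>K \<Gamma> \<psi> = I"
    using \<psi>_kernel unfolding a_kernel_def' restrict_scalars_simps .
  show "k \<odot>\<^bsub>C\<^esub> x \<in> carrier C" if "k \<in> carrier K" "x \<in> carrier C" for k x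
    using that by (rule completion_smult_closed)
  show "k \<odot>\<^bsub>RQ\<^sub>K\<^esub> x \<in> carrier RQ\<^sub>K" if "k \<in> carrier K" "x \<in> carrier RQ\<^sub>K" for k x
    using that scalar_mult(2) unfolding restrict_scalars_simps by blast
  show "to_admissible (k \<odot>\<^bsub>C\<^esub> x) = k \<odot>\<^bsub>\<Gamma>\<^esub> to_admissible x" if "k \<in> carrier K" "x \<in> carrier C" for k x
    using that by (rule to_admissible_smult)
  show "\<psi> (k \<odot>\<^bsub>RQ\<^sub>K\<^esub> x) = k \<odot>\<^bsub>\<Gamma>\<^esub> \<psi> x" if "k \<in> carrier K" "x \<in> carrier RQ\<^sub>K" for k x
    using that \<psi>_smult unfolding restrict_scalars_simps by blast
qed

end

theorem proposition1p4:
  fixes K :: "('k, 'm) ring_scheme"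
    and Q :: "('v, 'a) pre_digraph"
    and Z :: "('v, 'a) qpath set"
    and n :: nat
    and W :: "nat \<Rightarrow> 'v set"
  assumes "field K"
    and "fin_digraph Q"
    and "biserial Q"
    and "Z \<subseteq> paths Q"
    and "\<forall>z\<in>Z. 2 \<le> path_length z"
    and "special Q Z"
    and "bij_betw W {1..n} (nerve_partition Q Z)"
  shows "let R = power_series_ring K {1..n};
             I = nerve_ideal R (ps_var K) Q Z n W
         in is_alg_iso K (completed_string_algebra K Q Z)
              (quotient_algebra (restrict_scalars R (path_algebra R Q)) I)"
proof -
  interpret K: field K by fact
  interpret fin_digraph Q by fact
  interpret nerve_setting Q Z K n W
    by unfold_locales (use assms in auto)
  show ?thesis
    unfolding Let_def by (rule completed_string_algebra_iso)
qed

end
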